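(* Let $n\ge 1$ and let $C_n(p,q)$ be either of the two-variable algebras $C_{n,+}(p,q)$, $C_{n,-}(p,q)$ over the field $\mathbb{C}(p,q)$ of rational functions in $p$ and $q$. Then the spanning set $$\mathcal{B}=\bigcup_{r=0}^{n}\mathcal{B}(r),\qquad \mathcal{B}(r)=\mathcal{C}_{n,r}\,\mathcal{B}_{r}\,e_{(r)}\,\mathcal{B}_{r}^T\,\mathcal{D}_{n,r}^T,$$ is a basis of $C_n(p,q)$ over $\mathbb{C}(p,q)$. In particular, $$\dim C_n(p,q)=\sum_{r=0}^n h_r^2\,\frac{n!}{r!}\binom{n}{r}.$$
   Context: Integers $h_r$: $h_0=h_1=1$ and $h_{r+1}=h_r+r\,h_{r-1}$. Hecke algebra: $H_n=H_n(q)$ has generators $g_i$, $1\le i<n$, and relations $g_ig_{i+1}g_i=g_{i+1}g_ig_{i+1}$, $g_ig_j=g_jg_i$ for $|i-j|\ne 1$, $g_i^2=(q-q^{-1})g_i+1$. Put $u_i=q-g_i$. Algebras: $C_{n,\pm}(p,q)$ is the unital algebra over $\mathbb{C}(p,q)$ with generators $u_i$ ($1\le i<n$) and $e_{(r)}$ ($1\le r\le n$); we put $e_{(0)}=1$ and $e=e_{(1)}$. Relations: (a) the $u_i$ satisfy the Hecke algebra relations (i.e. the $g_i=q-u_i$ satisfy the relations of $H_n$), and $e u_i=u_ie$ for $i\ge 2$; (b) the $e_{(r)}$ are idempotents, and for $1\le r<n$: $e_{(r+1)}=e_{(r)}u_re_{(r)}-\frac{p^{1/2}q^{-1}-p^{-1/2}q}{p^{1/2}-p^{-1/2}}e_{(r)}$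 for $C_{n,+}$, respectively $e_{(r+1)}=\frac{p^{1/2}q^{-1}+p^{-1/2}q}{p^{1/2}+p^{-1/2}}e_{(r)}-e_{(r)}u_re_{(r)}$ for $C_{n,-}$ (the coefficients are rational functions of $p,q$); (c) for $2\le j<r\le n$: $(u_{j-1}u_j-u_{j-1})e_{(r)}=(u_ju_{j-1}-u_j)e_{(r)}$ and $e_{(r)}(u_ju_{j-1}-u_{j-1})=e_{(r)}(u_{j-1}u_j-u_j)$ for $C_{n,+}$; $(u_{j-1}u_j+u_{j-1})e_{(r)}=(u_ju_{j-1}+u_j)e_{(r)}$ and $e_{(r)}(u_ju_{j-1}+u_{j-1})=e_{(r)}(u_{j-1}u_j+u_j)$ for $C_{n,-}$. Sets: For $w\in S_n$, $h_w$ is the product of the $g_i$ corresponding to any reduced expression of $w$ in the simple reflections $s_i=(i,i+1)$; we use the same notation for its image in $C_n$. Put $h_w^T=h_{w^{-1}}$ and $\mathcal{S}^T=\{h^T:h\in\mathcal{S}\}$ for a set $\mathcal{S}$ of elements $h_w$. $\mathcal{C}_{n,r}=\{h_w\}$ with $w$ ranging over the shortest elements of the left cosets of $S_r\subset S_n$; $\mathcal{D}_{n,r}=\{h_w\}$ with $w$ ranging over the shortest elements of the left cosets of $S_r\times S_{n-r}\subset S_n$. $\mathcal{B}_0=\mathcal{B}_1=\{1\}$ and $\mathcal{B}_{r+1}=\mathcal{B}_r\cup\bigcup_{j=1}^r g_jg_{j+1}\cdots g_r\,\mathcal{B}_{r-1}$ (all its elements are of the form $h_w$, $w\in S_{r+1}$).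 Products of sets mean sets of all products, indexed by tuples of factors. *)

theory Defs
  imports
    "HOL-Library.Poly_Mapping"
    "HOL-Computational_Algebra.Polynomial"
    "HOL-Computational_Algebra.Fraction_Field"
    "HOL-Combinatorics.Permutations"
    "HOL-Algebra.QuotRing"
    "Jordan_Normal_Form.VS_Connect"
begin

section \<open>Algebras given by generators and relations\<close>

datatype 'x free_monoid = Word (letters: "'x list")

instantiation free_monoid :: (type) monoid_add
begin
definition "0 = Word []"
definition "v + w = Word (letters v @ letters w)"
instance
  by standard (auto simp: zero_free_monoid_def plus_free_monoid_def)
end

lemma letters_zero [simp]: "letters 0 = []"
  by (simp add: zero_free_monoid_def)

lemma letters_plus [simp]: "letters (v + w) = letters v @ letters w"
  by (simp add: plus_free_monoid_def)

text \<open>The type \<open>'x free_monoid \<Rightarrow>\<^sub>0 'k\<close> with the convolution product of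
  \<open>Poly_Mapping\<close> is the free unital algebra on all of \<open>'x\<close>; the record below is its
  subalgebra on the generators in \<open>X\<close>.\<close>

abbreviation const :: "'k \<Rightarrow> 'x free_monoid \<Rightarrow>\<^sub>0 'k::zero"
  where "const c \<equiv> Poly_Mapping.single 0 c"

abbreviation gen :: "'x \<Rightarrow> 'x free_monoid \<Rightarrow>\<^sub>0 'k::zero_neq_one"
  where "gen x \<equiv> Poly_Mapping.single (Word [x]) 1"

definition free_algebra :: "'x set \<Rightarrow> ('k::field, 'x free_monoid \<Rightarrow>\<^sub>0 'k) module"
  where "free_algebra X =
    \<lparr>carrier = {f. \<forall>w \<in> Poly_Mapping.keys f. set (letters w) \<subseteq> X},
     mult = (*), one = 1, zero = 0, add = (+), smult = (\<lambda>c f. const c * f)\<rparr>"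

text \<open>The quotient ring \<open>A Quot I\<close> together with the induced scalar multiplication.\<close>

definition quotient_algebra :: "('k, 'a) module \<Rightarrow> 'a set \<Rightarrow> ('k, 'a set) module"
  where "quotient_algebra A I =
    \<lparr>carrier = carrier (A Quot I), mult = mult (A Quot I), one = one (A Quot I),
     zero = zero (A Quot I), add = add (A Quot I),
     smult = (\<lambda>c M. \<Union>x\<in>M. I +>\<^bsub>A\<^esub> (c \<odot>\<^bsub>A\<^esub> x))\<rparr>"

text \<open>A relation is a pair of a left and a right hand side; ideals of \<open>HOL-Algebra\<close> are
  two-sided.\<close>

definition relation_ideal ::
    "'x set \<Rightarrow> (('x free_monoid \<Rightarrow>\<^sub>0 'k::field) \<times> ('x free_monoid \<Rightarrow>\<^sub>0 'k)) set \<Rightarrow>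
      ('x free_monoid \<Rightarrow>\<^sub>0 'k) set"
  where "relation_ideal X R = genideal (free_algebra X) {l - r | l r. (l, r) \<in> R}"

definition presented_algebra ::
    "'x set \<Rightarrow> (('x free_monoid \<Rightarrow>\<^sub>0 'k::field) \<times> ('x free_monoid \<Rightarrow>\<^sub>0 'k)) set \<Rightarrow>
      ('k, ('x free_monoid \<Rightarrow>\<^sub>0 'k) set) module"
  where "presented_algebra X R = quotient_algebra (free_algebra X) (relation_ideal X R)"

lemma free_algebra_simps [simp]:
  "mult (free_algebra X) = (*)" "one (free_algebra X) = 1"
  "zero (free_algebra X) = 0" "add (free_algebra X) = (+)"
  "smult (free_algebra X) = (\<lambda>c f. const c * f)"
  by (simp_all add: free_algebra_def)

lemma carrier_free_algebra:
  "f \<in> carrier (free_algebra X) \<longleftrightarrow> (\<forall>w \<in> Poly_Mapping.keys f. set (letters w) \<subseteq> X)"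
  by (simp add: free_algebra_def)

lemma const_in_carrier [simp]: "const c \<in> carrier (free_algebra X)"
  by (auto simp: carrier_free_algebra split: if_splits)

lemma gen_in_carrier [simp]: "gen x \<in> carrier (free_algebra X) \<longleftrightarrow> x \<in> X"
  by (simp add: carrier_free_algebra)

lemma one_in_carrier [simp]: "1 \<in> carrier (free_algebra X)"
  using const_in_carrier[of "1" X] by simp

lemma zero_in_carrier [simp]: "0 \<in> carrier (free_algebra X)"
  by (simp add: carrier_free_algebra)

lemma add_in_carrier [simp]:
  "\<lbrakk>f \<in> carrier (free_algebra X); g \<in> carrier (free_algebra X)\<rbrakk>
    \<Longrightarrow> f + g \<in> carrier (free_algebra X)"
  using Poly_Mapping.keys_add[of f g] by (auto simp: carrier_free_algebra)

lemma mult_in_carrier [simp]: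
  "\<lbrakk>f \<in> carrier (free_algebra X); g \<in> carrier (free_algebra X)\<rbrakk>
    \<Longrightarrow> f * g \<in> carrier (free_algebra X)"
  using Poly_Mapping.keys_mult[of f g] by (fastforce simp: carrier_free_algebra)

lemma diff_in_carrier [simp]:
  assumes "f \<in> carrier (free_algebra X)" "g \<in> carrier (free_algebra X)"
  shows "f - g \<in> carrier (free_algebra X)"
proof -
  have "f - g = f + const (- 1) * g"
    by (simp add: Poly_Mapping.single_uminus)
  then show ?thesis using assms by (metis add_in_carrier mult_in_carrier const_in_carrier)
qed

lemma uminus_in_carrier [simp]:
  "f \<in> carrier (free_algebra X) \<Longrightarrow> - f \<in> carrier (free_algebra X)"
  using diff_in_carrier[of 0 X f] by simp

lemma ring_free_algebra: "ring (free_algebra X)"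
proof (rule ringI)
  show "abelian_group (free_algebra X)"
    by (rule abelian_groupI) (auto simp: algebra_simps intro!: bexI[of _ "- _"])
  show "Group.monoid (free_algebra X)"
    by (rule monoidI) (auto simp: algebra_simps)
qed (auto simp: algebra_simps)

lemma const_mult_assoc: "const (c * d) * f = const c * (const d * f)"
  by (simp add: Poly_Mapping.mult_single flip: mult.assoc)

lemma ideal_relation_ideal:
  assumes "\<And>l r. (l, r) \<in> R \<Longrightarrow> l \<in> carrier (free_algebra X) \<and> r \<in> carrier (free_algebra X)"
  shows "ideal (relation_ideal X R) (free_algebra X)"
  unfolding relation_ideal_def
  by (rule ring.genideal_ideal[OF ring_free_algebra]) (use assms in auto)

lemma presented_algebra_simps:
  "carrier (presented_algebra X R) = carrier (free_algebra X Quot relation_ideal X R)"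
  "mult (presented_algebra X R) = mult (free_algebra X Quot relation_ideal X R)"
  "one (presented_algebra X R) = one (free_algebra X Quot relation_ideal X R)"
  "zero (presented_algebra X R) = zero (free_algebra X Quot relation_ideal X R)"
  "add (presented_algebra X R) = add (free_algebra X Quot relation_ideal X R)"
  by (simp_all add: presented_algebra_def quotient_algebra_def)

context
  fixes X :: "'x set" and R :: "(('x free_monoid \<Rightarrow>\<^sub>0 'k::field) \<times> ('x free_monoid \<Rightarrow>\<^sub>0 'k)) set"
  assumes R: "\<And>l r. (l, r) \<in> R \<Longrightarrow>
    l \<in> carrier (free_algebra X) \<and> r \<in> carrier (free_algebra X)"
begin

interpretation I: ideal "relation_ideal X R" "free_algebra X"
  by (rule ideal_relation_ideal[OF R])

lemma ring_presented_algebra: "ring (presented_algebra X R)"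
proof -
  interpret Q: ring "free_algebra X Quot relation_ideal X R"
    by (rule I.quotient_is_ring)
  show ?thesis
  proof (rule ringI, goal_cases)
    case 1
    show ?case
    proof (rule abelian_groupI; unfold presented_algebra_simps)
      fix x assume x: "x \<in> carrier (free_algebra X Quot relation_ideal X R)"
      show "\<exists>y\<in>carrier (free_algebra X Quot relation_ideal X R).
          y \<oplus>\<^bsub>free_algebra X Quot relation_ideal X R\<^esub> x = \<zero>\<^bsub>free_algebra X Quot relation_ideal X R\<^esub>"
        using Q.a_inv_closed[OF x] Q.l_neg[OF x] by blast
    qed (fact Q.a_closed Q.zero_closed Q.a_assoc Q.a_comm Q.l_zero)+
  next
    case 2
    show ?case
      by (rule monoidI; unfold presented_algebra_simps)
        (fact Q.m_closed Q.one_closed Q.m_assoc Q.l_one Q.r_one)+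
  qed (unfold presented_algebra_simps, (fact Q.l_distr Q.r_distr)+)
qed

lemma smult_presented_algebra:
  assumes f: "f \<in> carrier (free_algebra X)"
  shows "c \<odot>\<^bsub>presented_algebra X R\<^esub> (relation_ideal X R +>\<^bsub>free_algebra X\<^esub> f)
    = relation_ideal X R +>\<^bsub>free_algebra X\<^esub> (const c * f)"
proof -
  let ?A = "free_algebra X" and ?I = "relation_ideal X R"
  have rep: "?I +>\<^bsub>?A\<^esub> (const c * x) = ?I +>\<^bsub>?A\<^esub> (const c * f)" if x: "x \<in> ?I +>\<^bsub>?A\<^esub> f" for x
  proof -
    obtain i where i: "i \<in> ?I" "x = i + f"
      using x by (auto simp: a_r_coset_def')
    have "const c * i \<in> ?I"
      using I.I_l_closed[OF i(1) const_in_carrier[of c]] by simp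
    then have "const c * x \<in> ?I +>\<^bsub>?A\<^esub> (const c * f)"
      using i(2) by (auto simp: a_r_coset_def' distrib_left)
    then show ?thesis
      by (rule I.a_repr_independence[OF _ mult_in_carrier[OF const_in_carrier f] I.a_subgroup, symmetric])
  qed
  have self: "f \<in> ?I +>\<^bsub>?A\<^esub> f"
    using f by (rule I.a_rcos_self)
  have "c \<odot>\<^bsub>presented_algebra X R\<^esub> (?I +>\<^bsub>?A\<^esub> f) =
      (\<Union>x\<in>?I +>\<^bsub>?A\<^esub> f. ?I +>\<^bsub>?A\<^esub> (const c * x))"
    by (simp add: presented_algebra_def quotient_algebra_def)
  also have "\<dots> = (\<Union>x\<in>?I +>\<^bsub>?A\<^esub> f. ?I +>\<^bsub>?A\<^esub> (const c * f))"
    by (rule SUP_cong) (simp_all only: rep)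
  also have "\<dots> = ?I +>\<^bsub>?A\<^esub> (const c * f)"
    using self by blast
  finally show ?thesis .
qed

lemma vectorspace_presented_algebra: "vectorspace class_ring (presented_algebra X R)"
proof -
  let ?A = "free_algebra X" and ?I = "relation_ideal X R"
  let ?cl = "\<lambda>f. ?I +>\<^bsub>?A\<^esub> f"
  interpret P: ring "presented_algebra X R" by (rule ring_presented_algebra)
  have car: "carrier (presented_algebra X R) = ?cl ` carrier ?A"
    by (auto simp: presented_algebra_simps FactRing_def A_RCOSETS_def' )
  have add: "?cl f \<oplus>\<^bsub>presented_algebra X R\<^esub> ?cl g = ?cl (f + g)"
    if "f \<in> carrier ?A" "g \<in> carrier ?A" for f g
    using I.a_rcos_sum[OF that] by (simp add: presented_algebra_simps FactRing_def)
  have ex: "\<exists>f\<in>carrier ?A. x = ?cl f" if "x \<in> carrier (presented_algebra X R)" for x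
    using that by (simp add: car image_iff)
  have "module class_ring (presented_algebra X R)"
  proof (rule moduleI)
    show "cring (class_ring :: 'k ring)"
      by (rule domain.axioms(1)[OF field.axioms(1)[OF class_field]])
    show "abelian_group (presented_algebra X R)"
      by (rule P.abelian_group_axioms)
  next
    fix a :: 'k and x
    assume "x \<in> carrier (presented_algebra X R)"
    then obtain f where f: "f \<in> carrier ?A" "x = ?cl f"
      using ex by blast
    show "a \<odot>\<^bsub>presented_algebra X R\<^esub> x \<in> carrier (presented_algebra X R)"
      unfolding f(2) smult_presented_algebra[OF f(1)] car
      by (rule imageI) (simp add: f(1))
    show "\<one>\<^bsub>class_ring\<^esub> \<odot>\<^bsub>presented_algebra X R\<^esub> x = x"
      unfolding f(2) smult_presented_algebra[OF f(1)] by simp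
  next
    fix a b :: 'k and x
    assume "x \<in> carrier (presented_algebra X R)"
    then obtain f where f: "f \<in> carrier ?A" "x = ?cl f"
      using ex by blast
    note cf = mult_in_carrier[OF const_in_carrier f(1)]
    show "(a \<oplus>\<^bsub>class_ring\<^esub> b) \<odot>\<^bsub>presented_algebra X R\<^esub> x =
        a \<odot>\<^bsub>presented_algebra X R\<^esub> x \<oplus>\<^bsub>presented_algebra X R\<^esub> b \<odot>\<^bsub>presented_algebra X R\<^esub> x"
      unfolding f(2) smult_presented_algebra[OF f(1)] add[OF cf cf]
      by (simp add: Poly_Mapping.single_add distrib_right)
    show "(a \<otimes>\<^bsub>class_ring\<^esub> b) \<odot>\<^bsub>presented_algebra X R\<^esub> x =
        a \<odot>\<^bsub>presented_algebra X R\<^esub> (b \<odot>\<^bsub>presented_algebra X R\<^esub> x)"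
      unfolding f(2) smult_presented_algebra[OF f(1)] smult_presented_algebra[OF cf]
      by (simp add: const_mult_assoc)
  next
    fix a :: 'k and x y
    assume "x \<in> carrier (presented_algebra X R)" "y \<in> carrier (presented_algebra X R)"
    then obtain f h where f: "f \<in> carrier ?A" "x = ?cl f" and h: "h \<in> carrier ?A" "y = ?cl h"
      using ex by blast
    show "a \<odot>\<^bsub>presented_algebra X R\<^esub> (x \<oplus>\<^bsub>presented_algebra X R\<^esub> y) =
        a \<odot>\<^bsub>presented_algebra X R\<^esub> x \<oplus>\<^bsub>presented_algebra X R\<^esub> a \<odot>\<^bsub>presented_algebra X R\<^esub> y"
      unfolding f(2) h(2) add[OF f(1) h(1)] smult_presented_algebra[OF f(1)]
        smult_presented_algebra[OF h(1)] smult_presented_algebra[OF add_in_carrier[OF f(1) h(1)]]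
        add[OF mult_in_carrier[OF const_in_carrier f(1)] mult_in_carrier[OF const_in_carrier h(1)]]
      by (simp add: distrib_left)
  qed
  then show ?thesis
    by (rule vectorspace.intro) (rule class_field)
qed

end


section \<open>The algebras\<close>

text \<open>The field of rational functions in \<open>p\<close> and \<open>q\<close>, as the fraction field of \<open>\<complex>[p][q]\<close>.\<close>

type_synonym cpq = "complex poly poly fract"

definition pvar :: cpq where "pvar = Fract [:[:0, 1:]:] 1"
definition qvar :: cpq where "qvar = Fract [:0, 1:] 1"

text \<open>\<open>U i\<close> stands for \<open>u\<^sub>i\<close>, and \<open>E r\<close> for \<open>e\<^bsub>(r)\<^esub>\<close>.\<close>

datatype generator = U nat | E nat

datatype variant = Plus | Minus

type_synonym free_elem = "generator free_monoid \<Rightarrow>\<^sub>0 cpq"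

definition generators :: "nat \<Rightarrow> generator set"
  where "generators n = U ` {1..<n} \<union> E ` {1..n}"

definition u_gen :: "nat \<Rightarrow> free_elem"
  where "u_gen i = gen (U i)"

definition g_gen :: "nat \<Rightarrow> free_elem"
  where "g_gen i = const qvar - u_gen i"

definition e_gen :: "nat \<Rightarrow> free_elem"
  where "e_gen r = (if r = 0 then 1 else gen (E r))"

text \<open>The coefficients
  \<open>(p\<^sup>1\<^sup>/\<^sup>2 q\<^sup>-\<^sup>1 \<mp> p\<^sup>-\<^sup>1\<^sup>/\<^sup>2 q) / (p\<^sup>1\<^sup>/\<^sup>2 \<mp> p\<^sup>-\<^sup>1\<^sup>/\<^sup>2)\<close>, with numerator and denominator
  multiplied by \<open>p\<^sup>1\<^sup>/\<^sup>2\<close>.\<close>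

fun coefficient :: "variant \<Rightarrow> cpq" where
  "coefficient Plus = (pvar / qvar - qvar) / (pvar - 1)"
| "coefficient Minus = (pvar / qvar + qvar) / (pvar + 1)"

definition hecke_relations :: "nat \<Rightarrow> (free_elem \<times> free_elem) set"
  where "hecke_relations n =
    {(g_gen i * g_gen (i + 1) * g_gen i, g_gen (i + 1) * g_gen i * g_gen (i + 1)) | i. 1 \<le> i \<and> i + 1 < n} \<union>
    {(g_gen i * g_gen j, g_gen j * g_gen i) | i j. i \<in> {1..<n} \<and> j \<in> {1..<n} \<and> \<bar>int i - int j\<bar> \<noteq> 1} \<union>
    {(g_gen i * g_gen i, const (qvar - 1 / qvar) * g_gen i + 1) | i. i \<in> {1..<n}}"

definition commutation_relations :: "nat \<Rightarrow> (free_elem \<times> free_elem) set"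
  where "commutation_relations n = {(e_gen 1 * u_gen i, u_gen i * e_gen 1) | i. 2 \<le> i \<and> i < n}"

definition idempotent_relations :: "nat \<Rightarrow> (free_elem \<times> free_elem) set"
  where "idempotent_relations n = {(e_gen r * e_gen r, e_gen r) | r. 1 \<le> r \<and> r \<le> n}"

fun recursion_relations :: "variant \<Rightarrow> nat \<Rightarrow> (free_elem \<times> free_elem) set" where
  "recursion_relations Plus n =
    {(e_gen (r + 1), e_gen r * u_gen r * e_gen r - const (coefficient Plus) * e_gen r) | r. 1 \<le> r \<and> r < n}"
| "recursion_relations Minus n =
    {(e_gen (r + 1), const (coefficient Minus) * e_gen r - e_gen r * u_gen r * e_gen r) | r. 1 \<le> r \<and> r < n}"

fun absorption_relations :: "variant \<Rightarrow> nat \<Rightarrow> (free_elem \<times> free_elem) set" where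
  "absorption_relations Plus n =
    {((u_gen (j - 1) * u_gen j - u_gen (j - 1)) * e_gen r, (u_gen j * u_gen (j - 1) - u_gen j) * e_gen r)
      | j r. 2 \<le> j \<and> j < r \<and> r \<le> n} \<union>
    {(e_gen r * (u_gen j * u_gen (j - 1) - u_gen (j - 1)), e_gen r * (u_gen (j - 1) * u_gen j - u_gen j))
      | j r. 2 \<le> j \<and> j < r \<and> r \<le> n}"
| "absorption_relations Minus n =
    {((u_gen (j - 1) * u_gen j + u_gen (j - 1)) * e_gen r, (u_gen j * u_gen (j - 1) + u_gen j) * e_gen r)
      | j r. 2 \<le> j \<and> j < r \<and> r \<le> n} \<union>
    {(e_gen r * (u_gen j * u_gen (j - 1) + u_gen (j - 1)), e_gen r * (u_gen (j - 1) * u_gen j + u_gen j))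
      | j r. 2 \<le> j \<and> j < r \<and> r \<le> n}"

definition relations :: "variant \<Rightarrow> nat \<Rightarrow> (free_elem \<times> free_elem) set"
  where "relations s n = hecke_relations n \<union> commutation_relations n \<union>
    idempotent_relations n \<union> recursion_relations s n \<union> absorption_relations s n"

definition Calg :: "variant \<Rightarrow> nat \<Rightarrow> (cpq, free_elem set) module"
  where "Calg s n = presented_algebra (generators n) (relations s n)"

definition Calg_class :: "variant \<Rightarrow> nat \<Rightarrow> free_elem \<Rightarrow> free_elem set"
  where "Calg_class s n x =
    relation_ideal (generators n) (relations s n) +>\<^bsub>free_algebra (generators n)\<^esub> x"

lemma u_in_carrier [simp]: "i \<in> {1..<n} \<Longrightarrow> u_gen i \<in> carrier (free_algebra (generators n))"
  by (auto simp: u_gen_def generators_def)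

lemma g_in_carrier [simp]: "i \<in> {1..<n} \<Longrightarrow> g_gen i \<in> carrier (free_algebra (generators n))"
  by (simp add: g_gen_def)

lemma e_in_carrier [simp]: "r \<le> n \<Longrightarrow> e_gen r \<in> carrier (free_algebra (generators n))"
  by (auto simp: e_gen_def generators_def)

lemma relations_in_carrier:
  assumes "(x, y) \<in> relations s n"
  shows "x \<in> carrier (free_algebra (generators n)) \<and> y \<in> carrier (free_algebra (generators n))"
proof -
  have u: "u_gen i \<in> carrier (free_algebra (generators n))"
    and g: "g_gen i \<in> carrier (free_algebra (generators n))" if "1 \<le> i" "i < n" for i
    using that by simp_all
  have e: "e_gen r \<in> carrier (free_algebra (generators n))" if "r \<le> n" for r
    using that by simp
  note closed = u g e mult_in_carrier add_in_carrier diff_in_carrier const_in_carrier one_in_carrier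
  from assms consider "(x, y) \<in> hecke_relations n" | "(x, y) \<in> commutation_relations n"
    | "(x, y) \<in> idempotent_relations n" | "(x, y) \<in> recursion_relations s n"
    | "(x, y) \<in> absorption_relations s n"
    unfolding relations_def by blast
  then show ?thesis
  proof cases
    case 1
    then show ?thesis unfolding hecke_relations_def
      by (elim UnE CollectE exE conjE Pair_inject; hypsubst; intro conjI closed) auto
  next
    case 2
    then show ?thesis unfolding commutation_relations_def
      by (elim UnE CollectE exE conjE Pair_inject; hypsubst; intro conjI closed) auto
  next
    case 3
    then show ?thesis unfolding idempotent_relations_def
      by (elim UnE CollectE exE conjE Pair_inject; hypsubst; intro conjI closed) auto
  next
    case 4
    then show ?thesis
      by (cases s; simp only: recursion_relations.simps;
        elim UnE CollectE exE conjE Pair_inject; hypsubst; intro conjI closed) auto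
  next
    case 5
    then show ?thesis
      by (cases s; simp only: absorption_relations.simps;
        elim UnE CollectE exE conjE Pair_inject; hypsubst; intro conjI closed) auto
  qed
qed

lemma ring_Calg: "ring (Calg s n)"
  unfolding Calg_def by (rule ring_presented_algebra) (rule relations_in_carrier)

lemma vectorspace_Calg: "vectorspace class_ring (Calg s n)"
  unfolding Calg_def by (rule vectorspace_presented_algebra) (rule relations_in_carrier)


section \<open>The spanning set\<close>

subsection \<open>Reduced expressions\<close>

text \<open>A list \<open>[i\<^sub>1, \<dots>, i\<^sub>k]\<close> stands for the product of simple reflections
  \<open>s\<^bsub>i\<^sub>1\<^esub> \<circ> \<dots> \<circ> s\<^bsub>i\<^sub>k\<^esub>\<close>.\<close>

definition is_expression :: "nat \<Rightarrow> nat list \<Rightarrow> (nat \<Rightarrow> nat) \<Rightarrow> bool"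
  where "is_expression n is w \<longleftrightarrow>
    set is \<subseteq> {1..<n} \<and> foldr (\<lambda>i f. Transposition.transpose i (i + 1) \<circ> f) is id = w"

definition coxeter_length :: "nat \<Rightarrow> (nat \<Rightarrow> nat) \<Rightarrow> nat"
  where "coxeter_length n w = (LEAST k. \<exists>is. is_expression n is w \<and> length is = k)"

definition is_reduced_expression :: "nat \<Rightarrow> nat list \<Rightarrow> (nat \<Rightarrow> nat) \<Rightarrow> bool"
  where "is_reduced_expression n is w \<longleftrightarrow>
    is_expression n is w \<and> length is = coxeter_length n w"

definition shortest_left_coset_elements :: "nat \<Rightarrow> (nat \<Rightarrow> nat) set \<Rightarrow> (nat \<Rightarrow> nat) set"
  where "shortest_left_coset_elements n G =
    {w. w permutes {1..n} \<and> (\<forall>v\<in>G. coxeter_length n w \<le> coxeter_length n (w \<circ> v))}"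

subsection \<open>Sets of elements of the algebra\<close>

definition g_prod :: "variant \<Rightarrow> nat \<Rightarrow> nat list \<Rightarrow> free_elem set"
  where "g_prod s n is =
    foldr (\<lambda>i x. Calg_class s n (g_gen i) \<otimes>\<^bsub>Calg s n\<^esub> x) is \<one>\<^bsub>Calg s n\<^esub>"

text \<open>By Matsumoto's theorem and the braid relations the result does not depend on which reduced
  expression is chosen.\<close>

definition h_elem :: "variant \<Rightarrow> nat \<Rightarrow> (nat \<Rightarrow> nat) \<Rightarrow> free_elem set"
  where "h_elem s n w = g_prod s n (SOME is. is_reduced_expression n is w)"

definition transpose_set :: "variant \<Rightarrow> nat \<Rightarrow> free_elem set set \<Rightarrow> free_elem set set"
  where "transpose_set s n S =
    {h_elem s n (inv_into UNIV w) | w. w permutes {1..n} \<and> h_elem s n w \<in> S}"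

definition C_set :: "variant \<Rightarrow> nat \<Rightarrow> nat \<Rightarrow> free_elem set set"
  where "C_set s n r = h_elem s n ` shortest_left_coset_elements n {v. v permutes {1..r}}"

definition D_set :: "variant \<Rightarrow> nat \<Rightarrow> nat \<Rightarrow> free_elem set set"
  where "D_set s n r = h_elem s n ` shortest_left_coset_elements n
    {v \<circ> v' | v v'. v permutes {1..r} \<and> v' permutes {r + 1..n}}"

text \<open>The index of the defining recursion
  \<open>\<B>\<^bsub>r+1\<^esub> = \<B>\<^sub>r \<union> \<Union>\<^sub>j g\<^sub>j \<dots> g\<^sub>r \<B>\<^bsub>r-1\<^esub>\<close> is shifted by one.\<close>

fun B_set :: "variant \<Rightarrow> nat \<Rightarrow> nat \<Rightarrow> free_elem set set" where
  "B_set s n 0 = {\<one>\<^bsub>Calg s n\<^esub>}"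
| "B_set s n (Suc 0) = {\<one>\<^bsub>Calg s n\<^esub>}"
| "B_set s n (Suc (Suc r)) = B_set s n (Suc r) \<union>
    (\<Union>j\<in>{1..Suc r}. {g_prod s n [j..<Suc (Suc r)]} <#>\<^bsub>Calg s n\<^esub> B_set s n r)"

definition basis_block :: "variant \<Rightarrow> nat \<Rightarrow> nat \<Rightarrow> free_elem set set"
  where "basis_block s n r =
    C_set s n r <#>\<^bsub>Calg s n\<^esub> B_set s n r <#>\<^bsub>Calg s n\<^esub> {Calg_class s n (e_gen r)}
      <#>\<^bsub>Calg s n\<^esub> transpose_set s n (B_set s n r)
      <#>\<^bsub>Calg s n\<^esub> transpose_set s n (D_set s n r)"

definition basis_set :: "variant \<Rightarrow> nat \<Rightarrow> free_elem set set"
  where "basis_set s n = (\<Union>r\<in>{0..n}. basis_block s n r)"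

text \<open>The indexing of \<open>basis_set\<close> by tuples of factors.\<close>

definition factor_tuples ::
    "variant \<Rightarrow> nat \<Rightarrow>
      (nat \<times> free_elem set \<times> free_elem set \<times> free_elem set \<times> free_elem set) set"
  where "factor_tuples s n =
    (SIGMA r:{0..n}. C_set s n r \<times> B_set s n r \<times>
      transpose_set s n (B_set s n r) \<times> transpose_set s n (D_set s n r))"

fun tuple_product ::
    "variant \<Rightarrow> nat \<Rightarrow>
      nat \<times> free_elem set \<times> free_elem set \<times> free_elem set \<times> free_elem set \<Rightarrow> free_elem set"
  where "tuple_product s n (r, c, b, b', d) =
    c \<otimes>\<^bsub>Calg s n\<^esub> b \<otimes>\<^bsub>Calg s n\<^esub> Calg_class s n (e_gen r) \<otimes>\<^bsub>Calg s n\<^esub> b' \<otimes>\<^bsub>Calg s n\<^esub> d"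

lemma basis_set_eq_image: "basis_set s n = tuple_product s n ` factor_tuples s n"
proof (rule Set.set_eqI)
  fix x
  have mem: "y \<in> A <#>\<^bsub>Calg s n\<^esub> B \<longleftrightarrow> (\<exists>a\<in>A. \<exists>b\<in>B. y = a \<otimes>\<^bsub>Calg s n\<^esub> b)" for y A B
    by (auto simp: set_mult_def)
  have bex: "(\<exists>y\<in>A <#>\<^bsub>Calg s n\<^esub> B. P y) \<longleftrightarrow> (\<exists>a\<in>A. \<exists>b\<in>B. P (a \<otimes>\<^bsub>Calg s n\<^esub> b))" for A B P
    by (auto simp: set_mult_def)
  have single: "(\<exists>y\<in>{a}. P y) \<longleftrightarrow> P a" for a :: "free_elem set" and P
    by simp
  have "x \<in> basis_set s n \<longleftrightarrow>
    (\<exists>r\<in>{0..n}. \<exists>c\<in>C_set s n r. \<exists>b\<in>B_set s n r. \<exists>b'\<in>transpose_set s n (B_set s n r).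
      \<exists>d\<in>transpose_set s n (D_set s n r). x = tuple_product s n (r, c, b, b', d))"
    unfolding basis_set_def basis_block_def UN_iff tuple_product.simps
    by (subst mem, subst bex, subst bex, subst bex, subst single, rule refl)
  also have "\<dots> \<longleftrightarrow> x \<in> tuple_product s n ` factor_tuples s n"
    unfolding factor_tuples_def by (simp add: image_iff Bex_def del: tuple_product.simps)
  finally show "x \<in> basis_set s n \<longleftrightarrow> x \<in> tuple_product s n ` factor_tuples s n" .
qed

fun h_num :: "nat \<Rightarrow> nat" where
  "h_num 0 = 1"
| "h_num (Suc 0) = 1"
| "h_num (Suc (Suc r)) = h_num (Suc r) + Suc r * h_num r"

end

theory Submission imports Defs begin

text \<open>There are \<open>h\<^bsub>2n\<^esub>\<close> involutions of \<open>2 n\<close> points, and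
  \<open>h\<^bsub>2n\<^esub> = \<Sum>\<^sub>r h\<^sub>r\<^sup>2 n!/r! (n choose r)\<close>: arrange the points in two rows of length \<open>n\<close> and sort the
  involutions by the number \<open>n - r\<close> of arcs between the rows. Since there are no more tuples of factors
  than this, it is enough that their products span and that the dimension is at least \<open>h\<^bsub>2n\<^esub>\<close>.

  Spanning: the products \<open>x e\<^bsub>(r)\<^esub> y\<close> with \<open>x\<close>, \<open>y\<close> in the Hecke algebra span a left ideal containing \<open>1\<close>,
  because the recursion for the \<open>e\<^bsub>(r)\<^esub>\<close> rewrites \<open>e g\<^sub>1 \<dots> g\<^sub>k e\<^bsub>(k)\<^esub>\<close> in terms of \<open>e\<^bsub>(k+1)\<^esub>\<close> and
  \<open>e\<^bsub>(k)\<^esub>\<close>. Coset decompositions of \<open>x\<close> and \<open>y\<close> leave factors from \<open>H\<^sub>r\<close> next to \<open>e\<^bsub>(r)\<^esub>\<close>, and the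
  relations (c) reduce these to \<open>\<B>\<^sub>r\<close>.

  Dimension: the algebra acts on the functions on involutions of \<open>\<nat>\<close>, the \<open>g\<^sub>i\<close> by a deformation of
  conjugation and \<open>e\<^bsub>(r)\<^esub>\<close> by removing the first \<open>r\<close> points and putting \<open>r\<close> fixed points in their place.
  Let \<open>\<omega>\<close> join every \<open>i < n\<close> to \<open>n + i\<close>. The algebra commutes with the Hecke operators of the
  second row, and on \<open>\<omega>\<close> these agree with those of the first row. So the functionals
  \<open>f \<mapsto> (x f) \<omega>\<close> are stable under both rows, and they turn out to contain the evaluation at
  every involution of \<open>2 n\<close> points.\<close>

section \<open>Hecke operators on involutions\<close>

text \<open>The Hecke operators imitate a Clifford algebra: for \<open>a = 0\<close>, on the span of
  the involutions, exchanging two neighbouring fixed points gives the arc minus the two fixed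
  points, like generators for which x y + y x is a contraction. Positions are counted from 0, so
  \<open>op_g a i\<close> belongs to g_(i+1). Involutions of all natural numbers are used so that
  adjoining a fixed point at 0 is an operator \<open>op_fix\<close> on one fixed space, with
  one-sided inverse \<open>op_P a t\<close>. Then e_(r) is \<open>op_fix ^ r * op_P a t ^ r\<close>,
  and its recursion comes from
  \<open>op_P a t * op_g a 0 * op_fix = sc t - op_fix * op_P a t\<close>. This dictates
  \<open>t\<close>, which has to be nonzero because e_(r) brings in the factor \<open>t ^ r\<close>
  at omega. Of the relations (c), those with the idempotent on the right only concern three fixed
  points; those with it on the left involve \<open>op_P\<close> on all arcs and are the harder half.
  Not every evaluation is reached directly: \<open>hecke\<close> leads from a fixed pair to an arc
  with coefficient 1, but back only with coefficient \<open>- a\<close>. Hence all inductions move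
  towards involutions with fewer arcs inside a row.\<close>

typedef involution = "{w :: nat \<Rightarrow> nat. \<forall>x. w (w x) = x}"
  morphisms ap Involution
  by (rule exI[of _ id]) simp

setup_lifting type_definition_involution

lemma ap_ap [simp]: "ap w (ap w x) = x"
  using ap[of w] by simp

lemma ap_eq_iff [simp]: "ap w x = ap w y \<longleftrightarrow> x = y"
  by (metis ap_ap)

lemma involution_eqI: "(\<And>x. ap v x = ap w x) \<Longrightarrow> v = w"
  by (metis ap_inject ext)

definition sw :: "nat \<Rightarrow> nat \<Rightarrow> nat"
  where "sw i x = (if x = i then Suc i else if x = Suc i then i else x)"

lemma sw_sw [simp]: "sw i (sw i x) = x"
  by (auto simp: sw_def)

lemma sw_simps [simp]: "sw i i = Suc i" "sw i (Suc i) = i"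
  by (simp_all add: sw_def)

lemma sw_other: "x \<noteq> i \<Longrightarrow> x \<noteq> Suc i \<Longrightarrow> sw i x = x"
  by (simp add: sw_def)

lemma sw_braid: "sw i (sw (Suc i) (sw i x)) = sw (Suc i) (sw i (sw (Suc i) x))"
  by (auto simp: sw_def)

lemma sw_less:
  assumes "x \<noteq> y" "\<not> (x \<in> {j, Suc j} \<and> y \<in> {j, Suc j})"
  shows "sw j x < sw j y \<longleftrightarrow> x < y"
  using assms by (auto simp: sw_def)

lemma sw_commute: "Suc i < j \<Longrightarrow> sw i (sw j x) = sw j (sw i x)"
  by (auto simp: sw_def)

lift_definition cj :: "nat \<Rightarrow> involution \<Rightarrow> involution"
  is "\<lambda>i w x. sw i (w (sw i x))"
  by simp

lemma ap_cj [simp]: "ap (cj i w) x = sw i (ap w (sw i x))"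
  by transfer simp

definition both_fixed :: "nat \<Rightarrow> involution \<Rightarrow> bool"
  where "both_fixed i w \<longleftrightarrow> ap w i = i \<and> ap w (Suc i) = Suc i"

text \<open>In both cases \<open>w\<close> commutes with \<open>sw i\<close>, so their composite is
  again an involution.\<close>

lemma toggle_involutive:
  assumes w: "\<forall>x. w (w x) = x"
    and c: "(w i = i \<and> w (Suc i) = Suc i) \<or> w i = Suc i"
  shows "w (sw i (w (sw i x))) = x"
proof -
  have wi: "w (Suc i) = i" if "w i = Suc i"
    using w that by metis
  have "w (sw i x) = sw i (w x)"
  proof (cases "x = i \<or> x = Suc i")
    case True
    then show ?thesis using c wi by auto
  next
    case False
    have "w x \<noteq> i" "w x \<noteq> Suc i"
      using False c w wi by metis+
    with False show ?thesis by (simp add: sw_other)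
  qed
  then show ?thesis by (simp only: sw_sw w)
qed

text \<open>Outside the two cases the composite with \<open>sw i\<close> need not be an involution,
  so the value falls back to \<open>w\<close>; \<open>hecke\<close> never consults it there.\<close>

lift_definition toggle :: "nat \<Rightarrow> involution \<Rightarrow> involution"
  is "\<lambda>i w. if (w i = i \<and> w (Suc i) = Suc i) \<or> w i = Suc i then (\<lambda>x. w (sw i x)) else w"
  using toggle_involutive by simp

lemma ap_toggle: "ap (toggle i w) x =
    (if both_fixed i w \<or> ap w i = Suc i then ap w (sw i x) else ap w x)"
  unfolding both_fixed_def by transfer simp

text \<open>Conjugation by \<open>s\<^sub>i\<close> leaves an involution \<open>w\<close> unchanged that fixes or exchanges \<open>i\<close> and \<open>i + 1\<close>;
  the first two cases mix such a \<open>w\<close> with \<open>w s\<^sub>i\<close>.\<close>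

definition hecke :: "'k::comm_ring_1 \<Rightarrow> nat \<Rightarrow> (involution \<Rightarrow> 'k) \<Rightarrow> involution \<Rightarrow> 'k"
  where "hecke a i f w =
    (if both_fixed i w then f (toggle i w) - f w
     else if ap w i = Suc i then (1 + a) * f w - a * f (toggle i w)
     else if ap w i < ap w (Suc i) then f (cj i w)
     else f (cj i w) + a * f w)"

lemma ap_eq_swap: "ap w x = y \<longleftrightarrow> x = ap w y"
  by (metis ap_ap)

lemma ap_eq_Suc: "ap w x = Suc x \<longleftrightarrow> ap w (Suc x) = x"
  by (metis ap_ap)

lemma cj_cj [simp]: "cj i (cj i w) = w"
  by (rule involution_eqI) simp

lemma both_fixed_toggle: "both_fixed i (toggle i w) \<longleftrightarrow> ap w i = Suc i"
  using ap_eq_Suc[of w i] by (auto simp: both_fixed_def ap_toggle)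

lemma arc_toggle: "ap (toggle i w) i = Suc i \<longleftrightarrow> both_fixed i w"
  using ap_eq_Suc[of w i] by (auto simp: both_fixed_def ap_toggle)

lemma toggle_toggle [simp]: "toggle i (toggle i w) = w"
  by (rule involution_eqI)
    (auto simp: ap_toggle both_fixed_toggle arc_toggle, simp add: both_fixed_def)

text \<open>On a pair \<open>w\<close>, \<open>toggle i w\<close> the operator has rows (-1, 1) and
  (-a, 1 + a), on a pair \<open>w\<close>, \<open>cj i w\<close> it has rows (0, 1) and (1, a). Both
  matrices have trace \<open>a\<close> and determinant -1.\<close>

lemma hecke_quadratic: "hecke a i (hecke a i f) w = a * hecke a i f w + f w"
proof -
  consider (f) "both_fixed i w" | (a) "\<not> both_fixed i w" "ap w i = Suc i"
    | (n) "\<not> both_fixed i w" "ap w i \<noteq> Suc i" by blast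
  then show ?thesis
  proof cases
    case f
    then have "ap w i \<noteq> Suc i" by (auto simp: both_fixed_def)
    then have "\<not> both_fixed i (toggle i w)" "ap (toggle i w) i = Suc i"
      using f by (auto simp: arc_toggle both_fixed_toggle)
    with f show ?thesis by (simp add: hecke_def algebra_simps)
  next
    case a
    then have "both_fixed i (toggle i w)"
      using a by (auto simp: both_fixed_toggle)
    with a show ?thesis by (simp add: hecke_def algebra_simps)
  next
    case n
    have s: "ap w (Suc i) \<noteq> i" using n by (metis ap_ap)
    have "\<not> both_fixed i (cj i w)" "ap (cj i w) i \<noteq> Suc i"
      using n s by (auto simp: both_fixed_def sw_def split: if_splits)
    moreover have "ap (cj i w) i < ap (cj i w) (Suc i) \<longleftrightarrow> \<not> ap w i < ap w (Suc i)"
      using n s ap_eq_iff[of w i "Suc i"] by (auto simp: both_fixed_def sw_def simp del: ap_eq_iff split: if_splits)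
    ultimately show ?thesis using n by (simp add: hecke_def algebra_simps)
  qed
qed

lemma cj_braid: "cj (Suc i) (cj i (cj (Suc i) w)) = cj i (cj (Suc i) (cj i w))"
  by (rule involution_eqI) (simp add: sw_braid)

lemma cj_commute: "Suc i < j \<Longrightarrow> cj j (cj i w) = cj i (cj j w)"
  by (rule involution_eqI) (simp add: sw_commute[of i j])

lemma toggle_cj_commute:
  assumes "Suc i < j \<or> Suc j < i"
  shows "toggle i (cj j w) = cj j (toggle i w)"
proof -
  have s: "sw i (sw j x) = sw j (sw i x)" for x
    using assms by (auto simp: sw_def)
  have a: "sw j y = i \<longleftrightarrow> y = i" "sw j y = Suc i \<longleftrightarrow> y = Suc i" for y
    using assms by (auto simp: sw_def)
  have b: "sw j i = i" "sw j (Suc i) = Suc i"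
    using assms by (auto simp: sw_def)
  show ?thesis
    by (rule involution_eqI) (simp add: ap_toggle both_fixed_def a b s)
qed

lemma toggle_toggle_commute:
  assumes "Suc i < j \<or> Suc j < i"
  shows "toggle i (toggle j w) = toggle j (toggle i w)"
proof -
  have s: "sw i (sw j x) = sw j (sw i x)" for x
    using assms by (auto simp: sw_def)
  have b: "sw j i = i" "sw j (Suc i) = Suc i" "sw i j = j" "sw i (Suc j) = Suc j"
    using assms by (auto simp: sw_def)
  show ?thesis
    by (rule involution_eqI) (auto simp: ap_toggle both_fixed_def b s)
qed

text \<open>Acting at \<open>j\<close> does not disturb the case distinction at \<open>i\<close>
  unless two arcs join \<open>{i, Suc i}\<close> to \<open>{j, Suc j}\<close>. In that case the
  comparison does change, but \<open>cj i w = cj j w\<close>, and the two operators coincide on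
  \<open>w\<close> and this conjugate.\<close>

lemma hecke_commute:
  assumes ij: "Suc i < j"
  shows "hecke a i (hecke a j f) w = hecke a j (hecke a i f) w"
proof (cases "ap w i \<in> {j, Suc j} \<and> ap w (Suc i) \<in> {j, Suc j}")
  case True
  have "ap w i \<noteq> ap w (Suc i)" by simp
  with True consider "ap w i = j" "ap w (Suc i) = Suc j" | "ap w i = Suc j" "ap w (Suc i) = j"
    by (metis insertE singletonD)
  then show ?thesis
  proof cases
    case 1
    then have 2: "ap w j = i" "ap w (Suc j) = Suc i" by (metis ap_ap)+
    have "ap (cj i w) x = ap (cj j w) x" for x
      using 1 2 ij ap_eq_iff[of w x i] ap_eq_iff[of w x "Suc i"] ap_eq_iff[of w x j] ap_eq_iff[of w x "Suc j"]
      unfolding ap_cj sw_def by (simp del: ap_eq_iff)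
    then have e: "cj i w = cj j w" by (rule involution_eqI)
    have "cj i (cj j w) = w" by (simp flip: e)
    moreover note e
    moreover have "\<not> both_fixed i w" "\<not> both_fixed j w" "\<not> both_fixed i (cj j w)" "\<not> both_fixed j (cj j w)"
      using 1 2 ij by (auto simp: both_fixed_def sw_def)
    moreover have "ap (cj j w) i = Suc j" "ap (cj j w) (Suc i) = j" "ap (cj j w) j = Suc i" "ap (cj j w) (Suc j) = i"
      using 1 2 ij by (auto simp: sw_def)
    ultimately show ?thesis using 1 2 ij by (simp add: hecke_def)
  next
    case 2
    then have 1: "ap w j = Suc i" "ap w (Suc j) = i" by (metis ap_ap)+
    have "ap (cj i w) x = ap (cj j w) x" for x
      using 1 2 ij ap_eq_iff[of w x i] ap_eq_iff[of w x "Suc i"] ap_eq_iff[of w x j] ap_eq_iff[of w x "Suc j"]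
      unfolding ap_cj sw_def by (simp del: ap_eq_iff)
    then have e: "cj i w = cj j w" by (rule involution_eqI)
    have "cj i (cj j w) = w" by (simp flip: e)
    moreover note e
    moreover have "\<not> both_fixed i w" "\<not> both_fixed j w" "\<not> both_fixed i (cj j w)" "\<not> both_fixed j (cj j w)"
      using 1 2 ij by (auto simp: both_fixed_def sw_def)
    moreover have "ap (cj j w) i = j" "ap (cj j w) (Suc i) = Suc j" "ap (cj j w) j = i" "ap (cj j w) (Suc j) = Suc i"
      using 1 2 ij by (auto simp: sw_def)
    ultimately show ?thesis using 1 2 ij by (simp add: hecke_def)
  qed
next
  case False
  have F2: "\<not> (ap w j \<in> {i, Suc i} \<and> ap w (Suc j) \<in> {i, Suc i})"
  proof
    assume *: "ap w j \<in> {i, Suc i} \<and> ap w (Suc j) \<in> {i, Suc i}"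
    have "ap w j \<noteq> ap w (Suc j)" by simp
    with * consider "ap w j = i" "ap w (Suc j) = Suc i" | "ap w j = Suc i" "ap w (Suc j) = i"
      by (metis insertE singletonD)
    then have "(ap w i = j \<and> ap w (Suc i) = Suc j) \<or> (ap w i = Suc j \<and> ap w (Suc i) = j)"
      using ap_ap[of w j] ap_ap[of w "Suc j"] by cases (simp_all del: ap_ap)
    with False show False by auto
  qed
  have s: "sw j i = i" "sw j (Suc i) = Suc i" "sw i j = j" "sw i (Suc j) = Suc j"
    using ij by (auto simp: sw_def)
  have p: "sw j y = i \<longleftrightarrow> y = i" "sw j y = Suc i \<longleftrightarrow> y = Suc i"
     "sw i y = j \<longleftrightarrow> y = j" "sw i y = Suc j \<longleftrightarrow> y = Suc j" for y
    using ij by (auto simp: sw_def)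
  have t: "both_fixed i (toggle j w) = both_fixed i w" "both_fixed j (toggle i w) = both_fixed j w"
    "both_fixed i (cj j w) = both_fixed i w" "both_fixed j (cj i w) = both_fixed j w"
    "ap (toggle j w) i = ap w i" "ap (toggle j w) (Suc i) = ap w (Suc i)"
    "ap (toggle i w) j = ap w j" "ap (toggle i w) (Suc j) = ap w (Suc j)"
    "ap (cj j w) i = Suc i \<longleftrightarrow> ap w i = Suc i" "ap (cj i w) j = Suc j \<longleftrightarrow> ap w j = Suc j"
    by (auto simp: both_fixed_def ap_toggle s p)
  have l: "ap (cj j w) i < ap (cj j w) (Suc i) \<longleftrightarrow> ap w i < ap w (Suc i)"
    unfolding ap_cj s by (rule sw_less[OF _ False]) simp
  have l': "ap (cj i w) j < ap (cj i w) (Suc j) \<longleftrightarrow> ap w j < ap w (Suc j)"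
    unfolding ap_cj s by (rule sw_less[OF _ F2]) simp
  have c: "toggle i (cj j w) = cj j (toggle i w)" "toggle j (cj i w) = cj i (toggle j w)"
    "toggle i (toggle j w) = toggle j (toggle i w)" "cj j (cj i w) = cj i (cj j w)"
    using ij by (simp_all add: toggle_cj_commute toggle_toggle_commute cj_commute)
  show ?thesis
    unfolding hecke_def t l l' c by (simp add: algebra_simps)
qed

text \<open>Conjugation by s_(i+1) s_i carries s_(i+1) to s_i.\<close>

lemma toggle_cj_cj: "toggle i (cj (Suc i) (cj i w)) = cj (Suc i) (cj i (toggle (Suc i) w))"
proof (rule involution_eqI)
  fix x
  have 1: "both_fixed i (cj (Suc i) (cj i w)) \<longleftrightarrow> both_fixed (Suc i) w"
    by (auto simp: both_fixed_def sw_def split: if_splits)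
  have 2: "ap (cj (Suc i) (cj i w)) i = Suc i \<longleftrightarrow> ap w (Suc i) = Suc (Suc i)"
    by (auto simp: sw_def split: if_splits)
  have 3: "sw (Suc i) (sw i (sw (Suc i) x)) = sw i (sw (Suc i) (sw i x))" for x
    by (simp add: sw_braid)
  show "ap (toggle i (cj (Suc i) (cj i w))) x = ap (cj (Suc i) (cj i (toggle (Suc i) w))) x"
    unfolding ap_toggle 1 2 by (simp add: ap_toggle 3)
qed

lemma toggle_cj_cj': "toggle (Suc i) (cj i (cj (Suc i) w)) = cj i (cj (Suc i) (toggle i w))"
proof (rule involution_eqI)
  fix x
  have 1: "both_fixed (Suc i) (cj i (cj (Suc i) w)) \<longleftrightarrow> both_fixed i w"
    by (auto simp: both_fixed_def sw_def split: if_splits)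
  have 2: "ap (cj i (cj (Suc i) w)) (Suc i) = Suc (Suc i) \<longleftrightarrow> ap w i = Suc i"
    by (auto simp: sw_def split: if_splits)
  have 3: "sw (Suc i) (sw i (sw (Suc i) x)) = sw i (sw (Suc i) (sw i x))" for x
    by (simp add: sw_braid)
  show "ap (toggle (Suc i) (cj i (cj (Suc i) w))) x = ap (cj i (cj (Suc i) (toggle i w))) x"
    unfolding ap_toggle 1 2 by (simp add: ap_toggle 3)
qed

text \<open>On both sides \<open>i\<close> and \<open>Suc (Suc i)\<close> become joined by an arc
  around the fixed point \<open>Suc i\<close>.\<close>

lemma toggle_cj_fixed:
  assumes "ap w i = i" "ap w (Suc i) = Suc i" "ap w (Suc (Suc i)) = Suc (Suc i)"
  shows "cj (Suc i) (toggle i w) = cj i (toggle (Suc i) w)"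
proof (rule involution_eqI)
  fix x
  have "x = i \<or> x = Suc i \<or> x = Suc (Suc i) \<or> (x \<noteq> i \<and> x \<noteq> Suc i \<and> x \<noteq> Suc (Suc i))"
    by blast
  moreover have "ap w x \<noteq> i" "ap w x \<noteq> Suc i" "ap w x \<noteq> Suc (Suc i)"
    if "x \<noteq> i" "x \<noteq> Suc i" "x \<noteq> Suc (Suc i)"
    using that assms by (simp_all add: ap_eq_swap[of w x])
  ultimately show "ap (cj (Suc i) (toggle i w)) x = ap (cj i (toggle (Suc i) w)) x"
    using assms by (auto simp: ap_toggle both_fixed_def sw_def)
qed

lemma cj_fixed:
  assumes "both_fixed i w \<or> ap w i = Suc i"
  shows "cj i w = w"
proof (rule involution_eqI)
  fix x
  have s: "ap w (Suc i) = i" if "ap w i = Suc i" using that ap_eq_Suc by blast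
  then have "ap w x \<noteq> i" "ap w x \<noteq> Suc i" if "x \<noteq> i" "x \<noteq> Suc i"
    using that assms by (auto simp: ap_eq_swap[of w x] both_fixed_def)
  then show "ap (cj i w) x = ap w x"
    using assms s by (auto simp: both_fixed_def sw_def)
qed

lemma cj_toggle_cj: "cj i (toggle (Suc i) (cj i w)) = cj (Suc i) (toggle i (cj (Suc i) w))"
  using arg_cong[OF toggle_cj_cj[of i "cj i w"], of "cj (Suc i)"] by simp

text \<open>Both sides depend on the images \<open>A\<close>, \<open>B\<close>, \<open>C\<close> of
  three consecutive points. These can meet the block \<open>{i, j, k}\<close> in fourteen ways, and
  an image outside enters only through its side of the block and its order relative to the others.
  Evaluating every test leaves identities between conjugates and toggles of
  \<open>w\<close>.\<close>

lemma hecke_braid: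
  "hecke a i (hecke a (Suc i) (hecke a i f)) w = hecke a (Suc i) (hecke a i (hecke a (Suc i) f)) w"
proof -
  define j k where jk: "j = Suc i" "k = Suc j"
  define A B C where ABC: "A = ap w i" "B = ap w j" "C = ap w k"
  have ne: "A \<noteq> B" "A \<noteq> C" "B \<noteq> C"
    by (simp_all add: ABC jk)
  have swap: "A = j \<longleftrightarrow> B = i" "A = k \<longleftrightarrow> C = i" "B = k \<longleftrightarrow> C = j"
    unfolding ABC by (metis ap_ap)+
  have lt: "i < j" "j < k" "i < k" "i \<noteq> j" "j \<noteq> k" "i \<noteq> k" "j \<noteq> i" "k \<noteq> j" "k \<noteq> i"
    "\<not> j < i" "\<not> k < j" "\<not> k < i"
    by (simp_all add: jk)
  \<comment> \<open>A comparison is stored with all its consequences in both directions, so that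
    \<open>simp only\<close> decides every test in \<open>hecke\<close> without arithmetic.\<close>
  define dist where "dist X Y \<longleftrightarrow> X < Y \<and> \<not> Y < X \<and> X \<noteq> Y \<and> Y \<noteq> X" for X Y :: nat
  have dist: "dist X Y \<or> dist Y X" if "X \<noteq> Y" for X Y
    using that unfolding dist_def by linarith
  have dist_lt: "dist X Y \<longleftrightarrow> X < Y" for X Y
    unfolding dist_def by linarith
  define bel where "bel X \<longleftrightarrow> dist X i \<and> dist X j \<and> dist X k" for X
  define abv where "abv X \<longleftrightarrow> dist i X \<and> dist j X \<and> dist k X" for X
  have out: "bel X \<or> abv X" if "X \<notin> {i, j, k}" for X
    using that jk unfolding dist_def bel_def abv_def by auto
  have out2: "(bel X \<and> bel Y \<and> dist X Y) \<or> (bel X \<and> bel Y \<and> dist Y X) \<or> (bel X \<and> abv Y \<and> dist X Y)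
      \<or> (abv X \<and> bel Y \<and> dist Y X) \<or> (abv X \<and> abv Y \<and> dist X Y) \<or> (abv X \<and> abv Y \<and> dist Y X)"
    if "X \<notin> {i, j, k}" "Y \<notin> {i, j, k}" "X \<noteq> Y" for X Y
  proof -
    have "bel U \<Longrightarrow> abv V \<Longrightarrow> dist U V" for U V
      unfolding bel_def abv_def dist_lt by linarith
    then show ?thesis
      using out[OF that(1)] out[OF that(2)] dist[OF that(3)] by blast
  qed
  have dist3: "(dist A B \<and> dist B C \<and> dist A C) \<or> (dist A C \<and> dist C B \<and> dist A B)
      \<or> (dist B A \<and> dist A C \<and> dist B C) \<or> (dist B C \<and> dist C A \<and> dist B A)
      \<or> (dist C A \<and> dist A B \<and> dist C B) \<or> (dist C B \<and> dist B A \<and> dist C A)"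
    using ne unfolding dist_lt
    by (cases A B rule: linorder_cases; cases B C rule: linorder_cases; cases A C rule: linorder_cases) simp_all
  note ev = hecke_def both_fixed_def ap_toggle ap_cj ap_ap sw_def jk[symmetric] ABC[symmetric]
    simp_thms if_False if_True
  note braid = cj_braid[of i, folded jk] toggle_cj_cj[of i, folded jk] toggle_cj_cj'[of i, folded jk]
     cj_toggle_cj[of i, folded jk] cj_cj toggle_toggle
  \<comment> \<open>If all three images stay in the block, \<open>w\<close> is either a
    \<open>v\<close> fixing all three points or \<open>v\<close> with one arc added. These equations
    relate the four involutions; the last four cases use them.\<close>
  have triv: "cj i v = v" "cj j v = v" "cj j (toggle i v) = cj i (toggle j v)"
    "cj j (cj i (toggle j v)) = toggle i v" "cj i (cj j (toggle i v)) = toggle j v"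
    if v: "ap v i = i" "ap v j = j" "ap v k = k" for v
  proof -
    show "cj i v = v" "cj j v = v"
      using v by (simp_all add: cj_fixed both_fixed_def jk)
    show e: "cj j (toggle i v) = cj i (toggle j v)"
      unfolding jk(1) by (rule toggle_cj_fixed) (use v in \<open>simp_all add: jk\<close>)
    show "cj j (cj i (toggle j v)) = toggle i v"
      by (simp flip: e)
    show "cj i (cj j (toggle i v)) = toggle j v"
      by (simp add: e)
  qed
  consider "A \<notin> {i, j, k}" "B \<notin> {i, j, k}" "C \<notin> {i, j, k}"
    | "A = i" "B \<notin> {i, j, k}" "C \<notin> {i, j, k}"
    | "B = j" "A \<notin> {i, j, k}" "C \<notin> {i, j, k}"
    | "C = k" "A \<notin> {i, j, k}" "B \<notin> {i, j, k}"
    | "A = i" "B = j" "C \<notin> {i, j, k}"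
    | "A = i" "C = k" "B \<notin> {i, j, k}"
    | "B = j" "C = k" "A \<notin> {i, j, k}"
    | "A = j" "C \<notin> {i, j, k}"
    | "A = k" "B \<notin> {i, j, k}"
    | "B = k" "A \<notin> {i, j, k}"
    | "A = i" "B = j" "C = k"
    | "A = i" "B = k"
    | "A = j" "C = k"
    | "A = k" "B = j"
    using ne swap lt(4-6) by (metis insert_iff empty_iff)
  then have "hecke a i (hecke a j (hecke a i f)) w = hecke a j (hecke a i (hecke a j f)) w"
    (is ?goal)
  proof cases
    case 1
    then have o: "A \<noteq> i \<and> A \<noteq> j \<and> A \<noteq> k \<and> B \<noteq> i \<and> B \<noteq> j \<and> B \<noteq> k \<and> C \<noteq> i \<and> C \<noteq> j \<and> C \<noteq> k"
      by simp
    show ?goal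
      using o dist3
      unfolding dist_def bel_def abv_def
      by (elim disjE; simp only: ev lt cong: if_weak_cong; (simp only: braid)?; (simp (no_asm) add: algebra_simps)?)
  next
    case 2
    show ?goal
      using 2(1) out2[OF 2(2,3) ne(3)]
      unfolding dist_def bel_def abv_def
      by (elim disjE; simp only: ev lt cong: if_weak_cong; (simp only: braid)?; (simp (no_asm) add: algebra_simps)?)
  next
    case 3
    show ?goal
      using 3(1) out2[OF 3(2,3) ne(2)]
      unfolding dist_def bel_def abv_def
      by (elim disjE; simp only: ev lt cong: if_weak_cong; (simp only: braid)?; (simp (no_asm) add: algebra_simps)?)
  next
    case 4
    show ?goal
      using 4(1) out2[OF 4(2,3) ne(1)]
      unfolding dist_def bel_def abv_def
      by (elim disjE; simp only: ev lt cong: if_weak_cong; (simp only: braid)?; (simp (no_asm) add: algebra_simps)?)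
  next
    case 5
    show ?goal
      using 5(1,2) out[OF 5(3)]
      unfolding dist_def bel_def abv_def
      by (elim disjE; simp only: ev lt cong: if_weak_cong; (simp only: braid)?; (simp (no_asm) add: algebra_simps)?)
  next
    case 6
    show ?goal
      using 6(1,2) out[OF 6(3)]
      unfolding dist_def bel_def abv_def
      by (elim disjE; simp only: ev lt cong: if_weak_cong; (simp only: braid)?; (simp (no_asm) add: algebra_simps)?)
  next
    case 7
    show ?goal
      using 7(1,2) out[OF 7(3)]
      unfolding dist_def bel_def abv_def
      by (elim disjE; simp only: ev lt cong: if_weak_cong; (simp only: braid)?; (simp (no_asm) add: algebra_simps)?)
  next
    case 8
    have B: "B = i" using swap 8 by simp
    show ?goal
      using 8(1) B out[OF 8(2)]
      unfolding dist_def bel_def abv_def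
      by (elim disjE; simp only: ev lt cong: if_weak_cong; (simp only: braid)?; (simp (no_asm) add: algebra_simps)?)
  next
    case 9
    have C: "C = i" using swap 9 by simp
    show ?goal
      using 9(1) C out[OF 9(2)]
      unfolding dist_def bel_def abv_def
      by (elim disjE; simp only: ev lt cong: if_weak_cong; (simp only: braid)?; (simp (no_asm) add: algebra_simps)?)
  next
    case 10
    have C: "C = j" using swap 10 by simp
    show ?goal
      using 10(1) C out[OF 10(2)]
      unfolding dist_def bel_def abv_def
      by (elim disjE; simp only: ev lt cong: if_weak_cong; (simp only: braid)?; (simp (no_asm) add: algebra_simps)?)
  next
    case 11
    note F = triv[OF 11[unfolded ABC]]
    show ?goal
      using 11 F
      
      by (simp only: ev lt cong: if_weak_cong; (simp only: braid)?; (simp (no_asm) add: algebra_simps)?)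
  next
    case 12
    have C: "C = j" using swap 12 by simp
    have "ap (toggle j w) i = i" "ap (toggle j w) j = j" "ap (toggle j w) k = k"
      using 12 C lt unfolding ABC by (simp_all add: ap_toggle both_fixed_def sw_def jk)
    note v = triv[OF this, unfolded toggle_toggle]
    show ?goal
      using 12 C v
      
      by (simp only: ev lt cong: if_weak_cong; (simp only: braid)?; (simp (no_asm) add: algebra_simps)?)
  next
    case 13
    have B: "B = i" using swap 13 by simp
    have "ap (toggle i w) i = i" "ap (toggle i w) j = j" "ap (toggle i w) k = k"
      using 13 B lt unfolding ABC by (simp_all add: ap_toggle both_fixed_def sw_def jk)
    note v = triv[OF this, unfolded toggle_toggle]
    show ?goal
      using 13 B v
      
      by (simp only: ev lt cong: if_weak_cong; (simp only: braid)?; (simp (no_asm) add: algebra_simps)?)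
  next
    case 14
    have C: "C = i" using swap 14 by simp
    \<comment> \<open>The arc from \<open>i\<close> to \<open>k\<close> is conjugated to one from
      \<open>j\<close> to \<open>k\<close>, which the toggle removes.\<close>
    have "ap (toggle j (cj i w)) i = i" "ap (toggle j (cj i w)) j = j" "ap (toggle j (cj i w)) k = k"
      using 14 C lt unfolding ABC by (simp_all add: ap_toggle both_fixed_def sw_def jk)
    note v = triv[OF this, unfolded toggle_toggle]
    show ?goal
      using 14 C v
      
      by (simp only: ev lt cong: if_weak_cong; (simp only: braid)?; (simp (no_asm) add: algebra_simps)?)
  qed
  then show ?thesis by (simp only: jk)
qed

section \<open>The ring of linear operators on functions of involutions\<close>

typedef (overloaded) 'k operator =
    "{T :: (involution \<Rightarrow> 'k::comm_ring_1) \<Rightarrow> involution \<Rightarrow> 'k.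
      \<forall>c f g. T (\<lambda>w. c * f w + g w) = (\<lambda>w. c * T f w + T g w)}"
  morphisms app Operator
  by (rule exI[of _ id]) simp

setup_lifting type_definition_operator

lemma app_linear: "app T (\<lambda>w. c * f w + g w) = (\<lambda>w. c * app T f w + app T g w)"
  using app[of T] by blast

lemma operator_eqI: "(\<And>f w. app S f w = app T f w) \<Longrightarrow> S = T"
  by (metis app_inject ext)

instantiation operator :: (comm_ring_1) ring_1
begin
lift_definition zero_operator :: "'a operator" is "\<lambda>f w. 0" by simp
lift_definition one_operator :: "'a operator" is "\<lambda>f. f" by simp
lift_definition plus_operator :: "'a operator \<Rightarrow> 'a operator \<Rightarrow> 'a operator"
  is "\<lambda>S T f w. S f w + T f w" by (simp add: fun_eq_iff algebra_simps)
lift_definition minus_operator :: "'a operator \<Rightarrow> 'a operator \<Rightarrow> 'a operator"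
  is "\<lambda>S T f w. S f w - T f w" by (simp add: fun_eq_iff algebra_simps)
lift_definition uminus_operator :: "'a operator \<Rightarrow> 'a operator"
  is "\<lambda>T f w. - T f w" by (simp add: fun_eq_iff algebra_simps)
text \<open>An operator acts on functionals on the span of the involutions; products are taken in the
  order in which the transposed maps act on this span.\<close>
lift_definition times_operator :: "'a operator \<Rightarrow> 'a operator \<Rightarrow> 'a operator"
  is "\<lambda>S T f. T (S f)" by simp
instance
proof
  fix R S T :: "'a operator"
  have add: "app T (\<lambda>w. g w + h w) w = app T g w + app T h w" for g h w
    using fun_cong[OF app_linear[of T 1 g h], of w] by simp
  show "R * S * T = R * (S * T)" "1 * R = R" "R * 1 = R" "R + S + T = R + (S + T)" "R + S = S + R"
    "0 + R = R" "- R + R = 0" "R - S = R + - S"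
    by (transfer; simp add: fun_eq_iff algebra_simps)+
  show "(R + S) * T = R * T + S * T"
    by (rule operator_eqI, unfold times_operator.rep_eq plus_operator.rep_eq, rule add)
  show "R * (S + T) = R * S + R * T"
    by transfer simp
  show "(0::'a operator) \<noteq> 1"
    by transfer (metis zero_neq_one)
qed
end

lift_definition sc :: "'k::comm_ring_1 \<Rightarrow> 'k operator" is "\<lambda>c f w. c * f w"
  by (simp add: fun_eq_iff algebra_simps)

lemma app_simps [simp]:
  "app 0 f w = 0" "app 1 f = f" "app (S + T) f w = app S f w + app T f w"
  "app (S - T) f w = app S f w - app T f w" "app (- T) f w = - app T f w"
  "app (S * T) f = app T (app S f)" "app (sc c) f w = c * f w"
  by (simp_all add: zero_operator.rep_eq one_operator.rep_eq plus_operator.rep_eq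
      minus_operator.rep_eq uminus_operator.rep_eq times_operator.rep_eq sc.rep_eq)

lemma sc_central: "sc c * T = T * sc c"
proof (rule operator_eqI)
  fix f w
  have "app T (\<lambda>w. c * f w + 0) w = c * app T f w + app T (\<lambda>w. 0) w"
    by (simp only: app_linear)
  \<comment> \<open>Linearity at zero functions says T 0 = T 0 + T 0, so T 0 = 0 and the first
    equation becomes homogeneity.\<close>
  moreover have "app T (\<lambda>w. 1 * 0 + 0) w = 1 * app T (\<lambda>w. 0) w + app T (\<lambda>w. 0) w"
    by (simp only: app_linear)
  moreover have "app (sc c) f = (\<lambda>w. c * f w)" by (simp add: fun_eq_iff)
  ultimately show "app (sc c * T) f w = app (T * sc c) f w"
    by simp
qed

lemma sc_arith: "sc (c + d) = sc c + sc d" "sc (c - d) = sc c - sc d" "sc (- c) = - sc c"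
  "sc (c * d) = sc c * sc d" "sc 0 = 0" "sc 1 = 1"
  by (rule operator_eqI; simp add: algebra_simps)+

lift_definition op_g :: "'k::comm_ring_1 \<Rightarrow> nat \<Rightarrow> 'k operator" is hecke
  by (simp add: fun_eq_iff hecke_def algebra_simps)

lemma app_op_g [simp]: "app (op_g a i) = hecke a i"
  by (simp add: op_g.rep_eq)

lemma op_g_quadratic: "op_g a i * op_g a i = sc a * op_g a i + 1"
  by (rule operator_eqI) (simp add: sc_central hecke_quadratic)

lemma op_g_braid:
  "op_g a i * op_g a (Suc i) * op_g a i = op_g a (Suc i) * op_g a i * op_g a (Suc i)"
  by (rule operator_eqI) (simp add: hecke_braid)

lemma op_g_commute: "Suc i < j \<or> Suc j < i \<Longrightarrow> op_g a i * op_g a j = op_g a j * op_g a i"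
  by (rule operator_eqI, elim disjE) (simp_all add: hecke_commute[of i j] hecke_commute[of j i])

section \<open>Adding a fixed point or an arc at position 0\<close>

lift_definition fx :: "involution \<Rightarrow> involution"
  is "\<lambda>w x. case x of 0 \<Rightarrow> 0 | Suc y \<Rightarrow> Suc (w y)"
  by (auto split: nat.splits)

lemma ap_fx [simp]: "ap (fx w) 0 = 0" "ap (fx w) (Suc x) = Suc (ap w x)"
  by (simp_all add: fx.rep_eq)

definition skip :: "nat \<Rightarrow> nat \<Rightarrow> nat"
  where "skip j x = (if x < j then x else Suc x)"

definition unskip :: "nat \<Rightarrow> nat \<Rightarrow> nat"
  where "unskip j x = (if x < j then x else x - 1)"

lemma unskip_skip [simp]: "unskip j (skip j x) = x"
  by (auto simp: skip_def unskip_def)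

lemma skip_unskip: "x \<noteq> j \<Longrightarrow> skip j (unskip j x) = x"
  by (auto simp: skip_def unskip_def)

lemma skip_neq [simp]: "skip j x \<noteq> j" "j \<noteq> skip j x"
  by (auto simp: skip_def)

lemma skip_eq_iff [simp]: "skip j x = skip j y \<longleftrightarrow> x = y"
  by (auto simp: skip_def)

lemma skip_less_iff [simp]: "skip j x < skip j y \<longleftrightarrow> x < y"
  by (auto simp: skip_def)

lift_definition arc :: "nat \<Rightarrow> involution \<Rightarrow> involution"
  is "\<lambda>j w x. if x = 0 then Suc j else if x = Suc j then 0 else Suc (skip j (w (unskip j (x - 1))))"
  subgoal for j w x
    by (cases x) (auto simp: skip_unskip)
  done

lemma ap_arc [simp]: "ap (arc j w) 0 = Suc j" "ap (arc j w) (Suc j) = 0"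
  "ap (arc j w) (Suc (skip j x)) = Suc (skip j (ap w x))"
  by (simp_all add: arc.rep_eq)

lemma arc_cases: obtains "x = 0" | "x = Suc j" | y where "x = Suc (skip j y)"
proof (cases x)
  case (Suc z)
  then show ?thesis using that(2,3) skip_unskip[of z j] by metis
qed (use that in blast)


lift_definition rest :: "involution \<Rightarrow> involution"
  is "\<lambda>w x. if w 0 = 0 then w (Suc x) - 1 else unskip (w 0 - 1) (w (Suc (skip (w 0 - 1) x)) - 1)"
  subgoal premises w for w
  proof -
    note w = w[rule_format]
    have inj: "w x = w y \<longleftrightarrow> x = y" for x y using w by metis
    have pos: "w (Suc x) \<noteq> 0" if "w 0 = 0" for x
      using inj[of "Suc x" 0] that by simp
    have pos': "w (Suc (skip j x)) \<noteq> 0" "w (Suc (skip j x)) \<noteq> Suc j" if "w 0 = Suc j" for j x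
      using inj[of "Suc (skip j x)" "Suc j"] inj[of "Suc (skip j x)" 0] that w[of 0] by auto
    show ?thesis
    proof (cases "w 0")
      case 0
      have "w (Suc (w (Suc x) - 1)) - 1 = x" for x
        using pos[OF 0, of x] w[of "Suc x"] by simp
      with 0 show ?thesis by simp
    next
      case (Suc j)
      have "unskip j (w (Suc (skip j (unskip j (w (Suc (skip j x)) - 1)))) - 1) = x" for x
      proof -
        have "skip j (unskip j (w (Suc (skip j x)) - 1)) = w (Suc (skip j x)) - 1"
          using pos'[OF Suc, of x] by (intro skip_unskip) auto
        moreover have "Suc (w (Suc (skip j x)) - 1) = w (Suc (skip j x))"
          using pos'[OF Suc, of x] by simp
        ultimately show ?thesis by (simp add: w)
      qed
      with Suc show ?thesis by simp
    qed
  qed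
  done

lemma rest_fx [simp]: "rest (fx w) = w"
  by (rule involution_eqI) (simp add: rest.rep_eq)

lemma rest_arc [simp]: "rest (arc j w) = w"
  by (rule involution_eqI) (simp add: rest.rep_eq)

lemma fx_rest: "ap w 0 = 0 \<Longrightarrow> fx (rest w) = w"
proof (rule involution_eqI)
  fix x assume 0: "ap w 0 = 0"
  show "ap (fx (rest w)) x = ap w x"
  proof (cases x)
    case (Suc y)
    have "ap w (Suc y) \<noteq> 0" using 0 by (metis ap_ap nat.distinct(1))
    with Suc 0 show ?thesis by (simp add: rest.rep_eq)
  qed (simp add: 0)
qed

lemma arc_rest: "ap w 0 = Suc j \<Longrightarrow> arc j (rest w) = w"
proof (rule involution_eqI)
  fix x assume 0: "ap w 0 = Suc j"
  then have j: "ap w (Suc j) = 0" by (metis ap_ap)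
  show "ap (arc j (rest w)) x = ap w x"
  proof (cases x rule: arc_cases[where j = j])
    case (3 y)
    have "ap w (Suc (skip j y)) \<noteq> ap w 0" "ap w (Suc (skip j y)) \<noteq> ap w (Suc j)"
      by (simp_all only: ap_eq_iff nat.distinct nat.inject skip_neq simp_thms)
    then have "ap w (Suc (skip j y)) \<noteq> Suc j" "ap w (Suc (skip j y)) \<noteq> 0"
      by (simp_all add: 0 j)
    then have "Suc (skip j (unskip j (ap w (Suc (skip j y)) - 1))) = ap w (Suc (skip j y))"
      by (subst skip_unskip) auto
    with 3 0 show ?thesis by (simp add: rest.rep_eq)
  qed (simp_all add: 0 j)
qed

lemma involution_cases:
  obtains y where "w = fx y" | j y where "w = arc j y"
  by (metis fx_rest arc_rest not0_implies_Suc)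

lemma sw_Suc_Suc [simp]: "sw (Suc i) (Suc x) = Suc (sw i x)"
  by (simp add: sw_def)

lemma sw_Suc_0 [simp]: "sw (Suc i) 0 = 0"
  by (simp add: sw_def)

lemma both_fixed_fx [simp]: "both_fixed (Suc i) (fx w) \<longleftrightarrow> both_fixed i w"
  by (simp add: both_fixed_def)

lemma cj_fx: "cj (Suc i) (fx w) = fx (cj i w)"
  by (rule involution_eqI, case_tac x) simp_all

lemma toggle_fx: "toggle (Suc i) (fx w) = fx (toggle i w)"
  by (rule involution_eqI, case_tac x) (simp_all add: ap_toggle)

lemma hecke_fx: "hecke a (Suc i) f (fx w) = hecke a i (\<lambda>v. f (fx v)) w"
  by (simp add: hecke_def cj_fx toggle_fx)

context
  fixes i j i' :: nat
  assumes sk: "\<And>x. sw i (skip j x) = skip j (sw i' x)" and j: "sw i j = j"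
    and i': "skip j i' = i" "skip j (Suc i') = Suc i"
begin

lemma both_fixed_arc: "both_fixed (Suc i) (arc j w) \<longleftrightarrow> both_fixed i' w"
  using ap_arc(3)[of j w i'] ap_arc(3)[of j w "Suc i'"] skip_eq_iff[of j _ i'] skip_eq_iff[of j _ "Suc i'"]
  unfolding both_fixed_def i' by simp

lemma arc_arc: "ap (arc j w) (Suc i) = Suc (Suc i) \<longleftrightarrow> ap w i' = Suc i'"
  using ap_arc(3)[of j w i'] skip_eq_iff[of j _ "Suc i'"] unfolding i' by simp

lemma arc_less: "ap (arc j w) (Suc i) < ap (arc j w) (Suc (Suc i)) \<longleftrightarrow> ap w i' < ap w (Suc i')"
  using ap_arc(3)[of j w i'] ap_arc(3)[of j w "Suc i'"] unfolding i' by simp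

lemma cj_arc: "cj (Suc i) (arc j w) = arc j (cj i' w)"
  by (rule involution_eqI, case_tac x rule: arc_cases[where j = j]) (simp_all add: j sk)

lemma toggle_arc: "toggle (Suc i) (arc j w) = arc j (toggle i' w)"
  by (rule involution_eqI, case_tac x rule: arc_cases[where j = j])
    (simp_all add: ap_toggle both_fixed_arc arc_arc j sk)

text \<open>\<open>skip j\<close> is increasing and hits both \<open>i\<close> and
  \<open>Suc i\<close>, so each test at \<open>Suc i\<close> in \<open>arc j w\<close> is the test
  at \<open>i'\<close> in \<open>w\<close>.\<close>

lemma hecke_arc: "hecke a (Suc i) f (arc j w) = hecke a i' (\<lambda>v. f (arc j v)) w"
  unfolding hecke_def both_fixed_arc arc_arc arc_less cj_arc toggle_arc ..

end

lemma hecke_arc_gt: "j < i \<Longrightarrow> hecke a (Suc i) f (arc j w) = hecke a (i - 1) (\<lambda>v. f (arc j v)) w"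
  by (rule hecke_arc) (auto simp: sw_def skip_def)

lemma hecke_arc_less: "Suc i < j \<Longrightarrow> hecke a (Suc i) f (arc j w) = hecke a i (\<lambda>v. f (arc j v)) w"
  by (rule hecke_arc) (auto simp: sw_def skip_def)

lemma cj_arc_Suc: "cj (Suc j) (arc j w) = arc (Suc j) w"
proof (rule involution_eqI)
  have s: "sw j (skip j x) = skip (Suc j) x" for x
    by (auto simp: sw_def skip_def)
  have s': "sw j (skip (Suc j) x) = skip j x" for x
    by (auto simp: sw_def skip_def)
  fix x
  show "ap (cj (Suc j) (arc j w)) x = ap (arc (Suc j) w) x"
    by (cases x rule: arc_cases[where j = "Suc j"]) (simp_all add: s s')
qed

text \<open>The far end of the arc has the smallest image, 0. Hence it moves right across an ascent,
  without a correction term, and left across a descent.\<close>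

lemma hecke_arc_same: "hecke a (Suc j) f (arc j w) = f (arc (Suc j) w)"
proof -
  have "skip j j = Suc j" by (simp add: skip_def)
  then have "ap (arc j w) (Suc (Suc j)) \<noteq> 0"
    using ap_arc(3)[of j w j] by simp
  then show ?thesis
    by (simp add: hecke_def both_fixed_def cj_arc_Suc)
qed

lemma hecke_arc_Suc: "hecke a (Suc j) f (arc (Suc j) w) = f (arc j w) + a * f (arc (Suc j) w)"
proof -
  have "cj (Suc j) (arc (Suc j) w) = arc j w"
    by (simp flip: cj_arc_Suc)
  moreover have "ap (arc (Suc j) w) (Suc j) \<noteq> Suc (Suc j)"
    by (metis ap_ap ap_arc(1) nat.distinct(1))
  moreover have "ap (arc (Suc j) w) (Suc (Suc j)) = 0" by simp
  ultimately show ?thesis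
    by (simp only: hecke_def both_fixed_def) simp
qed

lemma toggle_fx_fx: "toggle 0 (fx (fx w)) = arc 0 w"
proof (rule involution_eqI)
  have f: "ap (fx (fx w)) (Suc 0) = Suc 0"
    using ap_fx(2)[of "fx w" 0] by simp
  fix x show "ap (toggle 0 (fx (fx w))) x = ap (arc 0 w) x"
    using ap_arc(3)[of 0 w]
    by (cases x rule: arc_cases[where j = 0]) (simp_all add: ap_toggle both_fixed_def f sw_def skip_def)
qed

lemma hecke_fx_fx: "hecke a 0 f (fx (fx w)) = f (arc 0 w) - f (fx (fx w))"
  by (simp add: hecke_def both_fixed_def toggle_fx_fx)

lemma hecke_fx_arc: "hecke a 0 f (fx (arc 0 w)) = f (arc (Suc 0) (fx w))"
proof -
  have "cj 0 (fx (arc 0 w)) = arc (Suc 0) (fx w)"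
  proof (rule involution_eqI)
    fix x
    have 1: "ap (fx (arc 0 w)) (Suc 0) = Suc (Suc 0)"
      using ap_fx(2)[of "arc 0 w" 0] by simp
    have 2: "ap (fx (arc 0 w)) (Suc (Suc 0)) = Suc 0"
      using ap_fx(2)[of "arc 0 w" "Suc 0"] ap_arc(2)[of 0 w] by simp
    have 3: "ap (fx (arc 0 w)) (Suc (Suc (Suc y))) = Suc (Suc (Suc (ap w y)))" for y
      using ap_fx(2)[of "arc 0 w" "Suc (Suc y)"] ap_arc(3)[of 0 w y] by (simp add: skip_def)
    show "ap (cj 0 (fx (arc 0 w))) x = ap (arc (Suc 0) (fx w)) x"
    proof (cases x rule: arc_cases[where j = "Suc 0"])
      case (3 y)
      then show ?thesis
        using 1 \<open>\<And>y. ap (fx (arc 0 w)) (Suc (Suc (Suc y))) = Suc (Suc (Suc (ap w y)))\<close>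
          ap_arc(3)[of "Suc 0" "fx w" y]
        by (cases y) (simp_all add: skip_def sw_def)
    qed (use 1 2 in \<open>simp_all add: sw_def\<close>)
  qed
  moreover have "ap (fx (arc 0 w)) (Suc 0) = Suc (Suc 0)"
    using ap_fx(2)[of "arc 0 w" 0] by simp
  ultimately show ?thesis
    by (simp add: hecke_def both_fixed_def)
qed

section \<open>Idempotents from fixed points\<close>

lift_definition op_fix :: "'k::comm_ring_1 operator" is "\<lambda>f w. f (fx w)" by simp
lift_definition op_arc :: "nat \<Rightarrow> 'k::comm_ring_1 operator" is "\<lambda>j f w. f (arc j w)" by simp

lemma app_op_fix [simp]: "app op_fix f w = f (fx w)"
  by (simp add: op_fix.rep_eq)

lemma app_op_arc [simp]: "app (op_arc j) f w = f (arc j w)"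
  by (simp add: op_arc.rep_eq)

text \<open>Because products are reversed, a right factor \<open>op_fix\<close> or
  \<open>op_arc j\<close> restricts an operator to the involutions \<open>fx y\<close> or
  \<open>arc j y\<close>, and every involution has one of these forms. Identities for
  \<open>op_P\<close> are checked in this way.\<close>

lemma operator_fix_arc_eqI:
  assumes "X * op_fix = Y * op_fix" "\<And>j. X * op_arc j = Y * op_arc j"
  shows "X = Y"
proof (rule operator_eqI)
  fix f w
  show "app X f w = app Y f w"
  proof (cases w rule: involution_cases)
    case (1 y)
    then show ?thesis
      using arg_cong[OF assms(1), of "\<lambda>Z. app Z f y"] by simp
  next
    case (2 j y)
    then show ?thesis
      using arg_cong[OF assms(2)[of j], of "\<lambda>Z. app Z f y"] by simp
  qed
qed

lemma op_g_fix: "op_g a (Suc i) * op_fix = op_fix * op_g a i"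
  by (rule operator_eqI) (simp add: hecke_fx op_fix.rep_eq)

lemma op_g_arc:
  "j < i \<Longrightarrow> op_g a (Suc i) * op_arc j = op_arc j * op_g a (i - 1)"
  "Suc i < j \<Longrightarrow> op_g a (Suc i) * op_arc j = op_arc j * op_g a i"
  "op_g a (Suc j) * op_arc j = op_arc (Suc j)"
  "op_g a (Suc j) * op_arc (Suc j) = op_arc j + sc a * op_arc (Suc j)"
  by (rule operator_eqI;
      simp add: hecke_arc_gt hecke_arc_less hecke_arc_same hecke_arc_Suc op_arc.rep_eq)+

lemma op_g_fix_fix: "op_g a 0 * op_fix * op_fix = op_arc 0 - op_fix * op_fix"
  by (rule operator_eqI) (simp add: hecke_fx_fx)

lemma op_g_fix_arc: "op_g a 0 * op_fix * op_arc 0 = op_arc (Suc 0) * op_fix"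
  by (rule operator_eqI) (simp add: hecke_fx_arc)

text \<open>The Hecke word meant to carry a fixed point from position 0 to position
  \<open>j\<close>; \<open>descend_ins\<close> says when it does exactly this.\<close>

fun descend :: "'k::comm_ring_1 \<Rightarrow> nat \<Rightarrow> 'k operator" where
  "descend a 0 = 1"
| "descend a (Suc j) = op_g a j * descend a j"

text \<open>A left inverse of \<open>op_fix\<close>: an arc at \<open>0\<close> is replaced by a fixed point, transported to the other end of
  the arc and weighted by \<open>t\<close>.\<close>

lift_definition op_P :: "'k::comm_ring_1 \<Rightarrow> 'k \<Rightarrow> 'k operator"
  is "\<lambda>a t f w. if ap w 0 = 0 then f (rest w)
      else t * app (descend a (ap w 0 - 1)) f (fx (rest w))"
  by (simp add: fun_eq_iff app_linear) (simp add: algebra_simps)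

lemma op_P_fix [simp]: "op_P a t * op_fix = 1"
  by (rule operator_eqI) (simp add: op_P.rep_eq)

lemma op_P_arc: "op_P a t * op_arc j = sc t * descend a j * op_fix"
proof -
  have "op_P a t * op_arc j = descend a j * op_fix * sc t"
    by (rule operator_eqI) (simp add: op_P.rep_eq)
  then show ?thesis by (simp add: mult.assoc sc_central)
qed

lemma op_g_descend: "j < i \<Longrightarrow> op_g a i * descend a j = descend a j * op_g a i"
proof (induction j)
  case (Suc j)
  have "op_g a i * descend a (Suc j) = op_g a j * (op_g a i * descend a j)"
    using Suc.prems by (simp add: op_g_commute[of j i] flip: mult.assoc)
  then show ?case using Suc by (simp add: mult.assoc)
qed simp

lemma op_g_descend_Suc: "Suc i < j \<Longrightarrow> op_g a i * descend a j = descend a j * op_g a (Suc i)"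
proof (induction j)
  case (Suc j)
  show ?case
  proof (cases "j = Suc i")
    case True
    have "op_g a i * descend a (Suc j) = op_g a i * op_g a (Suc i) * op_g a i * descend a i"
      by (simp add: True mult.assoc)
    also have "\<dots> = op_g a (Suc i) * op_g a i * op_g a (Suc i) * descend a i"
      by (simp only: op_g_braid)
    also have "\<dots> = descend a (Suc j) * op_g a (Suc i)"
      by (simp add: True op_g_descend mult.assoc)
    finally show ?thesis .
  next
    case False
    then have "op_g a i * descend a (Suc j) = op_g a j * (op_g a i * descend a j)"
      using Suc.prems by (simp add: op_g_commute[of i j] flip: mult.assoc)
    then show ?thesis using Suc False by (simp add: mult.assoc)
  qed
qed simp

text \<open>This intertwining is the reason for the Hecke word inside \<open>op_P\<close>. At an arc
  with \<open>j = i\<close> the generator prolongs the word by one letter, and at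
  \<open>j = Suc i\<close> the quadratic relation recombines the two resulting terms. Otherwise the
  generator passes through the word, by commutation or by a braid move.\<close>

lemma op_P_g: "op_P a t * op_g a (Suc i) = op_g a i * op_P a t"
proof (rule operator_fix_arc_eqI)
  show "op_P a t * op_g a (Suc i) * op_fix = op_g a i * op_P a t * op_fix"
    by (simp add: op_g_fix mult.assoc) (simp flip: mult.assoc)
next
  fix j
  have c: "S * sc t = sc t * S" for S by (simp add: sc_central)
  have r: "op_g a i * op_P a t * op_arc j = sc t * op_g a i * descend a j * op_fix"
    by (simp add: mult.assoc op_P_arc) (simp add: c flip: mult.assoc)
  have ca: "op_P a t * (sc a * Z) = sc a * (op_P a t * Z)" for Z
    by (simp add: sc_central[of a "op_P a t"] flip: mult.assoc)
  consider "j < i" | "j = i" | "j = Suc i" | "Suc i < j" by linarith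
  then show "op_P a t * op_g a (Suc i) * op_arc j = op_g a i * op_P a t * op_arc j"
  proof cases
    case 1
    then have "op_P a t * op_g a (Suc i) * op_arc j = op_P a t * op_arc j * op_g a (i - 1)"
      by (simp add: mult.assoc op_g_arc)
    also have "\<dots> = sc t * descend a j * (op_g a i * op_fix)"
      using 1 op_g_fix[of a "i - 1"] by (simp add: op_P_arc mult.assoc)
    finally show ?thesis
      using 1 unfolding r by (simp add: mult.assoc) (simp flip: mult.assoc op_g_descend)
  next
    case 2
    then show ?thesis
      unfolding r by (simp add: mult.assoc op_g_arc op_P_arc)
  next
    case 3
    have "op_P a t * op_g a (Suc i) * op_arc j = op_P a t * op_arc i + sc a * (op_P a t * op_arc (Suc i))"
      unfolding 3 by (simp add: mult.assoc op_g_arc distrib_left ca)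
    also have "\<dots> = sc t * (1 + sc a * op_g a i) * descend a i * op_fix"
      unfolding op_P_arc by (simp add: algebra_simps) (simp add: c flip: mult.assoc)
    also have "1 + sc a * op_g a i = op_g a i * op_g a i"
      by (simp add: op_g_quadratic)
    finally show ?thesis
      unfolding 3 r[unfolded 3] by (simp add: mult.assoc)
  next
    case 4
    then have "op_P a t * op_g a (Suc i) * op_arc j = op_P a t * op_arc j * op_g a i"
      by (simp add: mult.assoc op_g_arc)
    also have "\<dots> = sc t * (descend a j * op_g a (Suc i)) * op_fix"
      using 4 by (simp add: op_P_arc mult.assoc op_g_fix)
    finally show ?thesis
      using 4 unfolding r by (simp add: mult.assoc flip: op_g_descend_Suc)
  qed
qed

text \<open>The root of the recursion for the idempotents. Both sides are computed on
  \<open>op_fix\<close> and \<open>op_arc 0\<close>. They commute with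
  \<open>op_g a (Suc j)\<close>, which takes \<open>op_arc j\<close> to
  \<open>op_arc (Suc j)\<close>, so the remaining arcs follow by induction.\<close>

lemma op_P_g_fix: "op_P a t * op_g a 0 * op_fix = sc t - op_fix * op_P a t"
  (is "?A = ?B")
proof (rule operator_fix_arc_eqI)
  have "?A * op_fix = op_P a t * (op_g a 0 * op_fix * op_fix)"
    by (simp add: mult.assoc)
  then show "?A * op_fix = ?B * op_fix"
    unfolding op_g_fix_fix by (simp add: algebra_simps op_P_arc) (simp flip: mult.assoc)
next
  fix j
  show "?A * op_arc j = ?B * op_arc j"
  proof (induction j)
    case 0
    have "?A * op_arc 0 = op_P a t * (op_g a 0 * op_fix * op_arc 0)"
      by (simp add: mult.assoc)
    also have "\<dots> = sc t * (op_g a 0 * op_fix * op_fix)"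
      unfolding op_g_fix_arc by (simp add: op_P_arc mult.assoc flip: mult.assoc[of "op_P a t"])
    also have "\<dots> = ?B * op_arc 0"
      unfolding op_g_fix_fix
      by (simp add: algebra_simps op_P_arc) (simp add: sc_central[of t] mult.assoc)
    finally show ?case .
  next
    case (Suc j)
    have A: "?A * op_g a (Suc j) = op_g a (Suc j) * ?A"
    proof -
      have "?A * op_g a (Suc j) = op_P a t * (op_g a 0 * op_g a (Suc (Suc j))) * op_fix"
        by (simp add: mult.assoc op_g_fix)
      also have "op_g a 0 * op_g a (Suc (Suc j)) = op_g a (Suc (Suc j)) * op_g a 0"
        by (simp add: op_g_commute)
      finally show ?thesis
        by (simp add: op_P_g flip: mult.assoc)
    qed
    have B: "?B * op_g a (Suc j) = op_g a (Suc j) * ?B"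
      by (simp add: algebra_simps op_P_g sc_central[of t]) (simp add: op_g_fix flip: mult.assoc)
    have "?A * op_arc (Suc j) = ?A * op_g a (Suc j) * op_arc j"
      by (simp add: mult.assoc op_g_arc)
    also have "\<dots> = op_g a (Suc j) * (?B * op_arc j)"
      unfolding A mult.assoc[of "op_g a (Suc j)"] Suc.IH ..
    also have "\<dots> = ?B * op_arc (Suc j)"
      unfolding mult.assoc[symmetric] B[symmetric] by (simp add: mult.assoc op_g_arc)
    finally show ?case .
  qed
qed

text \<open>Both sides equal \<open>op_arc (Suc 0) * op_fix\<close>, the arc from 0 to 2 around a
  fixed point; all other terms cancel.\<close>

lemma op_absorb_fix:
  "(op_g a 0 * op_g a (Suc 0) + op_g a 0) * op_fix ^ 3
    = (op_g a (Suc 0) * op_g a 0 + op_g a (Suc 0)) * op_fix ^ 3"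
proof -
  let ?g = "op_g a 0" and ?h = "op_g a (Suc 0)"
  have 1: "?h * op_fix ^ 3 = op_fix * op_arc 0 - op_fix ^ 3"
  proof -
    have "?h * op_fix ^ 3 = op_fix * (?g * op_fix * op_fix)"
      by (simp add: power3_eq_cube op_g_fix flip: mult.assoc)
    then show ?thesis
      unfolding op_g_fix_fix by (simp add: right_diff_distrib power3_eq_cube mult.assoc)
  qed
  have 2: "?g * op_fix ^ 3 = op_arc 0 * op_fix - op_fix ^ 3"
    using arg_cong[OF op_g_fix_fix[of a], of "\<lambda>x. x * op_fix"]
    by (simp add: left_diff_distrib power3_eq_cube mult.assoc)
  have 3: "?g * (op_fix * op_arc 0) = op_arc (Suc 0) * op_fix"
    using op_g_fix_arc[of a] by (simp add: mult.assoc)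
  have 4: "?h * (op_arc 0 * op_fix) = op_arc (Suc 0) * op_fix"
    using op_g_arc(3)[of a 0] by (simp flip: mult.assoc)
  show ?thesis
    by (simp add: distrib_right mult.assoc 1 2 3 4 right_diff_distrib)
qed

text \<open>The defect \<open>Z = p ^ 3 * X\<close> is shown to vanish on fixed points and on arcs.
  Since \<open>X * (g + h)\<close> is a multiple of \<open>X\<close>, a factor \<open>h\<close>
  after \<open>Z\<close> can be traded for \<open>g\<close>, and the arcs 0 and 1 reduce to
  \<open>Z * F = 0\<close>. Arc 2 needs one more product; beyond it the generators pass through
  \<open>X\<close> and move the arc on.\<close>

lemma op_absorb_P:
  "op_P a t ^ 3 * (op_g a (Suc 0) * op_g a 0 + op_g a 0)
    = op_P a t ^ 3 * (op_g a 0 * op_g a (Suc 0) + op_g a (Suc 0))"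
proof -
  define p F g h k A T where defs: "p = op_P a t" "F = (op_fix :: 'a operator)" "g = op_g a 0"
    "h = op_g a (Suc 0)" "k = op_g a (Suc (Suc 0))" "A = sc a" "T = sc t"
  have c: "x * A = A * x" "x * T = T * x" for x
    by (simp_all add: defs sc_central)
  have c': "x * (A * z) = A * (x * z)" "x * (T * z) = T * (x * z)" for x z
    by (simp_all add: c flip: mult.assoc)
  have r: "p * F = 1" "p * (g * F) = T - F * p" "p * h = g * p" "p * k = h * p"
    "h * F = F * g" "k * F = F * h" "g * g = A * g + 1" "h * h = A * h + 1" "g * (h * g) = h * (g * h)"
    "h * (k * h) = k * (h * k)" "g * k = k * g"
    using op_P_g_fix[of a t] op_g_braid[of a 0] op_g_braid[of a "Suc 0"]
    by (simp_all add: defs op_P_g op_g_fix op_g_quadratic op_g_commute mult.assoc)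
  have r': "p * (F * z) = z" "p * (g * (F * z)) = T * z - F * (p * z)" "p * (h * z) = g * (p * z)"
    "p * (k * z) = h * (p * z)" "h * (F * z) = F * (g * z)" "k * (F * z) = F * (h * z)"
    "g * (g * z) = A * (g * z) + z" "h * (h * z) = A * (h * z) + z"
    "g * (h * (g * z)) = h * (g * (h * z))"
    "h * (k * (h * z)) = k * (h * (k * z))" "g * (k * z) = k * (g * z)" for z
    using arg_cong[OF r(1), of "\<lambda>x. x * z"] arg_cong[OF r(2), of "\<lambda>x. x * z"]
      arg_cong[OF r(3), of "\<lambda>x. x * z"] arg_cong[OF r(4), of "\<lambda>x. x * z"]
      arg_cong[OF r(5), of "\<lambda>x. x * z"] arg_cong[OF r(6), of "\<lambda>x. x * z"]
      arg_cong[OF r(7), of "\<lambda>x. x * z"] arg_cong[OF r(8), of "\<lambda>x. x * z"]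
      arg_cong[OF r(9), of "\<lambda>x. x * z"] arg_cong[OF r(10), of "\<lambda>x. x * z"]
      arg_cong[OF r(11), of "\<lambda>x. x * z"]
    by (simp_all only: mult.assoc distrib_right left_diff_distrib mult_1)
  have s: "g * (h * (k * g)) = h * (g * (h * k))"
    using r(9) r'(11)[of 1] by (metis r(11) r'(9) mult.assoc)
  have s': "g * (h * (k * (g * z))) = h * (g * (h * (k * z)))" for z
    using arg_cong[OF s, of "\<lambda>x. x * z"] by (simp only: mult.assoc)
  note [simp] = r r' s s'
  note rules = mult.assoc distrib_left distrib_right left_diff_distrib right_diff_distrib
    c(1)[of T] c'(1)[of T] c[of p] c[of F] c[of g] c[of h] c[of k] c'[of p] c'[of F] c'[of g] c'[of h] c'[of k]
  define X Z where "X = h * g + g - g * h - h" and Z_def: "Z = p ^ 3 * X"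
  have "X * g + X * h = A * X - X"
    by (simp add: X_def rules)
  then have Xh: "X * h = A * X - X - X * g"
    by (simp add: algebra_simps)
  have Zh: "Z * h = A * Z - Z - Z * g"
    unfolding Z_def mult.assoc Xh
    by (simp add: rules power3_eq_cube)
  have Zh': "Z * (h * z) = A * (Z * z) - Z * z - Z * (g * z)" for z
    unfolding mult.assoc[symmetric] Zh by (simp add: rules)
  have ZF: "Z * (F * z) = 0" for z
  proof -
    have "Z * F = 0"
      by (simp add: Z_def X_def power3_eq_cube rules)
    then show ?thesis by (simp flip: mult.assoc)
  qed
  have ZgF: "Z * (g * (F * z)) = 0" for z
    using Zh'[of "F * z"] by (simp add: ZF)
  \<comment> \<open>\<open>k\<close> does not commute with the \<open>h\<close> inside
    \<open>X\<close>, so this product is not covered by trading \<open>h\<close> for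
    \<open>g\<close> and is evaluated directly.\<close>
  have ZkhgFF: "Z * (k * (h * (g * (F * F)))) = 0"
    by (simp add: Z_def X_def power3_eq_cube rules)
  have D0: "op_arc 0 = g * (F * F) + F * F"
    using op_g_fix_fix[of a] by (simp add: defs mult.assoc)
  have D1: "op_arc (Suc 0) = h * (op_arc 0 :: 'a operator)" and D2: "op_arc (Suc (Suc 0)) = k * (op_arc (Suc 0) :: 'a operator)"
    using op_g_arc(3)[of a 0] op_g_arc(3)[of a "Suc 0"] by (simp_all add: defs)
  have cA: "Z * (A * z) = A * (Z * z)" for z by (rule c'(1))
  have ZD: "Z * op_arc 0 = 0" "Z * op_arc (Suc 0) = 0" "Z * op_arc (Suc (Suc 0)) = 0"
    unfolding D2 D1 D0 by (simp_all add: distrib_left ZF ZgF Zh' ZkhgFF cA)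
  have "Z = 0"
  proof (rule operator_fix_arc_eqI)
    show "Z * op_fix = 0 * op_fix"
      using ZF[of 1] by (simp add: defs)
    fix j
    have Zg: "Z * op_g a (Suc (Suc (Suc i))) = op_g a i * Z" for i
    proof -
      have *: "op_g a (Suc (Suc (Suc i))) * x = x * op_g a (Suc (Suc (Suc i)))" if "x \<in> {g, h}" for x
        using that by (auto simp: defs op_g_commute)
      have **: "op_g a (Suc (Suc (Suc i))) * (x * z) = x * (op_g a (Suc (Suc (Suc i))) * z)"
        if "x \<in> {g, h}" for x z
        using *[OF that] by (simp flip: mult.assoc)
      have X: "X * op_g a (Suc (Suc (Suc i))) = op_g a (Suc (Suc (Suc i))) * X"
        by (simp add: X_def rules * **)
      have P: "p ^ 3 * op_g a (Suc (Suc (Suc i))) = op_g a i * p ^ 3"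
        unfolding defs power3_eq_cube
        by (simp add: mult.assoc op_P_g) (simp add: op_P_g flip: mult.assoc)
      have "Z * op_g a (Suc (Suc (Suc i))) = p ^ 3 * (X * op_g a (Suc (Suc (Suc i))))"
        by (simp only: Z_def mult.assoc)
      also have "\<dots> = (p ^ 3 * op_g a (Suc (Suc (Suc i)))) * X"
        unfolding X by (simp only: mult.assoc)
      also have "\<dots> = op_g a i * Z"
        unfolding P Z_def by (simp only: mult.assoc)
      finally show ?thesis .
    qed
    \<comment> \<open>\<open>Z\<close> only intertwines the generators from index 3 on, hence the
      induction has to start at arc 2.\<close>
    have ge2: "Z * op_arc (Suc (Suc j)) = 0" for j
    proof (induction j)
      case (Suc j)
      have "Z * op_arc (Suc (Suc (Suc j))) = Z * op_g a (Suc (Suc (Suc j))) * op_arc (Suc (Suc j))"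
        by (simp add: mult.assoc op_g_arc)
      then show ?case
        by (simp add: Zg mult.assoc Suc)
    qed (rule ZD(3))
    consider "j = 0" | "j = Suc 0" | i where "j = Suc (Suc i)"
      by (metis not0_implies_Suc)
    then show "Z * op_arc j = 0 * op_arc j"
      by cases (simp_all add: ZD ge2)
  qed
  then show ?thesis
    unfolding Z_def X_def defs by (simp add: algebra_simps)
qed

section \<open>The idempotents as operators\<close>

definition op_e :: "'k::comm_ring_1 \<Rightarrow> 'k \<Rightarrow> nat \<Rightarrow> 'k operator"
  where "op_e a t r = op_fix ^ r * op_P a t ^ r"

lemma op_P_fix_power: "op_P a t ^ r * op_fix ^ r = 1"
proof (induction r)
  case (Suc r)
  have "op_P a t ^ Suc r * op_fix ^ Suc r = op_P a t ^ r * (op_P a t * op_fix) * op_fix ^ r"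
    by (subst power_Suc2) (simp only: power_Suc mult.assoc)
  then show ?case by (simp add: Suc)
qed simp

lemma op_g_fix_power: "op_g a (i + r) * op_fix ^ r = op_fix ^ r * op_g a i"
proof (induction r)
  case (Suc r)
  have "op_g a (i + Suc r) * op_fix ^ Suc r = op_fix * (op_g a (i + r) * op_fix ^ r)"
    by (simp add: op_g_fix flip: mult.assoc)
  then show ?case by (simp add: Suc mult.assoc)
qed simp

lemma op_P_power_g: "op_P a t ^ r * op_g a (i + r) = op_g a i * op_P a t ^ r"
proof (induction r)
  case (Suc r)
  have "op_P a t ^ Suc r * op_g a (i + Suc r) = op_P a t ^ r * op_g a (i + r) * op_P a t"
    by (simp only: power_Suc2 mult.assoc add_Suc_right op_P_g)
  then show ?case by (simp only: Suc mult.assoc power_Suc2)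
qed simp

lemma op_e_idem: "op_e a t r * op_e a t r = op_e a t r"
proof -
  have "op_e a t r * op_e a t r = op_fix ^ r * (op_P a t ^ r * op_fix ^ r) * op_P a t ^ r"
    by (simp add: op_e_def mult.assoc)
  then show ?thesis by (simp add: op_P_fix_power op_e_def)
qed

lemma op_e_g: "r \<le> i \<Longrightarrow> op_e a t r * op_g a i = op_g a i * op_e a t r"
  using op_P_power_g[of a t r "i - r"] op_g_fix_power[of a "i - r" r]
  unfolding op_e_def by (simp add: mult.assoc) (simp flip: mult.assoc)

text \<open>Moving \<open>op_P a t ^ r\<close> past \<open>op_g a r\<close> and cancelling it
  against \<open>op_fix ^ r\<close> turns the middle of the product into
  \<open>op_P a t * op_g a 0 * op_fix\<close>, that is
  \<open>sc t - op_fix * op_P a t\<close>.\<close>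

lemma op_e_Suc: "op_e a t (Suc (Suc r))
    = sc t * op_e a t (Suc r) - op_e a t (Suc r) * op_g a r * op_e a t (Suc r)"
proof -
  let ?P = "op_P a t" and ?F = "op_fix :: 'a operator"
  have "?P ^ Suc r * op_g a r * ?F ^ Suc r = ?P * (?P ^ r * op_g a (0 + r)) * ?F ^ Suc r"
    by (simp add: mult.assoc)
  also have "\<dots> = ?P * op_g a 0 * (?P ^ r * ?F ^ r) * ?F"
    unfolding op_P_power_g power_Suc2 by (simp add: mult.assoc)
  also have "\<dots> = sc t - ?F * ?P"
    by (simp add: op_P_fix_power op_P_g_fix)
  finally have 1: "?P ^ Suc r * op_g a r * ?F ^ Suc r = sc t - ?F * ?P" .
  have "op_e a t (Suc r) * op_g a r * op_e a t (Suc r)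
      = ?F ^ Suc r * (?P ^ Suc r * op_g a r * ?F ^ Suc r) * ?P ^ Suc r"
    by (simp only: op_e_def mult.assoc)
  also have "\<dots> = sc t * op_e a t (Suc r) - ?F ^ Suc (Suc r) * ?P ^ Suc (Suc r)"
    unfolding 1 right_diff_distrib left_diff_distrib op_e_def
    by (simp only: sc_central[symmetric] mult.assoc power_Suc2[of ?F "Suc r"] power_Suc[of ?P "Suc r"])
  finally show ?thesis by (simp add: op_e_def)
qed

text \<open>The first \<open>i\<close> factors of \<open>op_fix\<close> and the last
  \<open>i\<close> factors of \<open>op_P\<close> shift the generators down to indices 0 and 1;
  three further factors are then consumed, which is the bound \<open>i + 3 \<le> r\<close>. In the
  numbering from 1 it reads j < r with j = i + 2.\<close>

lemma op_absorb_e: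
  assumes "i + 3 \<le> r"
  shows "(op_g a i * op_g a (Suc i) + op_g a i) * op_e a t r
    = (op_g a (Suc i) * op_g a i + op_g a (Suc i)) * op_e a t r"
    and "op_e a t r * (op_g a (Suc i) * op_g a i + op_g a i)
    = op_e a t r * (op_g a i * op_g a (Suc i) + op_g a (Suc i))"
proof -
  let ?P = "op_P a t" and ?F = "op_fix :: 'a operator"
  let ?g = "op_g a 0" and ?h = "op_g a (Suc 0)"
  define k where "k = r - i - 3"
  have r: "r = i + 3 + k" "r = k + 3 + i" using assms by (simp_all add: k_def)
  have F: "op_g a i * ?F ^ i = ?F ^ i * ?g" "op_g a (Suc i) * ?F ^ i = ?F ^ i * ?h"
    using op_g_fix_power[of a 0 i] op_g_fix_power[of a "Suc 0" i] by simp_all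
  have P: "?P ^ i * op_g a i = ?g * ?P ^ i" "?P ^ i * op_g a (Suc i) = ?h * ?P ^ i"
    using op_P_power_g[of a t i 0] op_P_power_g[of a t i "Suc 0"] by simp_all
  have F': "op_g a i * (?F ^ i * z) = ?F ^ i * (?g * z)" "op_g a (Suc i) * (?F ^ i * z) = ?F ^ i * (?h * z)" for z
    by (simp_all add: F flip: mult.assoc)
  have "(op_g a i * op_g a (Suc i) + op_g a i) * op_e a t r
      = ?F ^ i * ((?g * ?h + ?g) * ?F ^ 3) * (?F ^ k * ?P ^ r)"
    unfolding op_e_def by (subst (1) r(1)) (simp add: power_add distrib_right distrib_left F F' mult.assoc)
  moreover have "(op_g a (Suc i) * op_g a i + op_g a (Suc i)) * op_e a t r
      = ?F ^ i * ((?h * ?g + ?h) * ?F ^ 3) * (?F ^ k * ?P ^ r)"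
    unfolding op_e_def by (subst (1) r(1)) (simp add: power_add distrib_right distrib_left F F' mult.assoc)
  ultimately show "(op_g a i * op_g a (Suc i) + op_g a i) * op_e a t r
    = (op_g a (Suc i) * op_g a i + op_g a (Suc i)) * op_e a t r"
    by (simp only: op_absorb_fix)
  have P': "?P ^ i * (op_g a i * z) = ?g * (?P ^ i * z)" "?P ^ i * (op_g a (Suc i) * z) = ?h * (?P ^ i * z)" for z
    by (simp_all add: P flip: mult.assoc)
  have Pr: "?P ^ r = ?P ^ k * (?P ^ 3 * ?P ^ i)"
    by (subst r(2)) (simp only: power_add mult.assoc)
  have "op_e a t r * (op_g a (Suc i) * op_g a i + op_g a i)
      = ?F ^ r * ?P ^ k * (?P ^ 3 * (?h * ?g + ?g)) * ?P ^ i"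
    unfolding op_e_def Pr by (simp add: distrib_right distrib_left P P' mult.assoc)
  moreover have "op_e a t r * (op_g a i * op_g a (Suc i) + op_g a (Suc i))
      = ?F ^ r * ?P ^ k * (?P ^ 3 * (?g * ?h + ?h)) * ?P ^ i"
    unfolding op_e_def Pr by (simp add: distrib_right distrib_left P P' mult.assoc)
  ultimately show "op_e a t r * (op_g a (Suc i) * op_g a i + op_g a i)
    = op_e a t r * (op_g a i * op_g a (Suc i) + op_g a (Suc i))"
    by (simp only: op_absorb_P)
qed

section \<open>The representation\<close>

definition ev :: "('x \<Rightarrow> 'k operator) \<Rightarrow> ('x free_monoid \<Rightarrow>\<^sub>0 'k::comm_ring_1) \<Rightarrow> 'k operator"
  where "ev \<rho> x = (\<Sum>v\<in>Poly_Mapping.keys x. sc (Poly_Mapping.lookup x v) * prod_list (map \<rho> (letters v)))"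

lemma poly_mapping_induct [case_names single add]:
  fixes x :: "'a \<Rightarrow>\<^sub>0 'b::comm_monoid_add"
  assumes single: "\<And>v c. P (Poly_Mapping.single v c)" and add: "\<And>x y. P x \<Longrightarrow> P y \<Longrightarrow> P (x + y)"
  shows "P x"
proof -
  have "P (\<Sum>v\<in>S. Poly_Mapping.single v (Poly_Mapping.lookup x v))" if "finite S" for S
    using that by (induction S) (use single[of _ 0] in \<open>auto intro: assms\<close>)
  moreover have "(\<Sum>v\<in>Poly_Mapping.keys x. Poly_Mapping.single v (Poly_Mapping.lookup x v)) = x"
    by (rule poly_mapping_eqI) (auto simp: lookup_sum lookup_single when_def in_keys_iff)
  ultimately show ?thesis
    by (metis finite_keys)
qed

lemma ev_superset:
  assumes "finite S" "Poly_Mapping.keys x \<subseteq> S"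
  shows "ev \<rho> x = (\<Sum>v\<in>S. sc (Poly_Mapping.lookup x v) * prod_list (map \<rho> (letters v)))"
  unfolding ev_def
  by (rule sum.mono_neutral_left) (use assms in \<open>auto simp: in_keys_iff sc_arith\<close>)

lemma ev_add: "ev \<rho> (x + y) = ev \<rho> x + ev \<rho> y"
proof -
  let ?S = "Poly_Mapping.keys x \<union> Poly_Mapping.keys y"
  have "Poly_Mapping.keys (x + y) \<subseteq> ?S"
    by (rule Poly_Mapping.keys_add)
  then show ?thesis
    using ev_superset[of ?S x \<rho>] ev_superset[of ?S y \<rho>] ev_superset[of ?S "x + y" \<rho>]
    by (simp add: lookup_add sc_arith distrib_right sum.distrib)
qed

lemma ev_single: "ev \<rho> (Poly_Mapping.single v c) = sc c * prod_list (map \<rho> (letters v))"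
  by (subst ev_superset[of "{v}"]) auto

lemma ev_mult: "ev \<rho> (x * y) = ev \<rho> x * ev \<rho> y"
proof (induction x rule: poly_mapping_induct)
  case (single v c)
  show ?case
  proof (induction y rule: poly_mapping_induct)
    case (single u d)
    show ?case
      by (simp add: mult_single ev_single sc_arith mult.assoc)
        (simp add: sc_central[of d] mult.assoc)
  qed (simp_all add: ev_add distrib_left)
qed (simp_all add: ev_add distrib_right)

lemma ev_simps:
  "ev \<rho> 0 = 0" "ev \<rho> 1 = 1" "ev \<rho> (const c) = sc c" "ev \<rho> (gen x) = \<rho> x" "ev \<rho> (- y) = - ev \<rho> y"
proof -
  show "ev \<rho> 0 = 0" by (simp add: ev_def)
  then show "ev \<rho> (- y) = - ev \<rho> y"
    using ev_add[of \<rho> y "- y"] by (simp add: eq_neg_iff_add_eq_0 add.commute)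
  show "ev \<rho> (const c) = sc c" for c by (simp add: ev_single)
  from this[of 1] show "ev \<rho> 1 = 1" by (simp add: sc_arith)
  show "ev \<rho> (gen x) = \<rho> x" by (simp add: ev_single sc_arith)
qed

lemma ev_diff: "ev \<rho> (x - y) = ev \<rho> x - ev \<rho> y"
  using ev_add[of \<rho> x "- y"] by (simp add: ev_simps)

lemma ev_relation_ideal:
  fixes R :: "(('x free_monoid \<Rightarrow>\<^sub>0 'k::field) \<times> ('x free_monoid \<Rightarrow>\<^sub>0 'k)) set"
  assumes R: "\<And>l r. (l, r) \<in> R \<Longrightarrow> l \<in> carrier (free_algebra X) \<and> r \<in> carrier (free_algebra X)"
    and \<rho>: "\<And>l r. (l, r) \<in> R \<Longrightarrow> ev \<rho> l = ev \<rho> r"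
    and x: "x \<in> relation_ideal X R"
  shows "ev \<rho> x = 0"
proof -
  interpret ring "free_algebra X :: ('k, 'x free_monoid \<Rightarrow>\<^sub>0 'k) module" by (rule ring_free_algebra)
  let ?K = "{y \<in> carrier (free_algebra X). ev \<rho> y = 0}"
  have minus: "a_inv (free_algebra X) y = - y" if "y \<in> carrier (free_algebra X)" for y :: "'x free_monoid \<Rightarrow>\<^sub>0 'k"
    using that minus_equality[of "- y" y] by simp
  have "ideal ?K (free_algebra X)"
  proof (rule idealI[OF ring_axioms])
    show "subgroup ?K (add_monoid (free_algebra X))"
      by (rule add.subgroupI)
        (auto simp: ev_add ev_simps minus simp flip: a_inv_def intro: exI[of _ 0])
  qed (auto simp: ev_mult)
  moreover have "{l - r | l r. (l, r) \<in> R} \<subseteq> ?K"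
    using R \<rho> by (auto simp: ev_diff)
  ultimately have "relation_ideal X R \<subseteq> ?K"
    unfolding relation_ideal_def by (intro genideal_minimal)
  with x show ?thesis by auto
qed

text \<open>The variant \<open>Minus\<close> is obtained from \<open>Plus\<close> by \<open>p, q, u\<^sub>i \<mapsto> - p, - q, - u\<^sub>i\<close>.\<close>

fun eta :: "variant \<Rightarrow> cpq" where
  "eta Plus = 1"
| "eta Minus = - 1"

text \<open>The value of \<open>a\<close> for which \<open>eta s\<close> times \<open>op_g\<close>
  satisfies the quadratic relation of g_i; here \<open>eta s\<close> has square 1.\<close>

definition hpar :: "variant \<Rightarrow> cpq"
  where "hpar s = eta s * (qvar - 1 / qvar)"

text \<open>Substituting u = q - eta g into the recursion and using that e_(r) is idempotent leaves
  this coefficient in front of e_(r).\<close>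

definition tpar :: "variant \<Rightarrow> cpq"
  where "tpar s = eta s * (qvar - coefficient s)"

fun rep :: "variant \<Rightarrow> generator \<Rightarrow> cpq operator" where
  "rep s (U i) = sc qvar - sc (eta s) * op_g (hpar s) (i - 1)"
| "rep s (E r) = op_e (hpar s) (tpar s) r"

abbreviation evr :: "variant \<Rightarrow> free_elem \<Rightarrow> cpq operator"
  where "evr s \<equiv> ev (rep s)"

lemma eta_square: "eta s * eta s = 1"
  by (cases s) auto

lemma evr_u: "evr s (u_gen i) = sc qvar - sc (eta s) * op_g (hpar s) (i - 1)"
  by (simp add: u_gen_def ev_simps)

lemma evr_g: "evr s (g_gen i) = sc (eta s) * op_g (hpar s) (i - 1)"
  by (simp add: g_gen_def ev_diff ev_simps evr_u)

lemma op_e_0 [simp]: "op_e a t 0 = 1"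
  by (simp add: op_e_def)

lemma evr_e: "evr s (e_gen r) = op_e (hpar s) (tpar s) r"
  by (simp add: e_gen_def ev_simps)

lemma sc_mult_mult: "(sc c * S) * (sc d * T) = sc (c * d) * (S * T)"
  by (simp add: sc_arith mult.assoc) (simp add: sc_central[of d] mult.assoc)

lemma evr_relations:
  assumes "(l, r) \<in> relations s n"
  shows "evr s l = evr s r"
proof -
  let ?a = "hpar s" and ?t = "tpar s"
  let ?g = "\<lambda>i. op_g ?a (i - 1)"
  note ev = ev_add ev_diff ev_mult ev_simps evr_g evr_u evr_e
  have e1: "sc (eta s) * (sc (eta s) * T) = T" for T
    using eta_square[of s] by (simp add: sc_arith flip: mult.assoc) (simp add: sc_arith flip: sc_arith(4))
  have c: "T * (sc d * S) = sc d * (T * S)" for T S :: "cpq operator" and d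
    by (simp add: sc_central[of d T] flip: mult.assoc)
  from assms consider "(l, r) \<in> hecke_relations n" | "(l, r) \<in> commutation_relations n"
    | "(l, r) \<in> idempotent_relations n" | "(l, r) \<in> recursion_relations s n"
    | "(l, r) \<in> absorption_relations s n"
    unfolding relations_def by blast
  then show ?thesis
  proof cases
    case 1
    then consider i where "1 \<le> i" "l = g_gen i * g_gen (i + 1) * g_gen i" "r = g_gen (i + 1) * g_gen i * g_gen (i + 1)"
      | i j where "1 \<le> i" "1 \<le> j" "\<bar>int i - int j\<bar> \<noteq> 1" "l = g_gen i * g_gen j" "r = g_gen j * g_gen i"
      | i where "l = g_gen i * g_gen i" "r = const (qvar - 1 / qvar) * g_gen i + 1"
      unfolding hecke_relations_def by auto
    then show ?thesis
    proof cases
      case 1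
      then show ?thesis
        using op_g_braid[of ?a "i - 1"] by (simp add: ev sc_mult_mult)
    next
      case (2 i j)
      then have "?g i * ?g j = ?g j * ?g i"
        by (cases "i = j") (auto intro!: op_g_commute)
      then show ?thesis by (simp add: 2 ev sc_mult_mult)
    next
      case (3 i)
      have "evr s l = ?g i * ?g i"
        by (simp only: 3 ev sc_mult_mult eta_square sc_arith mult_1)
      moreover have "evr s r = sc ?a * ?g i + 1"
        by (simp add: 3 ev hpar_def mult.commute[of "eta s"] sc_arith(4) mult.assoc)
      ultimately show ?thesis
        by (simp only: op_g_quadratic)
    qed
  next
    case 2
    then obtain i where "2 \<le> i" and l: "l = e_gen 1 * u_gen i" and r: "r = u_gen i * e_gen 1"
      unfolding commutation_relations_def by auto
    then have "op_e ?a ?t 1 * ?g i = ?g i * op_e ?a ?t 1"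
      by (intro op_e_g) auto
    then show ?thesis
      unfolding l r by (simp add: ev algebra_simps c) (simp add: sc_central)
  next
    case 3
    then show ?thesis
      unfolding idempotent_relations_def by (auto simp: ev op_e_idem)
  next
    case 4
    \<comment> \<open>The factor \<open>eta s\<close> gives the two recursions a common
      form.\<close>
    obtain i where i: "1 \<le> i" and lr: "l = e_gen (i + 1)"
      "r = const (eta s) * (e_gen i * u_gen i * e_gen i) - const (eta s * coefficient s) * e_gen i"
    proof -
      obtain i where "1 \<le> i" "l = e_gen (i + 1)"
        and "r = const (coefficient s) * e_gen i - e_gen i * u_gen i * e_gen i \<and> s = Minus
          \<or> r = e_gen i * u_gen i * e_gen i - const (coefficient s) * e_gen i \<and> s = Plus"
        using 4 by (cases s) (auto simp del: coefficient.simps)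
      then show ?thesis
        using that[of i] by (auto simp: Poly_Mapping.single_uminus simp del: coefficient.simps)
    qed
    define j where "j = i - 1"
    have i: "i = Suc j" using i by (simp add: j_def)
    define E G H Q K where defs: "E = op_e ?a ?t i" "G = op_g ?a j" "H = sc (eta s)" "Q = sc qvar"
      "K = sc (coefficient s)"
    have cE: "E * (H * z) = H * (E * z)" "E * (Q * z) = Q * (E * z)" for z
      unfolding defs by (rule c)+
    have "E * E = E" by (simp add: defs op_e_idem)
    then have "E * (Q - H * G) * E = Q * E - H * (E * G * E)"
      by (simp add: right_diff_distrib left_diff_distrib mult.assoc cE)
    moreover have "evr s r = H * (E * (Q - H * G) * E) - H * K * E"
      by (simp add: lr ev defs i sc_arith(4))
    ultimately have "evr s r = sc (eta s) * sc (qvar - coefficient s) * op_e ?a ?t i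
        - op_e ?a ?t i * op_g ?a j * op_e ?a ?t i"
      using e1 by (simp add: right_diff_distrib left_diff_distrib mult.assoc defs sc_arith(2))
    then show ?thesis
      unfolding lr i by (simp add: ev op_e_Suc tpar_def sc_arith)
  next
    case 5
    obtain i r' where i: "i + 3 \<le> r'"
      and "(l = (u_gen (Suc i) * u_gen (i + 2) - const (eta s) * u_gen (Suc i)) * e_gen r'
          \<and> r = (u_gen (i + 2) * u_gen (Suc i) - const (eta s) * u_gen (i + 2)) * e_gen r')
        \<or> (l = e_gen r' * (u_gen (i + 2) * u_gen (Suc i) - const (eta s) * u_gen (Suc i))
          \<and> r = e_gen r' * (u_gen (Suc i) * u_gen (i + 2) - const (eta s) * u_gen (i + 2)))"
      (is "?L \<or> ?R")
    proof -
      obtain j r' where "2 \<le> j" "j < r'"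
        and "(l = (u_gen (j - 1) * u_gen j - const (eta s) * u_gen (j - 1)) * e_gen r'
          \<and> r = (u_gen j * u_gen (j - 1) - const (eta s) * u_gen j) * e_gen r')
        \<or> (l = e_gen r' * (u_gen j * u_gen (j - 1) - const (eta s) * u_gen (j - 1))
          \<and> r = e_gen r' * (u_gen (j - 1) * u_gen j - const (eta s) * u_gen j))"
        using 5 by (cases s) (auto simp: Poly_Mapping.single_uminus)+
      moreover from \<open>2 \<le> j\<close> obtain i where "j = i + 2"
        by (metis add.commute le_Suc_ex)
      ultimately show ?thesis
        using that[of i r'] by simp
    qed
    moreover define E g h H Q where defs: "E = op_e ?a ?t r'" "g = op_g ?a i" "h = op_g ?a (Suc i)"
      "H = sc (eta s)" "Q = sc qvar"
    have hecke_span: "H * (H * z) = z" for z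
      unfolding defs by (rule e1)
    have cT: "x * (H * z) = H * (x * z)" "x * (Q * z) = Q * (x * z)"
      "x * H = H * x" "x * Q = Q * x" for x z
      unfolding defs by (rule c, rule c, simp_all add: sc_central)
    note rules = algebra_simps cT[of E] cT[of g] cT[of h] cT(1,3)[of Q] hecke_span
    \<comment> \<open>All four brackets of the absorption relations share this part; what remains of
      each is the expression in \<open>g\<close> and \<open>h\<close> treated by
      \<open>op_absorb_e\<close>.\<close>
    define Y where "Y = Q * Q - H * Q * g - H * Q * h - H * Q"
    have L: "((Q - H * g) * (Q - H * h) - H * (Q - H * g)) * z = Y * z + (g * h + g) * z"
      "((Q - H * h) * (Q - H * g) - H * (Q - H * h)) * z = Y * z + (h * g + h) * z" for z
      by (simp_all add: Y_def rules)
    have R: "z * ((Q - H * h) * (Q - H * g) - H * (Q - H * g)) = z * Y + z * (h * g + g)"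
      "z * ((Q - H * g) * (Q - H * h) - H * (Q - H * h)) = z * Y + z * (g * h + h)" for z
      by (simp_all add: Y_def rules cT[of z])
    have u: "evr s (u_gen (Suc i)) = Q - H * g" "evr s (u_gen (i + 2)) = Q - H * h"
      "evr s (e_gen r') = E" "evr s (const (eta s)) = H"
      by (simp_all add: ev defs)
    note abs = op_absorb_e[OF i, of ?a ?t, folded defs]
    ultimately show ?thesis
    proof (elim disjE conjE)
      assume "l = (u_gen (Suc i) * u_gen (i + 2) - const (eta s) * u_gen (Suc i)) * e_gen r'"
        "r = (u_gen (i + 2) * u_gen (Suc i) - const (eta s) * u_gen (i + 2)) * e_gen r'"
      then show ?thesis
        by (simp only: ev_mult ev_diff u L abs)
    next
      assume "l = e_gen r' * (u_gen (i + 2) * u_gen (Suc i) - const (eta s) * u_gen (Suc i))"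
        "r = e_gen r' * (u_gen (Suc i) * u_gen (i + 2) - const (eta s) * u_gen (i + 2))"
      then show ?thesis
        by (simp only: ev_mult ev_diff u R abs)
    qed
  qed
qed

section \<open>Evaluations reached from the parallel involution\<close>

lift_definition ins :: "nat \<Rightarrow> involution \<Rightarrow> involution"
  is "\<lambda>t w x. if x = t then t else skip t (w (unskip t x))"
  by (auto simp: skip_unskip)

lemma ap_ins [simp]: "ap (ins t w) t = t" "ap (ins t w) (skip t x) = skip t (ap w x)"
  by (simp_all add: ins.rep_eq)

lemma skip_cases: obtains "x = t" | y where "x = skip t y"
  using skip_unskip[of x t] by metis

lemma ins_0: "ins 0 w = fx w"
  by (rule involution_eqI, case_tac x) (simp_all add: ins.rep_eq skip_def unskip_def)

lemma hecke_ins: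
  assumes "t < ap w t"
  shows "hecke a t f (ins t w) = f (ins (Suc t) w)"
proof -
  have s: "sw t (skip t x) = skip (Suc t) x" "sw t (skip (Suc t) x) = skip t x" for x
    by (auto simp: sw_def skip_def)
  have "cj t (ins t w) = ins (Suc t) w"
  proof (rule involution_eqI)
    fix x show "ap (cj t (ins t w)) x = ap (ins (Suc t) w) x"
      by (cases x rule: skip_cases[where t = "Suc t"]) (simp_all add: s)
  qed
  moreover have "skip t t = Suc t" by (simp add: skip_def)
  then have "ap (ins t w) (Suc t) = skip t (ap w t)"
    using ap_ins(2)[of t w t] by simp
  ultimately show ?thesis
    using assms by (simp add: hecke_def both_fixed_def skip_def)
qed

text \<open>Every strand passed by the fixed point is the left end of an arc, so each step is an
  ascent and no correction terms arise.\<close>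

lemma descend_ins:
  "(\<And>x. x < t \<Longrightarrow> x < ap w x) \<Longrightarrow> app (descend a t) f (fx w) = f (ins t w)"
  by (induction t arbitrary: f) (simp_all add: ins_0 hecke_ins)

text \<open>The strands \<open>0, \<dots>, l - 1\<close> are joined to \<open>l + k, \<dots>, 2 * l + k - 1\<close> in this order; all others are fixed.\<close>

lift_definition parallel :: "nat \<Rightarrow> nat \<Rightarrow> involution"
  is "\<lambda>l k x. if x < l then x + l + k else if x < l + k then x else if x < 2 * l + k then x - l - k else x"
  by auto

lemma parallel_Suc: "parallel (Suc l) k = arc (l + k) (parallel l k)"
proof (rule involution_eqI)
  fix x show "ap (parallel (Suc l) k) x = ap (arc (l + k) (parallel l k)) x"
    by (cases x rule: arc_cases[where j = "l + k"]; simp; auto simp: parallel.rep_eq skip_def)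
qed

lemma ins_parallel: "ins l (parallel l k) = parallel l (Suc k)"
proof (rule involution_eqI)
  fix x show "ap (ins l (parallel l k)) x = ap (parallel l (Suc k)) x"
    by (cases x rule: skip_cases[where t = l]; simp; auto simp: parallel.rep_eq skip_def)
qed

text \<open>A monoid and not an algebra: its elements are products of invertible generators, so they
  can later be stripped off one letter at a time.\<close>

inductive_set gmon :: "'k::comm_ring_1 \<Rightarrow> nat \<Rightarrow> nat \<Rightarrow> 'k operator set" for a lo hi where
  one: "1 \<in> gmon a lo hi"
| step: "T \<in> gmon a lo hi \<Longrightarrow> lo \<le> i \<Longrightarrow> i < hi \<Longrightarrow> op_g a i * T \<in> gmon a lo hi"

lemma gmon_mult: "S \<in> gmon a lo hi \<Longrightarrow> T \<in> gmon a lo hi \<Longrightarrow> S * T \<in> gmon a lo hi"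
  by (induction rule: gmon.induct) (auto simp: mult.assoc intro: gmon.intros)

lemma gmon_mono: "T \<in> gmon a lo hi \<Longrightarrow> lo' \<le> lo \<Longrightarrow> hi \<le> hi' \<Longrightarrow> T \<in> gmon a lo' hi'"
  by (induction rule: gmon.induct) (auto intro: gmon.intros)

lemma op_P_gmon:
  "T \<in> gmon a (Suc lo) (Suc hi) \<Longrightarrow> \<exists>T'\<in>gmon a lo hi. op_P a t * T = T' * op_P a t"
proof (induction rule: gmon.induct)
  case one
  show ?case by (rule bexI[of _ 1]) (auto intro: gmon.intros)
next
  case (step T i)
  then obtain T' j where "T' \<in> gmon a lo hi" "op_P a t * T = T' * op_P a t" "i = Suc j"
    by (metis Suc_le_D)
  moreover from this step have "op_g a j * T' \<in> gmon a lo hi"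
    by (auto intro: gmon.step)
  moreover have "op_P a t * (op_g a i * T) = op_g a j * T' * op_P a t"
    using calculation by (simp add: mult.assoc op_P_g flip: mult.assoc[of "op_P a t"])
  ultimately show ?case by blast
qed

lemma op_fix_gmon:
  "T \<in> gmon a lo hi \<Longrightarrow> \<exists>T'\<in>gmon a (lo + r) (hi + r). op_fix ^ r * T = T' * op_fix ^ r"
proof (induction rule: gmon.induct)
  case one
  show ?case by (rule bexI[of _ 1]) (auto intro: gmon.intros)
next
  case (step T i)
  then obtain T' where "T' \<in> gmon a (lo + r) (hi + r)" "op_fix ^ r * T = T' * op_fix ^ r"
    by blast
  moreover from this step have "op_g a (i + r) * T' \<in> gmon a (lo + r) (hi + r)"
    by (auto intro: gmon.step)
  moreover have "op_fix ^ r * (op_g a i * T) = op_g a (i + r) * T' * op_fix ^ r"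
    using calculation by (simp add: mult.assoc flip: mult.assoc[of "op_fix ^ r"] op_g_fix_power)
  ultimately show ?case by blast
qed

lemma descend_add: "\<exists>T\<in>gmon a l (l + k). descend a (l + k) = T * descend a l"
proof (induction k)
  case 0
  show ?case by (rule bexI[of _ 1]) (auto intro: gmon.intros)
next
  case (Suc k)
  then obtain T where "T \<in> gmon a l (l + k)" "descend a (l + k) = T * descend a l" by blast
  then show ?case
    by (intro bexI[of _ "op_g a (l + k) * T"])
      (auto simp: mult.assoc intro!: gmon.step intro: gmon_mono)
qed

text \<open>The first arc becomes a fixed point that has to travel to position \<open>l + k\<close>.
  Passing the \<open>l\<close> left ends is exact and produces \<open>parallel l (Suc k)\<close>.
  The steps past the \<open>k\<close> fixed points could create arcs; they are kept as the factor
  \<open>T\<close>.\<close>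

lemma op_P_parallel:
  "\<exists>T\<in>gmon a l (l + k). \<forall>f. app (op_P a t) f (parallel (Suc l) k) = t * app T f (parallel l (Suc k))"
proof -
  obtain T where T: "T \<in> gmon a l (l + k)" "descend a (l + k) = T * descend a l"
    using descend_add by blast
  have "app (op_P a t) f (parallel (Suc l) k) = t * app T f (parallel l (Suc k))" for f
    unfolding parallel_Suc op_P.rep_eq
    by (simp add: T(2) descend_ins parallel.rep_eq flip: ins_parallel)
  with T show ?thesis by blast
qed

lemma op_P_power_parallel:
  "r \<le> n \<Longrightarrow> \<exists>T\<in>gmon a (n - r) (n - 1). \<forall>f. app (op_P a t ^ r) f (parallel n 0) = t ^ r * app T f (parallel (n - r) r)"
proof (induction r)
  case 0
  show ?case by (rule bexI[of _ 1]) (auto intro: gmon.intros)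
next
  case (Suc r)
  define l where "l = n - Suc r"
  have n: "n - r = Suc l" "n - 1 = l + r" using Suc.prems by (auto simp: l_def)
  obtain T where T: "T \<in> gmon a (Suc l) (l + r)"
    "\<And>f. app (op_P a t ^ r) f (parallel n 0) = t ^ r * app T f (parallel (Suc l) r)"
    using Suc unfolding n by auto
  obtain S where S: "S \<in> gmon a l (l + r)"
    "\<And>f. app (op_P a t) f (parallel (Suc l) r) = t * app S f (parallel l (Suc r))"
    using op_P_parallel by blast
  have "T \<in> gmon a (Suc l) (Suc (l + r))"
    using T(1) by (rule gmon_mono) auto
  then obtain T' where T': "T' \<in> gmon a l (l + r)" "op_P a t * T = T' * op_P a t"
    using op_P_gmon by blast
  have "app (op_P a t ^ Suc r) f (parallel n 0) = t ^ Suc r * app (T' * S) f (parallel l (Suc r))" for f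
  proof -
    have "app (op_P a t ^ Suc r) f (parallel n 0) = t ^ r * app (op_P a t * T) f (parallel (Suc l) r)"
      by (simp add: T(2))
    also have "\<dots> = t ^ r * app (op_P a t) (app T' f) (parallel (Suc l) r)"
      by (simp add: T'(2))
    finally show ?thesis by (simp add: S(2) mult.assoc mult.commute mult.left_commute)
  qed
  moreover have "T' * S \<in> gmon a l (l + r)"
    using T'(1) S(1) by (rule gmon_mult)
  ultimately show ?case
    unfolding n l_def[symmetric] by blast
qed

lemma app_op_fix_power: "app (op_fix ^ r) f w = f ((fx ^^ r) w)"
proof (induction r arbitrary: f)
  case (Suc r)
  have "app (op_fix ^ Suc r) f w = app (op_fix ^ r) (app op_fix f) w"
    by simp
  then show ?case by (simp add: Suc)
qed simp

text \<open>The involution \<open>parallel n 0\<close> with its first \<open>r\<close> arcs replaced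
  by pairs of fixed points; \<open>omega n 0\<close> is the one called omega in the
  overview.\<close>

definition omega :: "nat \<Rightarrow> nat \<Rightarrow> involution"
  where "omega n r = (fx ^^ r) (parallel (n - r) r)"

lemma ap_fx_power: "ap ((fx ^^ r) w) x = (if x < r then x else ap w (x - r) + r)"
proof (induction r arbitrary: x)
  case (Suc r)
  show ?case by (cases x) (auto simp: Suc)
qed simp

text \<open>The leftover Hecke word lies in the range from \<open>n - r\<close> to
  \<open>n - 1\<close>. Adjoining \<open>r\<close> points at the front shifts it entirely into the
  second row, where \<open>reach_gmon\<close> can remove it.\<close>

lemma op_e_parallel:
  assumes "r \<le> n"
  shows "\<exists>T\<in>gmon a n (n + n - 1). \<forall>f. app (op_e a t r) f (parallel n 0) = t ^ r * app T f (omega n r)"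
proof (cases n)
  case 0
  with assms show ?thesis
    by (auto simp: op_e_def omega_def intro: bexI[OF _ gmon.one])
next
  case (Suc m)
  obtain T where T: "T \<in> gmon a (n - r) (n - 1)"
    "\<And>f. app (op_P a t ^ r) f (parallel n 0) = t ^ r * app T f (parallel (n - r) r)"
    using op_P_power_parallel[OF assms] by blast
  obtain T' where T': "T' \<in> gmon a (n - r + r) (n - 1 + r)" "op_fix ^ r * T = T' * op_fix ^ r"
    using op_fix_gmon[OF T(1)] by blast
  have "app (op_e a t r) f (parallel n 0) = t ^ r * app T' f (omega n r)" for f
  proof -
    have "app (op_e a t r) f (parallel n 0) = t ^ r * app (op_fix ^ r * T) f (parallel (n - r) r)"
      by (simp add: op_e_def T(2))
    also have "app (op_fix ^ r * T) f (parallel (n - r) r) = app T' f (omega n r)"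
      by (simp add: T'(2) app_op_fix_power omega_def)
    finally show ?thesis .
  qed
  moreover have "T' \<in> gmon a n (n + n - 1)"
    using T'(1) by (rule gmon_mono) (use assms Suc in auto)
  ultimately show ?thesis by blast
qed

section \<open>Functionals obtained from the algebra\<close>

inductive_set calg :: "'k::comm_ring_1 \<Rightarrow> 'k \<Rightarrow> nat \<Rightarrow> 'k operator set" for a t n where
  sc: "sc c \<in> calg a t n"
| g: "Suc i < n \<Longrightarrow> op_g a i \<in> calg a t n"
| e: "r \<le> n \<Longrightarrow> op_e a t r \<in> calg a t n"
| add: "S \<in> calg a t n \<Longrightarrow> T \<in> calg a t n \<Longrightarrow> S + T \<in> calg a t n"
| mult: "S \<in> calg a t n \<Longrightarrow> T \<in> calg a t n \<Longrightarrow> S * T \<in> calg a t n"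

lemma calg_commute: "T \<in> calg a t n \<Longrightarrow> op_g a (n + i) * T = T * op_g a (n + i)"
proof (induction rule: calg.induct)
  case (sc c)
  show ?case by (simp add: sc_central)
next
  case (g j)
  then show ?case by (simp add: op_g_commute)
next
  case (e r)
  then show ?case by (simp add: op_e_g)
next
  case (mult S T)
  have "op_g a (n + i) * (S * T) = op_g a (n + i) * S * T" by (simp only: mult.assoc)
  also have "\<dots> = S * (op_g a (n + i) * T)" unfolding mult.IH(1) by (simp only: mult.assoc)
  also have "\<dots> = S * T * op_g a (n + i)" unfolding mult.IH(2) by (simp only: mult.assoc)
  finally show ?case .
qed (simp add: distrib_left distrib_right)

text \<open>Reachability is preserved by Hecke operators of both rows \<open>{..<n}\<close> and \<open>{n..<n + n}\<close>: those of the second row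
  commute with \<open>calg\<close> and agree with those of the first row on \<open>parallel n 0\<close>.\<close>

definition reachable ::
    "'k::field \<Rightarrow> 'k \<Rightarrow> nat \<Rightarrow> ((involution \<Rightarrow> 'k) \<Rightarrow> 'k) \<Rightarrow> bool"
  where "reachable a t n \<phi> \<longleftrightarrow> (\<exists>T\<in>calg a t n. \<forall>f. app T f (parallel n 0) = \<phi> f)"

definition inner :: "nat \<Rightarrow> nat \<Rightarrow> bool"
  where "inner n i \<longleftrightarrow> Suc i < n \<or> (n \<le> i \<and> Suc i < n + n)"

context
  fixes a t :: "'k::field" and n :: nat
  assumes t: "t \<noteq> 0"
begin

lemma reach_lin: "reachable a t n \<phi> \<Longrightarrow> reachable a t n \<psi> \<Longrightarrow> reachable a t n (\<lambda>f. c * \<phi> f + \<psi> f)"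
proof -
  assume "reachable a t n \<phi>" "reachable a t n \<psi>"
  then obtain S T where "S \<in> calg a t n" "\<forall>f. app S f (parallel n 0) = \<phi> f"
    "T \<in> calg a t n" "\<forall>f. app T f (parallel n 0) = \<psi> f"
    unfolding reachable_def by blast
  then show "reachable a t n (\<lambda>f. c * \<phi> f + \<psi> f)"
    unfolding reachable_def
    by (intro bexI[of _ "S * sc c + T"]) (auto intro: calg.intros)
qed

lemma reach_left:
  assumes "reachable a t n \<phi>" "S \<in> calg a t n"
  shows "reachable a t n (\<lambda>f. \<phi> (app S f))"
proof -
  obtain T where "T \<in> calg a t n" "\<forall>f. app T f (parallel n 0) = \<phi> f"
    using assms unfolding reachable_def by blast
  then show ?thesis
    unfolding reachable_def using assms(2)
    by (intro bexI[of _ "S * T"]) (auto intro: calg.intros)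
qed

lemma hecke_parallel: "Suc i < n \<Longrightarrow> hecke a (n + i) f (parallel n 0) = hecke a i f (parallel n 0)"
proof -
  assume i: "Suc i < n"
  have "cj (n + i) (parallel n 0) = cj i (parallel n 0)"
  proof (rule involution_eqI)
    fix x
    show "ap (cj (n + i) (parallel n 0)) x = ap (cj i (parallel n 0)) x"
      using i by (auto simp: parallel.rep_eq sw_def)
  qed
  then show ?thesis
    using i by (simp add: hecke_def both_fixed_def parallel.rep_eq)
qed

lemma reach_g:
  assumes "reachable a t n \<phi>" "inner n i"
  shows "reachable a t n (\<lambda>f. \<phi> (hecke a i f))"
proof (cases "Suc i < n")
  case True
  then show ?thesis
    using reach_left[OF assms(1) calg.g[OF True]] by simp
next
  case False
  then obtain j where j: "i = n + j" "Suc j < n"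
    using assms(2) unfolding inner_def by (metis add_Suc_right le_Suc_ex nat_add_left_cancel_less)
  obtain T where T: "T \<in> calg a t n" "\<forall>f. app T f (parallel n 0) = \<phi> f"
    using assms unfolding reachable_def by blast
  have "app (T * op_g a j) f (parallel n 0) = \<phi> (hecke a i f)" for f
  proof -
    have "\<phi> (hecke a i f) = app (op_g a (n + j) * T) f (parallel n 0)"
      using T(2) by (simp add: j)
    also have "\<dots> = hecke a (n + j) (app T f) (parallel n 0)"
      unfolding calg_commute[OF T(1)] by simp
    finally show ?thesis using j by (simp add: hecke_parallel)
  qed
  then show ?thesis
    unfolding reachable_def using T(1) j by (blast intro: calg.intros)
qed

text \<open>\<open>op_g a i - sc a\<close> is inverse to \<open>op_g a i\<close> by the quadratic
  relation, so leading generators can be cancelled.\<close>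

lemma reach_gmon:
  assumes "T \<in> gmon a n (n + n - 1)" "reachable a t n (\<lambda>f. app T f w)"
  shows "reachable a t n (\<lambda>f. f w)"
  using assms
proof (induction rule: gmon.induct)
  case (step T i)
  have i: "inner n i" using step by (auto simp: inner_def)
  let ?\<phi> = "\<lambda>f. app (op_g a i * T) f w"
  have "reachable a t n (\<lambda>f. - a * ?\<phi> f + ?\<phi> (hecke a i f))"
    using step.prems reach_g[OF step.prems i] by (rule reach_lin)
  moreover have "- a * ?\<phi> f + ?\<phi> (hecke a i f) = app T f w" for f
  proof -
    have "?\<phi> (hecke a i f) = app (op_g a i * op_g a i * T) f w" by simp
    also have "\<dots> = a * ?\<phi> f + app T f w"
      unfolding op_g_quadratic using arg_cong[OF sc_central[of a "op_g a i * T"], of "\<lambda>S. app S f w"]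
      by (simp add: distrib_right mult.assoc)
    finally show ?thesis by simp
  qed
  ultimately show ?case
    using step.IH by simp
qed simp

lemma reach_omega:
  assumes "r \<le> n"
  shows "reachable a t n (\<lambda>f. f (omega n r))"
proof -
  obtain T where T: "T \<in> gmon a n (n + n - 1)"
    "\<forall>f. app (op_e a t r) f (parallel n 0) = t ^ r * app T f (omega n r)"
    using op_e_parallel[OF assms] by blast
  \<comment> \<open>Here \<open>t \<noteq> 0\<close> enters: the weight collected from
    \<open>r\<close> removed arcs is divided out.\<close>
  have "app (op_e a t r * sc (inverse (t ^ r))) f (parallel n 0) = app T f (omega n r)" for f
    using T(2) t by simp
  then have "reachable a t n (\<lambda>f. app T f (omega n r))"
    unfolding reachable_def using assms by (blast intro: calg.intros)
  with T(1) show ?thesis by (rule reach_gmon)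
qed

text \<open>Evaluating \<open>hecke\<close> at \<open>cj i w\<close> gives the value at
  \<open>w\<close>, plus \<open>a\<close> times the value at \<open>cj i w\<close> if that is a
  descent; the latter is already reachable and can be subtracted.\<close>

lemma reach_cj:
  assumes i: "inner n i" "\<not> both_fixed i w" "ap w i \<noteq> Suc i" and r: "reachable a t n (\<lambda>f. f (cj i w))"
  shows "reachable a t n (\<lambda>f. f w)"
proof -
  define v where "v = cj i w"
  have w: "cj i v = w" by (simp add: v_def)
  have "ap w (Suc i) \<noteq> i" using i(3) ap_eq_Suc by blast
  then have v: "\<not> both_fixed i v" "ap v i \<noteq> Suc i"
    using i(2,3) by (auto simp: v_def both_fixed_def sw_def split: if_splits)
  have h: "reachable a t n (\<lambda>f. hecke a i f v)"
    using reach_g[OF r i(1)] by (simp add: v_def)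
  show ?thesis
  proof (cases "ap v i < ap v (Suc i)")
    case True
    with h v show ?thesis by (simp add: hecke_def w)
  next
    case False
    have "reachable a t n (\<lambda>f. - a * f v + hecke a i f v)"
      using r h unfolding v_def by (rule reach_lin)
    then show ?thesis
      using v False by (simp add: hecke_def w)
  qed
qed

text \<open>At a fixed pair \<open>hecke\<close> contains the arc with coefficient 1. The opposite
  passage has coefficient \<open>- a\<close>, which may vanish for the general \<open>a\<close>
  here, so arcs are reached from fixed pairs and not conversely.\<close>

lemma reach_toggle:
  assumes i: "inner n i" "ap w i = Suc i" and r: "reachable a t n (\<lambda>f. f (toggle i w))"
  shows "reachable a t n (\<lambda>f. f w)"
proof -
  have "both_fixed i (toggle i w)"
    using i(2) by (simp add: both_fixed_toggle)
  moreover have "reachable a t n (\<lambda>f. 1 * f (toggle i w) + hecke a i f (toggle i w))"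
    using r reach_g[OF r i(1)] by (rule reach_lin)
  ultimately show ?thesis
    by (simp add: hecke_def)
qed

end

section \<open>The moment of an involution\<close>

definition supported :: "nat \<Rightarrow> involution \<Rightarrow> bool"
  where "supported m w \<longleftrightarrow> (\<forall>x\<ge>m. ap w x = x)"

lemma supported_less: "supported m w \<Longrightarrow> x < m \<Longrightarrow> ap w x < m"
  unfolding supported_def by (metis ap_ap not_le)

lemma supported_cj: "supported m w \<Longrightarrow> Suc i < m \<Longrightarrow> supported m (cj i w)"
  by (auto simp: supported_def sw_def)

lemma supported_toggle: "supported m w \<Longrightarrow> Suc i < m \<Longrightarrow> supported m (toggle i w)"
  by (auto simp: supported_def sw_def ap_toggle)

text \<open>Conjugating a descent away increases the moment, which is bounded.\<close>

definition moment :: "nat \<Rightarrow> involution \<Rightarrow> int"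
  where "moment m w = (\<Sum>x<m. int x * int (ap w x))"

lemma sum_sw: "Suc i < m \<Longrightarrow> (\<Sum>x<m. h (sw i x)) = (\<Sum>x<m. h x)"
  by (rule sum.reindex_bij_witness[of _ "sw i" "sw i"]) (auto simp: sw_def)

lemma sum_ap: "supported m w \<Longrightarrow> (\<Sum>x<m. h (ap w x)) = (\<Sum>x<m. h x)"
  by (rule sum.reindex_bij_witness[of _ "ap w" "ap w"]) (auto simp: supported_less)

lemma sum_sw_diff:
  assumes "Suc i < m"
  shows "(\<Sum>x<m. int (sw i x) * h x) = (\<Sum>x<m. int x * h x) + h i - h (Suc i)"
proof -
  have "(\<Sum>x<m. (int (sw i x) - int x) * h x) = (\<Sum>x\<in>{i, Suc i}. (int (sw i x) - int x) * h x)"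
    by (rule sum.mono_neutral_right) (use assms in \<open>auto simp: sw_def\<close>)
  also have "\<dots> = h i - h (Suc i)"
    by (simp add: algebra_simps)
  finally show ?thesis
    by (simp add: left_diff_distrib sum_subtractf)
qed

lemma moment_cj:
  assumes m: "Suc i < m" and w: "supported m w"
  shows "moment m (cj i w) = moment m w + int (ap w i) - int (ap w (Suc i))
    + int (sw i (ap w i)) - int (sw i (ap w (Suc i)))"
proof -
  have "moment m (cj i w) = (\<Sum>x<m. int (sw i x) * int (sw i (ap w x)))"
    unfolding moment_def using sum_sw[OF m, of "\<lambda>x. int (sw i x) * int (sw i (ap w x))"] by simp
  also have "\<dots> = (\<Sum>x<m. int x * int (sw i (ap w x))) + int (sw i (ap w i)) - int (sw i (ap w (Suc i)))"
    by (rule sum_sw_diff[OF m])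
  also have "(\<Sum>x<m. int x * int (sw i (ap w x))) = (\<Sum>x<m. int (sw i x) * int (ap w x))"
    using sum_ap[OF w, of "\<lambda>x. int (sw i x) * int (ap w x)"] by (simp add: mult.commute)
  also have "\<dots> = moment m w + int (ap w i) - int (ap w (Suc i))"
    unfolding moment_def by (rule sum_sw_diff[OF m])
  finally show ?thesis by simp
qed

text \<open>Both differences in \<open>moment_cj\<close> are positive: \<open>sw i\<close> keeps the
  order of the two images unless they are \<open>i\<close> and \<open>Suc i\<close>, which at a
  descent would mean an arc.\<close>

lemma moment_cj_less:
  assumes m: "Suc i < m" and w: "supported m w" and d: "ap w (Suc i) < ap w i" and n: "ap w i \<noteq> Suc i"
  shows "moment m w < moment m (cj i w)"
proof -
  have "ap w (Suc i) \<noteq> i" using n ap_eq_Suc by blast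
  then have "int (ap w (Suc i)) + int (sw i (ap w (Suc i))) < int (ap w i) + int (sw i (ap w i))"
    using d n unfolding sw_def by (auto split: if_splits)
  then show ?thesis
    using moment_cj[OF m w] by linarith
qed

text \<open>Removing the arc replaces 2 i (i + 1) by the sum of the squares of i and i + 1, a gain
  of 1.\<close>

lemma moment_toggle_less:
  assumes m: "Suc i < m" and w: "supported m w" and n: "ap w i = Suc i"
  shows "moment m w < moment m (toggle i w)"
proof -
  have "moment m (toggle i w) = (\<Sum>x<m. int (sw i x) * int (ap w x))"
    unfolding moment_def using n sum_sw[OF m, of "\<lambda>x. int (sw i x) * int (ap w x)"]
    by (simp add: ap_toggle)
  also have "\<dots> = moment m w + int (ap w i) - int (ap w (Suc i))"
    unfolding moment_def by (rule sum_sw_diff[OF m])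
  finally show ?thesis
    using n ap_eq_Suc[of w i] by simp
qed

lemma moment_le: "supported m w \<Longrightarrow> moment m w \<le> int m * (int m * int m)"
proof -
  assume w: "supported m w"
  have "moment m w \<le> (\<Sum>x<m. int m * int m)"
    unfolding moment_def
    by (rule sum_mono, rule mult_mono) (use supported_less[OF w] in \<open>auto intro: less_imp_le\<close>)
  then show ?thesis by simp
qed

lemma moment_induct [consumes 1, case_names step]:
  assumes w: "supported m w"
    and step: "\<And>w. supported m w \<Longrightarrow> (\<And>v. supported m v \<Longrightarrow> moment m w < moment m v \<Longrightarrow> Q v) \<Longrightarrow> Q w"
  shows "Q w"
  using w
proof (induction w rule: measure_induct_rule[where f = "\<lambda>w. nat (int m * (int m * int m) - moment m w)"])
  case (less w)
  show ?case
    by (rule step[OF less.prems], rule less.IH) (use moment_le in fastforce)+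
qed

section \<open>Arcs between the rows and involutions without inner descents\<close>

definition cross :: "nat \<Rightarrow> involution \<Rightarrow> nat"
  where "cross n w = card {x. x < n \<and> n \<le> ap w x}"

lemma sw_inner: "inner n i \<Longrightarrow> sw i x < n \<longleftrightarrow> x < n"
  by (auto simp: inner_def sw_def)

lemma sw_inner': "inner n i \<Longrightarrow> n \<le> sw i x \<longleftrightarrow> n \<le> x"
  by (auto simp: inner_def sw_def)

lemma image_sw_eqI:
  assumes "\<And>x. x \<in> A \<longleftrightarrow> sw i x \<in> B"
  shows "A = sw i ` B"
proof (intro Set.set_eqI iffI)
  fix x assume "x \<in> A"
  then have "sw i x \<in> B" using assms by blast
  then have "sw i (sw i x) \<in> sw i ` B" by (rule imageI)
  then show "x \<in> sw i ` B" by simp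
next
  fix x assume "x \<in> sw i ` B"
  then obtain y where "x = sw i y" "y \<in> B" by blast
  then show "x \<in> A" using assms[of x] by simp
qed

lemma cross_cj:
  assumes "inner n i"
  shows "cross n (cj i w) = cross n w"
proof -
  have "{x. x < n \<and> n \<le> ap (cj i w) x} = sw i ` {x. x < n \<and> n \<le> ap w x}"
    (is "?L = _ ` ?R")
  proof -
    have "x \<in> ?L \<longleftrightarrow> sw i x \<in> ?R" for x
      using sw_inner[OF assms, of x] sw_inner'[OF assms, of "ap w (sw i x)"] by simp
    then show ?thesis by (rule image_sw_eqI)
  qed
  moreover have "inj (sw i)" by (metis injI sw_sw)
  ultimately show ?thesis
    by (simp add: cross_def card_image inj_on_subset)
qed

text \<open>With \<open>r + t = n\<close> this joins the last \<open>t\<close> points of the first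
  row, in order, to the first \<open>t\<close> points of the second row: the form with
  \<open>t\<close> crossing arcs that has no descent inside a row.\<close>

lift_definition stair :: "nat \<Rightarrow> nat \<Rightarrow> involution"
  is "\<lambda>r t x. if x < r then x else if x < r + t then x + t else if x < r + 2 * t then x - t else x"
  by auto

lemma increasing:
  fixes f :: "nat \<Rightarrow> nat"
  assumes "\<And>i. lo \<le> i \<Longrightarrow> Suc i < hi \<Longrightarrow> f i < f (Suc i)"
  shows "lo \<le> x \<Longrightarrow> x < y \<Longrightarrow> y < hi \<Longrightarrow> f x < f y"
proof (induction y)
  case (Suc y)
  then show ?case
    using assms[of y] by (cases "x = y") (auto intro: less_trans)
qed simp

lemma increasing_ge:
  fixes f :: "nat \<Rightarrow> nat"
  assumes "\<And>i j. i < j \<Longrightarrow> j < t \<Longrightarrow> f i < f j"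
  shows "i < t \<Longrightarrow> i \<le> f i"
proof (induction i)
  case (Suc i)
  then show ?case using assms[of i "Suc i"] by simp
qed simp

lemma initial_segment:
  fixes A :: "nat set"
  assumes "finite A" "\<And>x y. y \<in> A \<Longrightarrow> x < y \<Longrightarrow> x \<in> A"
  shows "A = {..<card A}"
proof -
  have "\<exists>k. A = {..<k}"
  proof (cases "A = {}")
    case False
    have "x \<in> A \<longleftrightarrow> x < Suc (Max A)" for x
      using assms(2)[OF Max_in[OF assms(1) False], of x] Max_in[OF assms(1) False] Max_ge[OF assms(1), of x]
      by (auto simp: less_Suc_eq_le le_less)
    then have "A = {..<Suc (Max A)}" by blast
    then show ?thesis ..
  qed auto
  then show ?thesis by auto
qed

text \<open>An involution increasing on a row fixes every point whose image stays in that row. By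
  monotonicity these points form an initial segment of the first row and a final segment of the
  second, and the other points are matched increasingly.\<close>

lemma no_descent_stair:
  assumes w: "supported (n + n) w" and up: "\<And>i. inner n i \<Longrightarrow> ap w i < ap w (Suc i)"
  shows "w = stair (n - cross n w) (cross n w)"
proof -
  have incL: "x < y \<Longrightarrow> y < n \<Longrightarrow> ap w x < ap w y" for x y
    by (rule increasing[where f = "ap w" and lo = 0 and hi = n]) (auto intro!: up simp: inner_def)
  have incR: "n \<le> x \<Longrightarrow> x < y \<Longrightarrow> y < n + n \<Longrightarrow> ap w x < ap w y" for x y
    by (rule increasing[where f = "ap w" and lo = n and hi = "n + n"]) (auto intro!: up simp: inner_def)
  have fixL: "ap w x = x" if "x < n" "ap w x < n" for x
    using incL[of x "ap w x"] incL[of "ap w x" x] that by (cases x "ap w x" rule: linorder_cases) auto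
  have fixR: "ap w x = x" if "n \<le> x" "x < n + n" "n \<le> ap w x" for x
    using incR[of x "ap w x"] incR[of "ap w x" x] that supported_less[OF w, of x]
    by (cases x "ap w x" rule: linorder_cases) auto
  define A where "A = {x. x < n \<and> ap w x < n}"
  define C where "C = {x. x < n \<and> n \<le> ap w x}"
  define D where "D = {z. z < n \<and> ap w (n + z) < n}"
  define r t where "r = n - card C" "t = card C"
  have "A \<union> C = {..<n}" "A \<inter> C = {}" by (auto simp: A_def C_def)
  moreover have fin: "finite A" "finite C" "finite D" by (auto simp: A_def C_def D_def)
  ultimately have "card A + card C = n"
    by (metis card_Un_disjoint card_lessThan)
  then have r: "card A = r" "r + t = n" by (auto simp: r_t_def)
  have A: "A = {..<r}"
    unfolding r(1)[symmetric]
    by (rule initial_segment[OF fin(1)]) (auto simp: A_def dest: incL)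
  have "bij_betw (\<lambda>x. ap w x - n) C D"
  proof (rule bij_betwI[where g = "\<lambda>z. ap w (n + z)"])
    show "(\<lambda>x. ap w x - n) \<in> C \<rightarrow> D"
    proof
      fix x assume "x \<in> C"
      then show "ap w x - n \<in> D"
        using supported_less[OF w, of x] by (auto simp: C_def D_def)
    qed
  qed (auto simp: C_def D_def)
  then have "card D = t" by (simp add: bij_betw_same_card r_t_def)
  moreover have "D = {..<card D}"
  proof (rule initial_segment[OF fin(3)])
    fix x y assume "y \<in> D" "x < y"
    then show "x \<in> D"
      using incR[of "n + x" "n + y"] by (auto simp: D_def)
  qed
  ultimately have D: "D = {..<t}" by simp
  have L: "r \<le> x \<Longrightarrow> x < n \<Longrightarrow> n \<le> ap w x" for x
    using A by (auto simp: A_def not_less[symmetric])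
  have L2: "ap w (r + i) - n < t" "n \<le> ap w (r + i)" if "i < t" for i
  proof -
    show n: "n \<le> ap w (r + i)" using L that r(2) by simp
    then have "ap w (r + i) - n \<in> D"
      using supported_less[OF w, of "r + i"] that r(2) by (auto simp: D_def)
    then show "ap w (r + i) - n < t" by (simp add: D)
  qed
  have R2: "ap w (n + j) - r < t" "r \<le> ap w (n + j)" if "j < t" for j
  proof -
    have j: "ap w (n + j) < n" "j < n" using that D by (auto simp: D_def)
    then have "ap w (n + j) \<notin> A" by (auto simp: A_def)
    then show "r \<le> ap w (n + j)" by (simp add: A)
    then show "ap w (n + j) - r < t" using j r(2) by simp
  qed
  have w1: "ap w (r + i) = n + i" if i: "i < t" for i
  proof -
    \<comment> \<open>The matching of the crossing points and its inverse, renumbered from 0. Both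
      are increasing, hence i \<le> u i \<le> v (u i) = i.\<close>
    define u v where "u i = ap w (r + i) - n" and "v j = ap w (n + j) - r" for i j
    have u: "ap w (r + i) = n + u i" "u i < t" if "i < t" for i using L2[OF that] by (simp_all add: u_def)
    have v: "ap w (n + j) = r + v j" "v j < t" if "j < t" for j using R2[OF that] by (simp_all add: v_def)
    have "i \<le> u i"
    proof (rule increasing_ge[of t, OF _ i])
      fix j k assume "j < k" "k < t"
      then have "ap w (r + j) < ap w (r + k)" using r(2) by (intro incL) auto
      then show "u j < u k" using u[of j] u[of k] \<open>j < k\<close> \<open>k < t\<close> by simp
    qed
    moreover have "j \<le> v j" if "j < t" for j
    proof (rule increasing_ge[of t, OF _ that])
      fix j k assume "j < k" "k < t"
      then have "ap w (n + j) < ap w (n + k)" using r(2) by (intro incR) auto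
      then show "v j < v k" using v[of j] v[of k] \<open>j < k\<close> \<open>k < t\<close> by simp
    qed
    then have "u i \<le> v (u i)" using u(2)[OF i] .
    moreover have "v (u i) = i"
      using u[OF i] v(1)[of "u i"] ap_ap[of w "r + i"] by simp
    ultimately show ?thesis using u[OF i] by simp
  qed
  then have w2: "ap w (n + i) = r + i" if "i < t" for i
    using that by (metis ap_ap)
  have "w = stair r t"
  proof (rule involution_eqI)
    fix x
    consider "x < r" | "r \<le> x" "x < r + t" | "n \<le> x" "x < n + t"
      | "n + t \<le> x" "x < n + n" | "n + n \<le> x"
      using r(2) by linarith
    then show "ap w x = ap (stair r t) x"
    proof cases
      case 1
      then have "x \<in> A" by (simp add: A)
      then show ?thesis using 1 fixL by (simp add: stair.rep_eq A_def)
    next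
      case 2
      then show ?thesis
        using w1[of "x - r"] r(2) by (simp add: stair.rep_eq)
    next
      case 3
      then show ?thesis
        using w2[of "x - n"] r(2) by (simp add: stair.rep_eq)
    next
      case 4
      define z where "z = x - n"
      have z: "x = n + z" "z \<notin> D" "z < n" using 4 by (auto simp: z_def D)
      then have "ap w x = x" using fixR[of x] by (auto simp: D_def)
      then show ?thesis using 4 r(2) by (simp add: stair.rep_eq)
    next
      case 5
      then show ?thesis using w r(2) by (simp add: stair.rep_eq supported_def)
    qed
  qed
  then show ?thesis by (simp add: r_t_def C_def cross_def)
qed


text \<open>Excludes arcs inside a row. Inner conjugations preserve this, so starting from
  \<open>omega n r\<close> a toggle is never called for.\<close>

definition crossing :: "nat \<Rightarrow> involution \<Rightarrow> bool"
  where "crossing n w \<longleftrightarrow> (\<forall>x. ap w x \<noteq> x \<longrightarrow> (x < n \<longleftrightarrow> n \<le> ap w x))"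

lemma crossing_cj:
  assumes "inner n i" "crossing n w"
  shows "crossing n (cj i w)"
  unfolding crossing_def
proof (intro allI impI)
  fix x assume "ap (cj i w) x \<noteq> x"
  then have "ap w (sw i x) \<noteq> sw i x" by auto
  then show "x < n \<longleftrightarrow> n \<le> ap (cj i w) x"
    using assms(2)[unfolded crossing_def, rule_format, of "sw i x"]
    by (simp add: sw_inner[OF assms(1)] sw_inner'[OF assms(1)])
qed

lemma crossing_no_arc:
  assumes "inner n i" "crossing n w"
  shows "ap w i \<noteq> Suc i"
proof
  assume a: "ap w i = Suc i"
  then have "i < n \<longleftrightarrow> n \<le> Suc i" using assms(2) unfolding crossing_def by (metis n_not_Suc_n)
  with assms(1) show False by (auto simp: inner_def)
qed

lemma inner_less: "inner n i \<Longrightarrow> Suc i < n + n"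
  by (auto simp: inner_def)

lemma descent_not_fixed: "ap w (Suc i) < ap w i \<Longrightarrow> \<not> both_fixed i w"
  by (simp add: both_fixed_def)

lemma descent_cases:
  assumes "supported (n + n) w"
  obtains "w = stair (n - cross n w) (cross n w)"
  | i where "inner n i" "ap w (Suc i) < ap w i"
proof (cases "\<forall>i. inner n i \<longrightarrow> ap w i < ap w (Suc i)")
  case True
  then show ?thesis using that(1) no_descent_stair[OF assms] by blast
next
  case False
  then obtain i where "inner n i" "\<not> ap w i < ap w (Suc i)" by blast
  moreover have "ap w i \<noteq> ap w (Suc i)" by simp
  ultimately show ?thesis using that(2)[of i] by linarith
qed

context
  fixes a t :: "'k::field" and n :: nat
  assumes t: "t \<noteq> 0"
begin

text \<open>Conjugating inner descents away raises the moment and keeps the number of crossing arcs,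
  so the process ends at the stair with that number. Reachability is carried upwards along
  it.\<close>

lemma reachable_stair:
  assumes "supported (n + n) w" "crossing n w" "reachable a t n (\<lambda>f. f w)"
  shows "reachable a t n (\<lambda>f. f (stair (n - cross n w) (cross n w)))"
  using assms
proof (induction w rule: moment_induct)
  case (step w)
  from step.hyps show ?case
  proof (cases rule: descent_cases)
    case 1
    with step.prems show ?thesis by simp
  next
    case (2 i)
    have na: "ap w i \<noteq> Suc i" using crossing_no_arc[OF 2(1) step.prems(1)] .
    define v where "v = cj i w"
    have v: "cj i v = w" by (simp add: v_def)
    have "ap w (Suc i) \<noteq> i" using na ap_eq_Suc by blast
    then have nv: "\<not> both_fixed i v" "ap v i \<noteq> Suc i"
      using na descent_not_fixed[OF 2(2)] by (auto simp: v_def both_fixed_def sw_def split: if_splits)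
    have "reachable a t n (\<lambda>f. f (cj i v))" using step.prems v by simp
    from reach_cj[OF t 2(1) nv this] have "reachable a t n (\<lambda>f. f v)" .
    moreover have "supported (n + n) v" "moment (n + n) w < moment (n + n) v" "crossing n v" "cross n v = cross n w"
      using step.hyps step.prems 2 na inner_less[OF 2(1)]
      by (auto simp: v_def supported_cj moment_cj_less crossing_cj cross_cj)
    ultimately show ?thesis
      using step.IH[of v] by simp
  qed
qed

lemma reachable_omega_stair:
  assumes "r \<le> n"
  shows "reachable a t n (\<lambda>f. f (stair r (n - r)))"
proof -
  have ap: "ap (omega n r) x = (if x < r then x else if x < n then x + n else if x < n + r then x
      else if x < n + n then x - n else x)" for x
    using assms by (auto simp: omega_def ap_fx_power parallel.rep_eq)
  have "supported (n + n) (omega n r)" "crossing n (omega n r)"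
    using assms by (auto simp: supported_def crossing_def ap)
  moreover have "cross n (omega n r) = n - r"
  proof -
    have "{x. x < n \<and> n \<le> ap (omega n r) x} = {r..<n}"
      using assms by (auto simp: ap)
    then show ?thesis by (simp add: cross_def)
  qed
  ultimately show ?thesis
    using reachable_stair[of "omega n r"] reach_omega[OF t assms] assms by simp
qed

lemma cross_le: "cross n w \<le> n"
proof -
  have "cross n w \<le> card {..<n}"
    unfolding cross_def by (rule card_mono) auto
  then show ?thesis by simp
qed

text \<open>The same ascent, now also removing arcs between neighbours, leads from any
  \<open>w\<close> to a stair. The stairs are reachable through \<open>omega\<close>, and here
  reachability is carried back down.\<close>

theorem reachable_supported:
  assumes "supported (n + n) w"
  shows "reachable a t n (\<lambda>f. f w)"
  using assms
proof (induction w rule: moment_induct)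
  case (step w)
  from step.hyps show ?case
  proof (cases rule: descent_cases)
    case 1
    then show ?thesis
      using reachable_omega_stair[of "n - cross n w"] cross_le[of w] by simp
  next
    case (2 i)
    note m = inner_less[OF 2(1)]
    show ?thesis
    proof (cases "ap w i = Suc i")
      case True
      then show ?thesis
        using reach_toggle[OF t 2(1) True] step.IH[of "toggle i w"] step.hyps m
        by (simp add: supported_toggle moment_toggle_less)
    next
      case False
      then show ?thesis
        using reach_cj[OF t 2(1) descent_not_fixed[OF 2(2)] False] step.IH[of "cj i w"] step.hyps m 2(2)
        by (simp add: supported_cj moment_cj_less)
    qed
  qed
qed

end

lift_definition no_arcs :: involution is id by simp

section \<open>Counting involutions\<close>

fun involutions :: "nat \<Rightarrow> involution set" where
  "involutions 0 = {no_arcs}"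
| "involutions (Suc 0) = {no_arcs}"
| "involutions (Suc (Suc m)) = fx ` involutions (Suc m) \<union> (\<Union>j\<in>{..m}. arc j ` involutions m)"

lemma finite_involutions: "finite (involutions m)"
  by (induction m rule: involutions.induct) auto

lemma supported_fx:
  assumes "supported m w"
  shows "supported (Suc m) (fx w)"
  unfolding supported_def
proof (intro allI impI)
  fix x assume "Suc m \<le> x"
  then obtain y where "x = Suc y" "m \<le> y" by (cases x) auto
  then show "ap (fx w) x = x" using assms by (simp add: supported_def)
qed

lemma supported_arc:
  assumes "supported m w" "j \<le> m"
  shows "supported (Suc (Suc m)) (arc j w)"
  unfolding supported_def
proof (intro allI impI)
  fix x assume "Suc (Suc m) \<le> x"
  then obtain y where y: "x = Suc (Suc y)" "m \<le> y" by (metis Suc_le_D Suc_le_mono)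
  then have "skip j y = Suc y" using assms(2) by (simp add: skip_def)
  then show "ap (arc j w) x = x"
    using ap_arc(3)[of j w y] assms(1) y by (simp add: supported_def)
qed

lemma supported_involutions: "w \<in> involutions m \<Longrightarrow> supported m w"
proof (induction m arbitrary: w rule: involutions.induct)
  case (3 m)
  then show ?case by (auto intro: supported_fx supported_arc)
qed (simp_all add: supported_def no_arcs.rep_eq)

lemma card_involutions: "card (involutions m) = h_num m"
proof (induction m rule: involutions.induct)
  case (3 m)
  have card: "card (fx ` A) = card A" "card (arc j ` A) = card A" for A j
    by (rule card_image, metis inj_onI rest_fx) (rule card_image, metis inj_onI rest_arc)
  have "card (\<Union>j\<in>{..m}. arc j ` involutions m) = (\<Sum>j\<in>{..m}. card (arc j ` involutions m))"
  proof (rule card_UN_disjoint)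
    show "\<forall>i\<in>{..m}. \<forall>j\<in>{..m}. i \<noteq> j \<longrightarrow> arc i ` involutions m \<inter> arc j ` involutions m = {}"
      by (auto dest!: arg_cong[where f = "\<lambda>w. ap w 0"])
  qed (auto intro: finite_involutions)
  also have "\<dots> = Suc m * h_num m"
    using 3 by (simp add: card)
  finally have "card (\<Union>j\<in>{..m}. arc j ` involutions m) = Suc m * h_num m" .
  moreover have "fx ` involutions (Suc m) \<inter> (\<Union>j\<in>{..m}. arc j ` involutions m) = {}"
    by (auto dest!: arg_cong[where f = "\<lambda>w. ap w 0"])
  moreover have "card (fx ` involutions (Suc m)) = h_num (Suc m)"
    using 3 by (simp add: card)
  ultimately show ?case
    by (simp add: card_Un_disjoint finite_involutions)
qed simp_all

lemma h_num_Suc: "h_num (Suc m) = h_num m + m * h_num (m - 1)"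
  by (cases m) simp_all

text \<open>Involutions of two rows of lengths \<open>m\<close> and \<open>n\<close>, sorted by the number of arcs between the rows.\<close>

definition h_conv :: "nat \<Rightarrow> nat \<Rightarrow> nat"
  where "h_conv m n = (\<Sum>k\<le>n. fact k * (m choose k) * (n choose k) * h_num (m - k) * h_num (n - k))"

text \<open>The new point of the first row is fixed, joined to one of \<open>m\<close> points of its
  row, or joined to one of \<open>n\<close> points of the other row. Algebraically, Pascal's rule
  splits off the last case, and \<open>h_num_Suc\<close> separates the first two.\<close>

lemma h_conv_Suc: "h_conv (Suc m) n = h_conv m n + m * h_conv (m - 1) n + n * h_conv m (n - 1)"
proof -
  let ?c = "\<lambda>m n k. fact k * (m choose k) * (n choose k) * h_num (m - k) * h_num (n - k)"
  have 1: "fact k * (m choose k) * (n choose k) * h_num (Suc m - k) * h_num (n - k)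
      = ?c m n k + m * ?c (m - 1) n k" for k
  proof (cases "k \<le> m")
    case True
    have "(m - k) * (m choose k) = m * ((m - 1) choose k)"
      by (cases m) (simp_all add: binomial_absorb_comp)
    moreover have "h_num (Suc m - k) = h_num (m - k) + (m - k) * h_num (m - 1 - k)"
      using True h_num_Suc[of "m - k"] by (simp add: Suc_diff_le diff_right_commute)
    moreover have "F * M * N * (A + d * B) * H = F * M * N * A * H + F * N * H * B * (d * M)"
      for F M N A d B H :: nat by (simp add: algebra_simps)
    ultimately have "fact k * (m choose k) * (n choose k) * h_num (Suc m - k) * h_num (n - k)
      = ?c m n k + fact k * (n choose k) * h_num (n - k) * h_num (m - 1 - k) * (m * ((m - 1) choose k))"
      by simp
    then show ?thesis by simp
  qed (simp add: binomial_eq_0)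
  \<comment> \<open>The part of Pascal's rule in which the new point takes part in one of the
    \<open>k\<close> arcs between the rows; absorbing \<open>k\<close> into the second binomial
    leaves \<open>n\<close> and \<open>k - 1\<close> arcs.\<close>
  have 2: "(if k = 0 then 0 else fact k * (m choose (k - 1)) * (n choose k) * h_num (Suc m - k) * h_num (n - k))
      = (if k = 0 then 0 else n * ?c m (n - 1) (k - 1))" for k
  proof (cases k)
    case (Suc j)
    have "Suc j * (n choose Suc j) = n * ((n - 1) choose j)"
      by (cases n) (simp, metis Suc_times_binomial_eq mult.commute diff_Suc_1)
    moreover have "fact (Suc j) * (m choose j) * (n choose Suc j)
        = fact j * (m choose j) * (Suc j * (n choose Suc j))"
      by (simp add: algebra_simps)
    ultimately have "fact (Suc j) * (m choose j) * (n choose Suc j)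
        = fact j * (m choose j) * (n * ((n - 1) choose j))"
      by simp
    then have "fact (Suc j) * (m choose j) * (n choose Suc j) * h_num (m - j) * h_num (n - Suc j)
        = n * (fact j * (m choose j) * ((n - 1) choose j) * h_num (m - j) * h_num (n - 1 - j))"
      by (simp only: diff_Suc_eq_diff_pred) (simp add: mult.assoc mult.left_commute)
    then show ?thesis by (simp only: Suc diff_Suc_1 diff_Suc_Suc nat.distinct if_False)
  qed simp
  have "h_conv (Suc m) n = (\<Sum>k\<le>n. fact k * (m choose k) * (n choose k) * h_num (Suc m - k) * h_num (n - k)
     + (if k = 0 then 0 else fact k * (m choose (k - 1)) * (n choose k) * h_num (Suc m - k) * h_num (n - k)))"
    unfolding h_conv_def
  proof (rule sum.cong)
    fix k assume "k \<in> {..n}"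
    show "fact k * (Suc m choose k) * (n choose k) * h_num (Suc m - k) * h_num (n - k) =
      fact k * (m choose k) * (n choose k) * h_num (Suc m - k) * h_num (n - k) +
      (if k = 0 then 0 else fact k * (m choose (k - 1)) * (n choose k) * h_num (Suc m - k) * h_num (n - k))"
      by (cases k) (simp_all only: binomial_Suc_Suc distrib_left distrib_right binomial_n_0
        diff_Suc_1 nat.distinct if_False if_True refl add_0_right add.commute)
  qed simp
  also have "\<dots> = (\<Sum>k\<le>n. ?c m n k) + m * (\<Sum>k\<le>n. ?c (m - 1) n k)
     + (\<Sum>k\<le>n. if k = 0 then 0 else n * ?c m (n - 1) (k - 1))"
    unfolding 1 2 by (simp add: sum.distrib sum_distrib_left)
  also have "(\<Sum>k\<le>n. if k = 0 then 0 else n * ?c m (n - 1) (k - 1)) = n * h_conv m (n - 1)"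
  proof (cases n)
    case (Suc n')
    show ?thesis
      unfolding Suc by (subst sum.atMost_Suc_shift) (simp add: h_conv_def sum_distrib_left)
  qed simp
  finally show ?thesis
    unfolding h_conv_def .
qed

lemma h_conv_eq: "h_conv m n = h_num (m + n)"
proof (induction "m + n" arbitrary: m n rule: less_induct)
  case less
  have sym0: "h_conv 0 n = h_num n" for n
  proof -
    have "h_conv 0 n = (\<Sum>k\<le>n. if k = 0 then h_num n else 0)"
      unfolding h_conv_def by (rule sum.cong) (auto simp: binomial_eq_0)
    then show ?thesis by simp
  qed
  show ?case
  proof (cases m)
    case (Suc m')
    have a: "h_conv m' n = h_num (m' + n)" using less[of m' n] Suc by simp
    have b: "m' * h_conv (m' - 1) n = m' * h_num (m' + n - 1)"
      using less[of "m' - 1" n] Suc by (cases m') auto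
    have c: "n * h_conv m' (n - 1) = n * h_num (m' + n - 1)"
      using less[of m' "n - 1"] Suc by (cases n) auto
    show ?thesis
      unfolding Suc h_conv_Suc add_Suc h_num_Suc[of "m' + n"] a b c
      by (simp only: add_mult_distrib add.assoc)
  qed (simp add: sym0)
qed

text \<open>There are \<open>k = n - r\<close> arcs between the rows: choose their ends in each row
  and match them. This uses k! (n choose r) = n!/r!.\<close>

lemma h_num_double:
  "h_num (n + n) = (\<Sum>r = 0..n. (h_num r)\<^sup>2 * (fact n div fact r) * (n choose r))"
proof -
  have "h_num (n + n) = (\<Sum>k\<le>n. fact k * (n choose k) * (n choose k) * h_num (n - k) * h_num (n - k))"
    by (simp flip: h_conv_eq add: h_conv_def)
  also have "\<dots> = (\<Sum>r\<le>n. fact (n - r) * (n choose r) * (n choose r) * h_num r * h_num r)"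
    by (rule sum.reindex_bij_witness[of _ "\<lambda>r. n - r" "\<lambda>r. n - r"]) (auto simp flip: binomial_symmetric)
  also have "\<dots> = (\<Sum>r = 0..n. (h_num r)\<^sup>2 * (fact n div fact r) * (n choose r))"
  proof (rule sum.cong)
    fix r assume "r \<in> {0..n}"
    then have "fact r * (fact (n - r) * (n choose r)) = (fact n :: nat)"
      using binomial_fact_lemma[of r n] by (simp add: mult.assoc)
    then have "fact n div fact r = (fact (n - r) * (n choose r) :: nat)"
      by (metis fact_nonzero nonzero_mult_div_cancel_left)
    then show "fact (n - r) * (n choose r) * (n choose r) * h_num r * h_num r
        = (h_num r)\<^sup>2 * (fact n div fact r) * (n choose r)"
      by (simp add: power2_eq_square)
  qed auto
  finally show ?thesis .
qed

section \<open>Reduced words and cosets\<close>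

abbreviation transp :: "nat \<Rightarrow> nat \<Rightarrow> nat"
  where "transp i \<equiv> Transposition.transpose i (Suc i)"

definition perm_of :: "nat list \<Rightarrow> nat \<Rightarrow> nat"
  where "perm_of is = foldr (\<lambda>i f. transp i \<circ> f) is id"

lemma perm_of_simps [simp]: "perm_of [] = id" "perm_of (i # is) = transp i \<circ> perm_of is"
  by (simp_all add: perm_of_def)

lemma perm_of_append: "perm_of (xs @ ys) = perm_of xs \<circ> perm_of ys"
  by (induction xs) auto

lemma is_expression_iff: "is_expression n is w \<longleftrightarrow> set is \<subseteq> {1..<n} \<and> perm_of is = w"
  by (simp add: is_expression_def perm_of_def)

lemma transp_permutes: "lo \<le> i \<Longrightarrow> i < hi \<Longrightarrow> transp i permutes {lo..hi}"
  by (rule permutes_swap_id) auto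

lemma perm_of_permutes: "set is \<subseteq> {lo..<hi} \<Longrightarrow> perm_of is permutes {lo..hi}"
  by (induction "is") (auto intro!: permutes_compose[OF _ transp_permutes] permutes_id)

lemma transp_transp [simp]: "transp i \<circ> transp i = id" "transp i (transp i x) = x"
  by (simp_all add: fun_eq_iff)

lemma perm_of_snoc: "perm_of (is @ [i]) = perm_of is \<circ> transp i"
  by (simp add: perm_of_append)

lemma perm_of_rev_apply: "perm_of (rev is) (perm_of is x) = x"
  by (induction "is" arbitrary: x) (simp_all add: perm_of_append)

lemma perm_of_rev: "perm_of (rev is) \<circ> perm_of is = id"
  by (simp add: fun_eq_iff perm_of_rev_apply)

lemma perm_of_eq_iff [simp]: "perm_of is x = perm_of is y \<longleftrightarrow> x = y"
  by (metis perm_of_rev_apply)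

section \<open>Inversions and reduced words\<close>

definition inversions :: "nat \<Rightarrow> (nat \<Rightarrow> nat) \<Rightarrow> (nat \<times> nat) set"
  where "inversions n w = {(x, y). x < y \<and> y \<le> n \<and> w y < w x}"

lemma finite_inversions [simp]: "finite (inversions n w)"
  by (rule finite_subset[of _ "{..n} \<times> {..n}"]) (auto simp: inversions_def)

definition inv_num :: "nat \<Rightarrow> (nat \<Rightarrow> nat) \<Rightarrow> nat"
  where "inv_num n w = card (inversions n w)"

lemma transp_less: "x < y \<Longrightarrow> (x, y) \<noteq> (i, Suc i) \<Longrightarrow> transp i x < transp i y"
  by (auto simp: Transposition.transpose_def)

text \<open>Applying \<open>transp i\<close> to both entries maps the inversions of \<open>w\<close>
  bijectively to those of \<open>w \<circ> transp i\<close> other than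
  \<open>(i, Suc i)\<close>.\<close>

lemma inv_num_up:
  assumes i: "i < n" and up: "w i < w (Suc i)"
  shows "inv_num n (w \<circ> transp i) = Suc (inv_num n w)"
proof -
  let ?t = "\<lambda>(x, y). (transp i x, transp i y)"
  have le: "transp i x \<le> n \<longleftrightarrow> x \<le> n" for x
    using i by (auto simp: Transposition.transpose_def)
  have "inversions n (w \<circ> transp i) = insert (i, Suc i) (?t ` inversions n w)"
  proof (intro Set.set_eqI iffI)
    fix z assume z: "z \<in> inversions n (w \<circ> transp i)"
    obtain x y where xy: "z = (x, y)" by (cases z)
    show "z \<in> insert (i, Suc i) (?t ` inversions n w)"
    proof (cases "z = (i, Suc i)")
      case False
      with z xy have "(transp i x, transp i y) \<in> inversions n w"
        using transp_less[of x y i] le[of y] by (auto simp: inversions_def)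
      then have "?t (transp i x, transp i y) \<in> ?t ` inversions n w" by (rule imageI)
      then show ?thesis by (simp add: xy)
    qed simp
  next
    fix z assume z: "z \<in> insert (i, Suc i) (?t ` inversions n w)"
    show "z \<in> inversions n (w \<circ> transp i)"
    proof (cases "z = (i, Suc i)")
      case True
      then show ?thesis using i up by (simp add: inversions_def)
    next
      case False
      with z obtain x y where xy: "z = (transp i x, transp i y)" "(x, y) \<in> inversions n w" by auto
      then have "(x, y) \<noteq> (i, Suc i)" using up by (auto simp: inversions_def)
      then show ?thesis
        using xy transp_less[of x y i] le[of y] by (auto simp: inversions_def)
    qed
  qed
  moreover have "(i, Suc i) \<notin> ?t ` inversions n w"
  proof
    assume "(i, Suc i) \<in> ?t ` inversions n w"
    then obtain x y where "(x, y) \<in> inversions n w" "transp i x = i" "transp i y = Suc i" by auto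
    moreover from this have "x = Suc i" "y = i"
      by (metis Transposition.transpose_apply_first transp_transp(2), metis Transposition.transpose_apply_second transp_transp(2))
    ultimately show False by (simp add: inversions_def)
  qed
  moreover have "inj_on ?t (inversions n w)"
    by (rule inj_onI) (auto, (metis transp_transp(2))+)
  ultimately show ?thesis
    by (simp add: inv_num_def card_image)
qed

lemma inv_num_down:
  assumes "i < n" "w (Suc i) < w i"
  shows "inv_num n w = Suc (inv_num n (w \<circ> transp i))"
  using inv_num_up[of i n "w \<circ> transp i"] assms by (simp add: o_assoc[symmetric])

lemma inv_num_snoc:
  "i < n \<Longrightarrow> perm_of is i < perm_of is (Suc i)
    \<Longrightarrow> inv_num n (perm_of (is @ [i])) = Suc (inv_num n (perm_of is))"
  "i < n \<Longrightarrow> perm_of is (Suc i) < perm_of is i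
    \<Longrightarrow> inv_num n (perm_of is) = Suc (inv_num n (perm_of (is @ [i])))"
  unfolding perm_of_snoc by (rule inv_num_up inv_num_down, assumption+)+

lemma inv_num_id [simp]: "inv_num n id = 0"
proof -
  have "inversions n id = {}" by (auto simp: inversions_def)
  then show ?thesis by (simp add: inv_num_def)
qed

lemma inv_num_le_length: "set is \<subseteq> {..<n} \<Longrightarrow> inv_num n (perm_of is) \<le> length is"
proof (induction "is" rule: rev_induct)
  case (snoc i "is")
  let ?w = "perm_of is"
  have "?w i \<noteq> ?w (Suc i)" by simp
  then consider "?w i < ?w (Suc i)" | "?w (Suc i) < ?w i" by linarith
  then show ?case
    using snoc inv_num_snoc[of i n "is"] by cases (auto simp del: perm_of_simps)
qed simp

text \<open>Reduced words, characterised by the fact that every letter creates a new inversion.\<close>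

inductive asc :: "nat list \<Rightarrow> bool" where
  Nil: "asc []"
| snoc: "asc is \<Longrightarrow> perm_of is i < perm_of is (Suc i) \<Longrightarrow> asc (is @ [i])"

lemma asc_snoc_iff: "asc (is @ [i]) \<longleftrightarrow> asc is \<and> perm_of is i < perm_of is (Suc i)"
proof
  assume "asc (is @ [i])"
  then show "asc is \<and> perm_of is i < perm_of is (Suc i)"
    by (cases rule: asc.cases) simp_all
qed (simp add: asc.snoc)

lemma asc_length: "asc is \<Longrightarrow> set is \<subseteq> {..<n} \<Longrightarrow> length is = inv_num n (perm_of is)"
proof (induction rule: asc.induct)
  case (snoc "is" i)
  then show ?case
    using inv_num_snoc(1)[of i n "is"] by simp
qed simp

lemma asc_if_length: "set is \<subseteq> {..<n} \<Longrightarrow> length is = inv_num n (perm_of is) \<Longrightarrow> asc is"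
proof (induction "is" rule: rev_induct)
  case (snoc i "is")
  have s: "set is \<subseteq> {..<n}" "i < n" using snoc.prems by auto
  note le = inv_num_le_length[OF s(1)]
  have len: "Suc (length is) = inv_num n (perm_of (is @ [i]))"
    using snoc.prems(2) by simp
  have up: "perm_of is i < perm_of is (Suc i)"
  proof (rule ccontr)
    assume "\<not> ?thesis"
    moreover have "perm_of is i \<noteq> perm_of is (Suc i)" by simp
    ultimately have "perm_of is (Suc i) < perm_of is i" by linarith
    with len le inv_num_snoc(2)[OF s(2)] show False by simp
  qed
  then have "length is = inv_num n (perm_of is)"
    using len inv_num_snoc(1)[OF s(2)] by simp
  then show ?case
    using snoc.IH s up by (simp add: asc_snoc_iff)
qed (simp add: asc.Nil)

lemma increasing_permutation:
  assumes w: "w permutes {lo..hi::nat}" and up: "\<And>x y. lo \<le> x \<Longrightarrow> x < y \<Longrightarrow> y \<le> hi \<Longrightarrow> w x < w y"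
  shows "w = id"
proof -
  have ge: "x \<le> v x" if v: "v permutes {lo..hi}" "\<And>x y. lo \<le> x \<Longrightarrow> x < y \<Longrightarrow> y \<le> hi \<Longrightarrow> v x < v y"
    and x: "x \<in> {lo..hi}" for v x
  proof -
    have "lo + d \<le> hi \<Longrightarrow> lo + d \<le> v (lo + d)" for d
    proof (induction d)
      case 0
      then show ?case using permutes_in_image[OF v(1), of lo] by simp
    next
      case (Suc d)
      then show ?case using v(2)[of "lo + d" "lo + Suc d"] by simp
    qed
    from this[of "x - lo"] x show ?thesis by simp
  qed
  let ?v = "inv_into UNIV w"
  have v: "?v permutes {lo..hi}" using w by (rule permutes_inv)
  have "?v x < ?v y" if "lo \<le> x" "x < y" "y \<le> hi" for x y
  proof (rule ccontr)
    assume "\<not> ?thesis"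
    moreover have "?v x \<noteq> ?v y" using that permutes_inj[OF v] by (simp add: inj_eq)
    moreover have "?v x \<in> {lo..hi}" "?v y \<in> {lo..hi}"
      using that permutes_in_image[OF v] by simp_all
    ultimately have "w (?v y) < w (?v x)" by (intro up) auto
    then show False using that permutes_inverses(1)[OF w] by simp
  qed
  then have ge': "x \<le> ?v x" if "x \<in> {lo..hi}" for x
    using ge[OF v _ that] by blast
  have ge: "x \<le> w x" if "x \<in> {lo..hi}" for x
    using ge[OF w _ that] up by blast
  show ?thesis
  proof
    fix x
    show "w x = id x"
    proof (cases "x \<in> {lo..hi}")
      case True
      then have "w x \<in> {lo..hi}" using permutes_in_image[OF w] by blast
      then have "w x \<le> x" using ge'[of "w x"] permutes_inverses(2)[OF w] by simp
      with ge[OF True] show ?thesis by simp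
    qed (use w in \<open>simp add: permutes_not_in\<close>)
  qed
qed

lemma increasing_interval:
  fixes f :: "nat \<Rightarrow> nat"
  assumes "\<And>i. lo \<le> i \<Longrightarrow> i < hi \<Longrightarrow> f i < f (Suc i)"
  shows "lo \<le> x \<Longrightarrow> x < y \<Longrightarrow> y \<le> hi \<Longrightarrow> f x < f y"
proof (induction y)
  case (Suc y)
  then show ?case
    using assms[of y] by (cases "x = y") (auto intro: less_trans)
qed simp

lemma asc_word_exists:
  "w permutes {lo..hi} \<Longrightarrow> \<exists>is. asc is \<and> set is \<subseteq> {lo..<hi} \<and> perm_of is = w"
proof (induction "inv_num hi w" arbitrary: w rule: less_induct)
  case less
  show ?case
  proof (cases "\<exists>i. lo \<le> i \<and> i < hi \<and> w (Suc i) < w i")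
    case True
    then obtain i where i: "lo \<le> i" "i < hi" "w (Suc i) < w i" by blast
    let ?v = "w \<circ> transp i"
    have "?v permutes {lo..hi}"
      using less.prems transp_permutes[OF i(1,2)] by (intro permutes_compose)
    moreover have "inv_num hi ?v < inv_num hi w"
      using inv_num_down[of i hi w] i by simp
    ultimately obtain "is" where "is": "asc is" "set is \<subseteq> {lo..<hi}" "perm_of is = ?v"
      using less.hyps by blast
    then have "asc (is @ [i])" "perm_of (is @ [i]) = w" "set (is @ [i]) \<subseteq> {lo..<hi}"
      using i by (auto simp: asc_snoc_iff perm_of_snoc o_assoc[symmetric])
    then show ?thesis by blast
  next
    case False
    have "w i < w (Suc i)" if "lo \<le> i" "i < hi" for i
    proof -
      have "w i \<noteq> w (Suc i)" using permutes_inj[OF less.prems] by (simp add: inj_eq)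
      with that False show ?thesis by (meson linorder_neqE_nat)
    qed
    then have "w = id"
      using increasing_interval[of lo hi w] by (intro increasing_permutation[OF less.prems]) blast
    then show ?thesis
      using asc.Nil by (intro exI[of _ "[]"]) simp
  qed
qed

lemma coxeter_length_eq:
  assumes "w permutes {1..n}"
  shows "coxeter_length n w = inv_num n w"
proof -
  obtain "is" where "is": "asc is" "set is \<subseteq> {1..<n}" "perm_of is = w"
    using asc_word_exists[OF assms] by blast
  moreover from "is"(2) have "set is \<subseteq> {..<n}" by auto
  ultimately have "length is = inv_num n w"
    using asc_length[of "is" n] by blast
  show ?thesis
    unfolding coxeter_length_def
  proof (rule Least_equality)
    show "\<exists>is. is_expression n is w \<and> length is = inv_num n w"
      using "is" \<open>length is = inv_num n w\<close> by (auto simp: is_expression_iff)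
    fix k assume "\<exists>is. is_expression n is w \<and> length is = k"
    then obtain js where "set js \<subseteq> {1..<n}" "perm_of js = w" "length js = k"
      by (auto simp: is_expression_iff)
    moreover from this have "set js \<subseteq> {..<n}" by auto
    ultimately show "inv_num n w \<le> k"
      using inv_num_le_length[of js n] by blast
  qed
qed

lemma is_reduced_expression_iff:
  "is_reduced_expression n is w \<longleftrightarrow> set is \<subseteq> {1..<n} \<and> perm_of is = w \<and> asc is"
proof (cases "set is \<subseteq> {1..<n} \<and> perm_of is = w")
  case True
  then have w: "w permutes {1..n}" and s: "set is \<subseteq> {..<n}" using perm_of_permutes by auto
  show ?thesis
    using True asc_length[OF _ s] asc_if_length[OF s]
    by (auto simp: is_reduced_expression_def is_expression_iff coxeter_length_eq[OF w])
qed (auto simp: is_reduced_expression_def is_expression_iff)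

text \<open>Let \<open>js\<close> be a reduced word of the inverse. Its reversal is a word for
  \<open>perm_of is\<close>, so \<open>js\<close> is no shorter than \<open>is\<close>; hence
  \<open>rev is\<close> has minimal length among the words of the inverse.\<close>

lemma asc_rev:
  assumes "asc is"
  shows "asc (rev is)"
proof -
  obtain n where n: "set is \<subseteq> {..<n}"
    by (meson finite_set finite_nat_bounded)
  have "set is \<subseteq> {0..<n}" using n by auto
  then have "perm_of (rev is) permutes {0..n}"
    by (intro perm_of_permutes) simp
  then obtain "js" where js: "asc js" "set js \<subseteq> {0..<n}" "perm_of js = perm_of (rev is)"
    using asc_word_exists by blast
  have "perm_of (rev js) = perm_of is"
  proof -
    have "perm_of (rev js) = perm_of (rev js) \<circ> (perm_of (rev is) \<circ> perm_of is)"
      by (simp add: perm_of_rev)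
    also have "\<dots> = (perm_of (rev js) \<circ> perm_of js) \<circ> perm_of is"
      by (simp add: js o_assoc)
    finally show ?thesis by (simp add: perm_of_rev)
  qed
  moreover have js': "set js \<subseteq> {..<n}" using js(2) by auto
  ultimately have "inv_num n (perm_of is) \<le> length js"
    using inv_num_le_length[of "rev js" n] by simp
  then have "length is \<le> inv_num n (perm_of (rev is))"
    using asc_length[OF assms n] asc_length[OF js(1) js'] js(3) by simp
  then show ?thesis
    using inv_num_le_length[of "rev is" n] n by (intro asc_if_length[of _ n]) simp_all
qed

text \<open>Additivity of lengths over a parabolic subgroup: \<open>c\<close> is increasing on the
  interval permuted by \<open>b\<close>, so each ascent along \<open>b\<close> remains one after
  applying \<open>c\<close>.\<close>

lemma asc_append:
  assumes "asc c" "\<And>x y. lo \<le> x \<Longrightarrow> x < y \<Longrightarrow> y \<le> hi \<Longrightarrow> perm_of c x < perm_of c y"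
  shows "asc b \<Longrightarrow> set b \<subseteq> {lo..<hi} \<Longrightarrow> asc (c @ b)"
proof (induction rule: asc.induct)
  case (snoc b i)
  have "perm_of b permutes {lo..hi}"
    using snoc.prems by (intro perm_of_permutes) auto
  then have "perm_of b i \<in> {lo..hi}" "perm_of b (Suc i) \<in> {lo..hi}"
    using snoc.prems permutes_in_image[OF \<open>perm_of b permutes {lo..hi}\<close>] by auto
  then have "perm_of c (perm_of b i) < perm_of c (perm_of b (Suc i))"
    using snoc.hyps by (intro assms(2)) auto
  moreover have "asc (c @ b)" using snoc by simp
  ultimately have "asc ((c @ b) @ [i])"
    unfolding asc_snoc_iff by (simp add: perm_of_append)
  then show ?case by (simp only: append_assoc)
qed (use assms in simp)

text \<open>\<open>us\<close> is a reduced word of the shortest element in the coset of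
  \<open>w\<close> modulo the subgroup generated by s_i and s_j. With two descents, \<open>w\<close>
  is this element times the longest element of that subgroup, whose two reduced words differ by a
  single commutation or braid move.\<close>

lemma descent_words:
  assumes w: "w permutes {1..n}" and ij: "i \<in> {1..<n}" "j \<in> {1..<n}" "i < j"
    and d: "w (Suc i) < w i" "w (Suc j) < w j"
  obtains us where "asc us" "set us \<subseteq> {1..<n}" "Suc i < j" "asc (us @ [j])" "asc (us @ [i])"
      "perm_of (us @ [j]) = w \<circ> transp i" "perm_of (us @ [i]) = w \<circ> transp j"
  | us where "asc us" "set us \<subseteq> {1..<n}" "j = Suc i" "asc (us @ [i, j])" "asc (us @ [j, i])"
      "perm_of (us @ [i, j]) = w \<circ> transp i" "perm_of (us @ [j, i]) = w \<circ> transp j"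
proof (cases "Suc i < j")
  case True
  have c: "transp i \<circ> transp j = transp j \<circ> transp i"
    using True by (auto simp: fun_eq_iff Transposition.transpose_def)
  have "w \<circ> transp i \<circ> transp j permutes {1..n}"
    using ij by (intro permutes_compose[OF transp_permutes] permutes_compose[OF transp_permutes w]) auto
  then obtain us where us: "asc us" "set us \<subseteq> {1..<n}" "perm_of us = w \<circ> transp i \<circ> transp j"
    using asc_word_exists by blast
  have "perm_of us j < perm_of us (Suc j)" "perm_of us i < perm_of us (Suc i)"
    using True d by (simp_all add: us(3) Transposition.transpose_def)
  then have "asc (us @ [j])" "asc (us @ [i])"
    using us(1) by (simp_all add: asc_snoc_iff)
  moreover have "perm_of (us @ [j]) = w \<circ> transp i"
    unfolding perm_of_snoc us(3) by (simp only: o_assoc[symmetric] transp_transp(1) comp_id)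
  moreover have "perm_of us = w \<circ> transp j \<circ> transp i"
    unfolding us(3) by (simp only: c o_assoc[symmetric])
  then have "perm_of (us @ [i]) = w \<circ> transp j"
    unfolding perm_of_snoc by (simp only: o_assoc[symmetric] transp_transp(1) comp_id)
  ultimately show ?thesis
    using that(1) us True by blast
next
  case False
  then have j: "j = Suc i" using ij by simp
  have b: "transp i \<circ> transp j \<circ> transp i = transp j \<circ> transp i \<circ> transp j"
    by (auto simp: fun_eq_iff Transposition.transpose_def j)
  have "w \<circ> transp i \<circ> transp j \<circ> transp i permutes {1..n}"
    using ij by (intro permutes_compose[OF transp_permutes] permutes_compose[OF transp_permutes w]) auto
  then obtain us where us: "asc us" "set us \<subseteq> {1..<n}" "perm_of us = w \<circ> transp i \<circ> transp j \<circ> transp i"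
    using asc_word_exists by blast
  have us': "perm_of us = w \<circ> transp j \<circ> transp i \<circ> transp j"
    unfolding us(3) using b by (simp only: o_assoc[symmetric])
  have 1: "perm_of (us @ [i]) = w \<circ> transp i \<circ> transp j"
    unfolding perm_of_snoc us(3) by (simp only: o_assoc[symmetric] transp_transp(1) comp_id)
  have 2: "perm_of (us @ [j]) = w \<circ> transp j \<circ> transp i"
    unfolding perm_of_snoc us' by (simp only: o_assoc[symmetric] transp_transp(1) comp_id)
  have v: "perm_of us i = w (Suc (Suc i))" "perm_of us (Suc i) = w (Suc i)" "perm_of us (Suc (Suc i)) = w i"
    by (simp_all add: us(3) Transposition.transpose_def j)
  then have "asc (us @ [i])" "asc (us @ [j])"
    using us(1) d by (simp_all add: asc_snoc_iff j)
  moreover have "perm_of (us @ [i]) j < perm_of (us @ [i]) (Suc j)" "perm_of (us @ [j]) i < perm_of (us @ [j]) (Suc i)"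
    unfolding 1 2 using d by (simp_all add: Transposition.transpose_def j)
  ultimately have "asc ((us @ [i]) @ [j])" "asc ((us @ [j]) @ [i])"
    unfolding asc_snoc_iff by blast+
  moreover have "perm_of ((us @ [i]) @ [j]) = w \<circ> transp i" "perm_of ((us @ [j]) @ [i]) = w \<circ> transp j"
    unfolding perm_of_snoc[of "us @ [i]"] perm_of_snoc[of "us @ [j]"] 1 2
    by (simp_all only: o_assoc[symmetric] transp_transp(1) comp_id)
  ultimately show ?thesis
    using that(2)[of us] us j by simp
qed

lemma perm_of_snoc_cancel: "perm_of (is @ [i]) = perm_of (js @ [i]) \<Longrightarrow> perm_of is = perm_of js"
proof -
  assume "perm_of (is @ [i]) = perm_of (js @ [i])"
  then have "perm_of (is @ [i]) \<circ> transp i = perm_of (js @ [i]) \<circ> transp i" by simp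
  then show ?thesis
    unfolding perm_of_snoc by (simp only: o_assoc[symmetric] transp_transp(1) comp_id)
qed

text \<open>The suffix \<open>ks\<close> is there for the induction: \<open>F\<close> is an
  arbitrary function of words, so the last letter of a word cannot be split off as a factor and is
  moved into the suffix instead.\<close>

theorem matsumoto:
  fixes F :: "nat list \<Rightarrow> 'a"
  assumes comm: "\<And>xs ys i j. set xs \<subseteq> {1..<n} \<Longrightarrow> set ys \<subseteq> {1..<n} \<Longrightarrow> i \<in> {1..<n} \<Longrightarrow> j \<in> {1..<n} \<Longrightarrow>
      Suc i < j \<Longrightarrow> F (xs @ i # j # ys) = F (xs @ j # i # ys)"
    and braid: "\<And>xs ys i. set xs \<subseteq> {1..<n} \<Longrightarrow> set ys \<subseteq> {1..<n} \<Longrightarrow> i \<in> {1..<n} \<Longrightarrow> Suc i \<in> {1..<n} \<Longrightarrow>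
      F (xs @ i # Suc i # i # ys) = F (xs @ Suc i # i # Suc i # ys)"
  shows "asc is \<Longrightarrow> asc js \<Longrightarrow> set is \<subseteq> {1..<n} \<Longrightarrow> set js \<subseteq> {1..<n} \<Longrightarrow> perm_of is = perm_of js \<Longrightarrow>
    set ks \<subseteq> {1..<n} \<Longrightarrow> F (is @ ks) = F (js @ ks)"
proof (induction "length is" arbitrary: "is" js ks)
  case 0
  then have "is = []" by simp
  have "inv_num n (perm_of js) = inv_num n (perm_of is)"
    by (simp only: 0(6))
  also have "\<dots> = 0"
    by (simp only: \<open>is = []\<close> perm_of_simps(1) inv_num_id)
  finally have "inv_num n (perm_of js) = 0" .
  moreover from 0 have "set js \<subseteq> {..<n}" by auto
  ultimately have "js = []"
    using asc_length[of js n] 0(3) by simp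
  then show ?case by (simp only: \<open>is = []\<close>)
next
  case (Suc m)
  have sub: "set is \<subseteq> {..<n}" "set js \<subseteq> {..<n}" using Suc.prems by auto
  have len: "length js = Suc m"
    using asc_length[OF Suc.prems(1) sub(1)] asc_length[OF Suc.prems(2) sub(2)] Suc by simp
  obtain i is' where is': "is = is' @ [i]" using Suc.hyps(2) by (cases "is" rule: rev_cases) auto
  obtain j js' where js': "js = js' @ [j]" using len by (cases js rule: rev_cases) auto
  have asc': "asc is'" "asc js'" and d: "perm_of is' i < perm_of is' (Suc i)" "perm_of js' j < perm_of js' (Suc j)"
    using Suc.prems(1,2) unfolding is' js' asc_snoc_iff by auto
  have m: "m = length is'" "m = length js'" using Suc.hyps(2) len by (simp_all add: is' js')
  have X: "set is' \<subseteq> {1..<n}" "i \<in> {1..<n}" "set js' \<subseteq> {1..<n}" "j \<in> {1..<n}" "set ks \<subseteq> {1..<n}"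
    using Suc.prems unfolding is' js' by auto
  let ?w = "perm_of is"
  have w: "?w permutes {1..n}" using Suc.prems by (intro perm_of_permutes) auto
  have "perm_of (is' @ [i]) (Suc i) < perm_of (is' @ [i]) i" "perm_of (js' @ [j]) (Suc j) < perm_of (js' @ [j]) j"
    unfolding perm_of_snoc using d by simp_all
  then have wd: "?w (Suc i) < ?w i" "?w (Suc j) < ?w j"
    unfolding is'[symmetric] js'[symmetric] Suc.prems(5) by simp_all
  \<comment> \<open>\<open>A\<close> and \<open>B\<close> are other reduced words of the two
    prefixes, chosen such that one move leads from \<open>A @ [i]\<close> to \<open>B @ [j]\<close>;
    the induction hypothesis handles the exchange of the prefixes.\<close>
  have key: "F (is' @ i # ks) = F (js' @ j # ks)"
    if A: "asc A" "set A \<subseteq> {1..<n}" "perm_of A = ?w \<circ> transp i"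
      and B: "asc B" "set B \<subseteq> {1..<n}" "perm_of B = ?w \<circ> transp j"
      and AB: "F (A @ i # ks) = F (B @ j # ks)" for A B
  proof -
    have "perm_of is' = perm_of A"
      unfolding A is' perm_of_snoc by (simp only: o_assoc[symmetric] transp_transp(1) comp_id)
    moreover have "perm_of js' = perm_of B"
      unfolding B Suc.prems(5) unfolding js' perm_of_snoc
      by (simp only: o_assoc[symmetric] transp_transp(1) comp_id)
    ultimately have "F (is' @ i # ks) = F (A @ i # ks)" "F (js' @ j # ks) = F (B @ j # ks)"
      using Suc.hyps(1)[OF m(1), of A "i # ks"] Suc.hyps(1)[OF m(2), of B "j # ks"] asc' A B X by simp_all
    with AB show ?thesis by simp
  qed
  show ?case
  proof (cases i j rule: linorder_cases)
    case equal
    then have "perm_of is' = perm_of js'"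
      using Suc.prems(5) unfolding is' js' by (intro perm_of_snoc_cancel[of is' j js']) simp
    then show ?thesis
      using Suc.hyps(1)[OF m(1) asc', of "i # ks"] X equal by (simp add: is' js')
  next
    case less
    from w X(2,4) less wd show ?thesis
    proof (cases rule: descent_words)
      case (1 us)
      then show ?thesis
        using key[of "us @ [j]" "us @ [i]"] comm[of us ks i j] X by (simp add: is' js')
    next
      case (2 us)
      then show ?thesis
        using key[of "us @ [i, j]" "us @ [j, i]"] braid[of us ks i] X by (simp add: is' js')
    qed
  next
    case greater
    from w X(4,2) greater wd(2,1) show ?thesis
    proof (cases rule: descent_words)
      case (1 us)
      then show ?thesis
        using key[of "us @ [j]" "us @ [i]"] comm[of us ks j i] X by (simp add: is' js')
    next
      case (2 us)
      then show ?thesis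
        using key[of "us @ [i, j]" "us @ [j, i]"] braid[of us ks j] X by (simp add: is' js')
    qed
  qed
qed

section \<open>Shortest coset representatives\<close>

lemma coset_decomposition:
  assumes w: "w permutes {1..n}" and G: "id \<in> G" "\<And>u v. u \<in> G \<Longrightarrow> v \<in> G \<Longrightarrow> u \<circ> v \<in> G"
    "\<And>v. v \<in> G \<Longrightarrow> inv_into UNIV v \<in> G" "\<And>v. v \<in> G \<Longrightarrow> v permutes {1..n}"
  obtains w' v where "w' \<in> shortest_left_coset_elements n G" "v \<in> G" "w = w' \<circ> v"
proof -
  obtain u where u: "u \<in> G" "\<And>v. v \<in> G \<Longrightarrow> coxeter_length n (w \<circ> u) \<le> coxeter_length n (w \<circ> v)"
    using ex_has_least_nat[of "\<lambda>v. v \<in> G" id "\<lambda>v. coxeter_length n (w \<circ> v)"] G(1) by auto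
  have "w \<circ> u \<in> shortest_left_coset_elements n G"
    unfolding shortest_left_coset_elements_def
    using u G w by (auto simp: o_assoc[symmetric] intro: permutes_compose)
  moreover have "w = (w \<circ> u) \<circ> inv_into UNIV u"
    using permutes_inv_o(1)[OF G(4)[OF u(1)]] by (simp add: o_assoc[symmetric])
  ultimately show ?thesis
    using that G(3)[OF u(1)] by blast
qed

lemma shortest_increasing:
  assumes w: "w \<in> shortest_left_coset_elements n G" and i: "i \<in> {1..<n}" "transp i \<in> G"
  shows "w i < w (Suc i)"
proof (rule ccontr)
  assume c: "\<not> ?thesis"
  have p: "w permutes {1..n}" and le: "coxeter_length n w \<le> coxeter_length n (w \<circ> transp i)"
    using w i unfolding shortest_left_coset_elements_def by auto
  have "w \<circ> transp i permutes {1..n}"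
    using i by (intro permutes_compose[OF transp_permutes p]) auto
  note le = le[unfolded coxeter_length_eq[OF p] coxeter_length_eq[OF this]]
  have "w i \<noteq> w (Suc i)" using permutes_inj[OF p] by (simp add: inj_eq)
  with c have "inv_num n w = Suc (inv_num n (w \<circ> transp i))"
    using i by (intro inv_num_down) auto
  with le show False by simp
qed

lemma increasing_cancel:
  assumes v: "v permutes {lo..hi::nat}"
    and w: "\<And>x y. lo \<le> x \<Longrightarrow> x < y \<Longrightarrow> y \<le> hi \<Longrightarrow> w x < (w y :: nat)"
    and wv: "\<And>x y. lo \<le> x \<Longrightarrow> x < y \<Longrightarrow> y \<le> hi \<Longrightarrow> w (v x) < w (v y)"
  shows "v = id"
proof (rule increasing_permutation[OF v])
  fix x y assume xy: "lo \<le> x" "x < y" "y \<le> hi"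
  have "v x \<in> {lo..hi}" "v y \<in> {lo..hi}" using xy permutes_in_image[OF v] by simp_all
  moreover have "v x \<noteq> v y" using xy permutes_inj[OF v] by (simp add: inj_eq)
  ultimately show "v x < v y"
    using wv[OF xy] w[of "v y" "v x"] by (cases "v x" "v y" rule: linorder_cases) auto
qed

text \<open>By \<open>rigid\<close> a coset contains at most one shortest element, so composition is
  injective on the product of these elements with \<open>G\<close>. An upper bound is all that the
  count of tuples requires.\<close>

lemma card_shortest:
  assumes G: "\<And>u v. u \<in> G \<Longrightarrow> v \<in> G \<Longrightarrow> u \<circ> inv_into UNIV v \<in> G" "\<And>v. v \<in> G \<Longrightarrow> v permutes {1..n}"
    and rigid: "\<And>w u. w \<in> shortest_left_coset_elements n G \<Longrightarrow> u \<in> G \<Longrightarrow>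
      w \<circ> u \<in> shortest_left_coset_elements n G \<Longrightarrow> u = id"
  shows "card (shortest_left_coset_elements n G) * card G \<le> fact n"
proof -
  let ?S = "shortest_left_coset_elements n G"
  let ?P = "{w. w permutes {1..n}}"
  have S: "?S \<subseteq> ?P" by (auto simp: shortest_left_coset_elements_def)
  have "inj_on (\<lambda>(w, v). w \<circ> v) (?S \<times> G)"
  proof (rule inj_onI, clarify)
    fix w v w' v' assume wv: "w \<in> ?S" "v \<in> G" "w' \<in> ?S" "v' \<in> G" "w \<circ> v = w' \<circ> v'"
    let ?u = "v \<circ> inv_into UNIV v'"
    have "w' = w' \<circ> v' \<circ> inv_into UNIV v'"
      using permutes_inv_o(1)[OF G(2)[OF wv(4)]] by (simp add: o_assoc[symmetric])
    then have w': "w' = w \<circ> ?u" by (simp add: wv(5)[symmetric] o_assoc)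
    then have "?u = id" using rigid[OF wv(1) G(1)[OF wv(2,4)]] wv(3) by simp
    then have "?u \<circ> v' = v'" by simp
    then have "v = v'"
      using permutes_inv_o(2)[OF G(2)[OF wv(4)]] by (simp add: o_assoc[symmetric])
    then show "w = w' \<and> v = v'" using w' \<open>?u = id\<close> by simp
  qed
  moreover have "(\<lambda>(w, v). w \<circ> v) ` (?S \<times> G) \<subseteq> ?P"
    using S G(2) by (auto intro: permutes_compose)
  ultimately have "card (?S \<times> G) \<le> card ?P"
    by (intro card_inj_on_le) (auto simp: finite_permutations)
  then show ?thesis
    by (simp add: card_cartesian_product card_permutations)
qed

definition young :: "nat \<Rightarrow> nat \<Rightarrow> (nat \<Rightarrow> nat) set"
  where "young n r = {v \<circ> v' | v v'. v permutes {1..r} \<and> v' permutes {r + 1..n}}"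

lemma young_commute:
  assumes v: "v permutes {1..r}" and v': "v' permutes {r + 1..n::nat}"
  shows "v \<circ> v' = v' \<circ> v"
proof
  fix x
  consider "x \<in> {1..r}" | "x \<in> {r + 1..n}" | "x \<notin> {1..r}" "x \<notin> {r + 1..n}" by blast
  then show "(v \<circ> v') x = (v' \<circ> v) x"
  proof cases
    case 1
    then have "v x \<in> {1..r}" "x \<notin> {r + 1..n}" using permutes_in_image[OF v] by auto
    then have "v x \<notin> {r + 1..n}" by auto
    with \<open>x \<notin> {r + 1..n}\<close> show ?thesis using v' by (simp add: permutes_not_in)
  next
    case 2
    then have "v' x \<in> {r + 1..n}" "x \<notin> {1..r}" using permutes_in_image[OF v'] by auto
    then have "v' x \<notin> {1..r}" by auto
    with \<open>x \<notin> {1..r}\<close> show ?thesis using v by (simp add: permutes_not_in)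
  next
    case 3
    then show ?thesis using v v' by (simp add: permutes_not_in)
  qed
qed

lemma young_group:
  assumes "r \<le> n"
  shows "id \<in> young n r" "u \<in> young n r \<Longrightarrow> v \<in> young n r \<Longrightarrow> u \<circ> v \<in> young n r"
    "v \<in> young n r \<Longrightarrow> inv_into UNIV v \<in> young n r" "v \<in> young n r \<Longrightarrow> v permutes {1..n}"
proof -
  show "id \<in> young n r"
    unfolding young_def using permutes_id by (auto intro!: exI[of _ id])
  show "u \<circ> v \<in> young n r" if uv: "u \<in> young n r" "v \<in> young n r"
  proof -
    obtain u1 u2 v1 v2 where u: "u = u1 \<circ> u2" "u1 permutes {1..r}" "u2 permutes {r + 1..n}"
      and v: "v = v1 \<circ> v2" "v1 permutes {1..r}" "v2 permutes {r + 1..n}"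
      using uv unfolding young_def by blast
    have "u \<circ> v = u1 \<circ> (u2 \<circ> v1) \<circ> v2" unfolding u v by (simp add: o_assoc)
    also have "\<dots> = (u1 \<circ> v1) \<circ> (u2 \<circ> v2)"
      unfolding young_commute[OF v(2) u(3), symmetric] by (simp add: o_assoc)
    finally show ?thesis
      unfolding young_def using u v by (auto intro!: exI permutes_compose)
  qed
  show "inv_into UNIV v \<in> young n r" if vy: "v \<in> young n r"
  proof -
    obtain v1 v2 where v: "v = v1 \<circ> v2" "v1 permutes {1..r}" "v2 permutes {r + 1..n}"
      using vy unfolding young_def by blast
    have "inv_into UNIV v = inv_into UNIV v1 \<circ> inv_into UNIV v2"
      unfolding v young_commute[OF v(2,3)]
      using permutes_bij[OF v(2)] permutes_bij[OF v(3)] by (simp add: o_inv_distrib)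
    then show ?thesis
      unfolding young_def using v by (auto intro!: exI permutes_inv)
  qed
  show "v permutes {1..n}" if vy: "v \<in> young n r"
  proof -
    obtain v1 v2 where v: "v = v1 \<circ> v2" "v1 permutes {1..r}" "v2 permutes {r + 1..n}"
      using vy unfolding young_def by blast
    show ?thesis
      unfolding v using assms
      by (intro permutes_compose permutes_subset[OF v(2)] permutes_subset[OF v(3)]) auto
  qed
qed

lemma sym_group:
  "id \<in> {v. v permutes {1..r::nat}}" "u \<in> {v. v permutes {1..r}} \<Longrightarrow> v \<in> {v. v permutes {1..r}} \<Longrightarrow> u \<circ> v \<in> {v. v permutes {1..r}}"
  "v \<in> {v. v permutes {1..r}} \<Longrightarrow> inv_into UNIV v \<in> {v. v permutes {1..r}}"
  "r \<le> n \<Longrightarrow> v \<in> {v. v permutes {1..r}} \<Longrightarrow> v permutes {1..n}"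
  by (auto simp: permutes_id permutes_compose permutes_inv intro: permutes_subset)

lemma shortest_sym_increasing:
  assumes "w \<in> shortest_left_coset_elements n {v. v permutes {1..r}}" "r \<le> n"
    "1 \<le> x" "x < y" "y \<le> r"
  shows "w x < w y"
proof (rule increasing_interval[where f = w and lo = 1 and hi = r])
  fix i assume "1 \<le> i" "i < r"
  then show "w i < w (Suc i)"
    using shortest_increasing[OF assms(1), of i] transp_permutes[of 1 i r] assms(2) by simp
qed (use assms in simp_all)

lemma shortest_young_increasing:
  assumes w: "w \<in> shortest_left_coset_elements n (young n r)" and r: "r \<le> n"
  shows "1 \<le> x \<Longrightarrow> x < y \<Longrightarrow> y \<le> r \<Longrightarrow> w x < w y" "r + 1 \<le> x \<Longrightarrow> x < y \<Longrightarrow> y \<le> n \<Longrightarrow> w x < w y"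
proof -
  have 1: "transp i \<in> young n r" if "1 \<le> i" "i < r" for i
    unfolding young_def using transp_permutes[OF that] permutes_id
    by (intro CollectI exI[of _ "transp i"] exI[of _ id]) simp
  have 2: "transp i \<in> young n r" if "r + 1 \<le> i" "i < n" for i
    unfolding young_def using transp_permutes[OF that] permutes_id
    by (intro CollectI exI[of _ id] exI[of _ "transp i"]) simp
  show "1 \<le> x \<Longrightarrow> x < y \<Longrightarrow> y \<le> r \<Longrightarrow> w x < w y"
    by (rule increasing_interval[where lo = 1 and hi = r]) (use shortest_increasing[OF w _ 1] r in auto)
  show "r + 1 \<le> x \<Longrightarrow> x < y \<Longrightarrow> y \<le> n \<Longrightarrow> w x < w y"
    by (rule increasing_interval[where lo = "r + 1" and hi = n]) (use shortest_increasing[OF w _ 2] r in auto)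
qed

lemma card_shortest_sym:
  assumes "r \<le> n"
  shows "card (shortest_left_coset_elements n {v. v permutes {1..r}}) \<le> fact n div fact r"
proof -
  have "card (shortest_left_coset_elements n {v. v permutes {1..r}}) * card {v. v permutes {1..r}} \<le> fact n"
  proof (rule card_shortest)
    fix w u assume "w \<in> shortest_left_coset_elements n {v. v permutes {1..r}}" "u \<in> {v. v permutes {1..r}}"
      "w \<circ> u \<in> shortest_left_coset_elements n {v. v permutes {1..r}}"
    then show "u = id"
      using shortest_sym_increasing[OF _ assms, of w] shortest_sym_increasing[OF _ assms, of "w \<circ> u"]
      by (intro increasing_cancel[of u 1 r w]) simp_all
  next
    fix u v assume "u \<in> {v. v permutes {1..r}}" "v \<in> {v. v permutes {1..r}}"
    then show "u \<circ> inv_into UNIV v \<in> {v. v permutes {1..r}}"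
      by (simp add: permutes_compose permutes_inv)
  next
    fix v assume "v \<in> {v. v permutes {1..r}}"
    then show "v permutes {1..n}"
      using sym_group(4)[OF assms] by blast
  qed
  then show ?thesis
    by (simp add: card_permutations less_eq_div_iff_mult_less_eq)
qed

lemma card_young:
  assumes "r \<le> n"
  shows "card (young n r) = fact r * fact (n - r)"
proof -
  have "young n r = (\<lambda>(v, v'). v \<circ> v') ` ({v. v permutes {1..r}} \<times> {v. v permutes {r + 1..n}})"
    by (auto simp: young_def)
  moreover have "inj_on (\<lambda>(v, v'). v \<circ> v') ({v. v permutes {1..r}} \<times> {v. v permutes {r + 1..n}})"
  proof (rule inj_onI, clarify)
    fix v v' u u' :: "nat \<Rightarrow> nat"
    assume p: "v permutes {1..r}" "v' permutes {r + 1..n}" "u permutes {1..r}" "u' permutes {r + 1..n}"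
      and e: "v \<circ> v' = u \<circ> u'"
    have "v x = u x" for x
    proof (cases "x \<in> {1..r}")
      case True
      then have "x \<notin> {r + 1..n}" by auto
      then show ?thesis using fun_cong[OF e, of x] p by (simp add: permutes_not_in)
    qed (use p in \<open>simp add: permutes_not_in\<close>)
    then have "v = u" by blast
    moreover have "v' x = u' x" for x
      using fun_cong[OF e, of x] permutes_inj[OF p(3)] \<open>v = u\<close> by (simp add: inj_eq)
    ultimately show "v = u \<and> v' = u'" by blast
  qed
  ultimately show ?thesis
    by (simp add: card_image card_cartesian_product card_permutations)
qed

lemma card_shortest_young:
  assumes "r \<le> n"
  shows "card (shortest_left_coset_elements n (young n r)) \<le> n choose r"
proof -
  have "card (shortest_left_coset_elements n (young n r)) * card (young n r) \<le> fact n"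
  proof (rule card_shortest)
    fix w u assume w: "w \<in> shortest_left_coset_elements n (young n r)" and u: "u \<in> young n r"
      and wu: "w \<circ> u \<in> shortest_left_coset_elements n (young n r)"
    obtain v v' where v: "u = v \<circ> v'" "v permutes {1..r}" "v' permutes {r + 1..n}"
      using u unfolding young_def by blast
    have u1: "u x = v x" if "x \<le> r" for x
      unfolding v(1) using that v(3) by (simp add: permutes_not_in)
    have u2: "u x = v' x" if "r + 1 \<le> x" for x
      unfolding v(1) young_commute[OF v(2,3)] using that v(2) by (simp add: permutes_not_in)
    have "v = id"
    proof (rule increasing_cancel[OF v(2), of w])
      fix x y assume "1 \<le> x" "x < y" "y \<le> r"
      then show "w x < w y" "w (v x) < w (v y)"
        using shortest_young_increasing(1)[OF w assms] shortest_young_increasing(1)[OF wu assms, of x y] u1 by auto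
    qed
    moreover have "v' = id"
    proof (rule increasing_cancel[OF v(3), of w])
      fix x y assume "r + 1 \<le> x" "x < y" "y \<le> n"
      then show "w x < w y" "w (v' x) < w (v' y)"
        using shortest_young_increasing(2)[OF w assms] shortest_young_increasing(2)[OF wu assms, of x y] u2 by auto
    qed
    ultimately show "u = id" by (simp add: v(1))
  qed (use young_group[OF assms] in blast)+
  then have "card (shortest_left_coset_elements n (young n r)) * (fact r * fact (n - r))
      \<le> (n choose r) * (fact r * fact (n - r))"
    using binomial_fact_lemma[OF assms] by (simp add: card_young[OF assms] mult.commute mult.left_commute)
  then show ?thesis by simp
qed

section \<open>Words for the sets B_r\<close>

fun bw :: "nat \<Rightarrow> nat list set" where
  "bw 0 = {[]}"
| "bw (Suc 0) = {[]}"
| "bw (Suc (Suc r)) = bw (Suc r) \<union> (\<Union>j\<in>{1..Suc r}. (@) [j..<Suc (Suc r)] ` bw r)"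

lemma bw_letters: "b \<in> bw r \<Longrightarrow> set b \<subseteq> {1..<r}"
proof (induction r arbitrary: b rule: bw.induct)
  case (3 r)
  show ?case
  proof (cases "b \<in> bw (Suc r)")
    case True
    with 3(1) show ?thesis by fastforce
  next
    case False
    then obtain j b' where "b = [j..<Suc (Suc r)] @ b'" "b' \<in> bw r" "1 \<le> j" "j \<le> Suc r"
      using 3(3) by auto
    then show ?thesis using 3(2)[of j b'] by fastforce
  qed
qed auto

lemma perm_of_upt: "1 \<le> j \<Longrightarrow> j \<le> k \<Longrightarrow> 1 \<le> x \<Longrightarrow> x \<le> k \<Longrightarrow> perm_of [j..<k] x = (if x < j then x else if x < k then Suc x else j)"
proof (induction k arbitrary: x)
  case (Suc k)
  show ?case
  proof (cases "j \<le> k")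
    case True
    have "perm_of [j..<Suc k] x = perm_of [j..<k] (transp k x)"
      using True by (simp add: perm_of_snoc)
    moreover have "perm_of [j..<k] permutes {j..k}"
      by (rule perm_of_permutes) simp
    then have "perm_of [j..<k] (Suc k) = Suc k" by (simp add: permutes_not_in)
    ultimately show ?thesis
      using Suc.IH[OF _ True, of x] Suc.IH[OF _ True, of k] Suc.prems True by (auto simp: Transposition.transpose_def)
  qed (use Suc.prems in auto)
qed auto

lemma asc_upt: "1 \<le> j \<Longrightarrow> asc [j..<k]"
proof (induction k)
  case (Suc k)
  show ?case
  proof (cases "j \<le> k")
    case True
    have "perm_of [j..<k] permutes {j..k}"
      by (rule perm_of_permutes) simp
    then have "perm_of [j..<k] (Suc k) = Suc k" by (simp add: permutes_not_in)
    then show ?thesis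
      using Suc True perm_of_upt[of j k k] by (simp add: asc_snoc_iff)
  qed (simp add: asc.Nil)
qed (simp add: asc.Nil)

text \<open>The permutation of \<open>[j..<Suc (Suc r)]\<close> is increasing on
  \<open>1, ..., Suc r\<close>, so lengths add. Since the words are reduced, the transpose of their
  product is given by the reversed word.\<close>

lemma bw_asc: "b \<in> bw r \<Longrightarrow> asc b"
proof (induction r arbitrary: b rule: bw.induct)
  case (3 r)
  show ?case
  proof (cases "b \<in> bw (Suc r)")
    case False
    then obtain j b' where b: "b = [j..<Suc (Suc r)] @ b'" "b' \<in> bw r" "1 \<le> j" "j \<le> Suc r"
      using 3(3) by auto
    have "asc ([j..<Suc (Suc r)] @ b')"
    proof (rule asc_append[where lo = 1 and hi = "Suc r"])
      show "asc [j..<Suc (Suc r)]" using b(3) by (rule asc_upt)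
      show "asc b'" using 3(2)[of j b'] b by simp
      show "set b' \<subseteq> {1..<Suc r}" using bw_letters[OF b(2)] by auto
      fix x y assume "1 \<le> x" "x < y" "y \<le> Suc r"
      then show "perm_of [j..<Suc (Suc r)] x < perm_of [j..<Suc (Suc r)] y"
        using perm_of_upt[of j "Suc (Suc r)" x] perm_of_upt[of j "Suc (Suc r)" y] b by simp
    qed
    then show ?thesis by (simp add: b)
  qed (use 3 in blast)
qed (auto intro: asc.Nil)

section \<open>Computing modulo the relations\<close>

definition eqv :: "variant \<Rightarrow> nat \<Rightarrow> free_elem \<Rightarrow> free_elem \<Rightarrow> bool"
  where "eqv s n x y \<longleftrightarrow> x \<in> carrier (free_algebra (generators n))
    \<and> y \<in> carrier (free_algebra (generators n))
    \<and> x - y \<in> relation_ideal (generators n) (relations s n)"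

text \<open>The span of \<open>S\<close> modulo the relations, described by representatives in the
  free algebra. This permits induction and calculation there; classes appear only at the
  end.\<close>

inductive_set sp :: "variant \<Rightarrow> nat \<Rightarrow> free_elem set \<Rightarrow> free_elem set" for s n S where
  base: "x \<in> S \<Longrightarrow> x \<in> carrier (free_algebra (generators n)) \<Longrightarrow> x \<in> sp s n S"
| zero: "0 \<in> sp s n S"
| add: "x \<in> sp s n S \<Longrightarrow> y \<in> sp s n S \<Longrightarrow> x + y \<in> sp s n S"
| scale: "x \<in> sp s n S \<Longrightarrow> const c * x \<in> sp s n S"
| cong: "x \<in> sp s n S \<Longrightarrow> eqv s n x y \<Longrightarrow> y \<in> sp s n S"

lemma const_central: "const c * (x :: free_elem) = x * const c"
proof -
  have "(\<Sum>v\<in>S. Poly_Mapping.single v (Poly_Mapping.lookup x v)) * const c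
      = const c * (\<Sum>v\<in>S. Poly_Mapping.single v (Poly_Mapping.lookup x v))" for S
    by (simp add: sum_distrib_left sum_distrib_right mult_single mult.commute)
  moreover have "(\<Sum>v\<in>Poly_Mapping.keys x. Poly_Mapping.single v (Poly_Mapping.lookup x v)) = x"
    by (rule poly_mapping_eqI) (auto simp: lookup_sum lookup_single when_def in_keys_iff)
  ultimately show ?thesis by metis
qed

definition gl :: "nat list \<Rightarrow> free_elem"
  where "gl is = prod_list (map g_gen is)"

lemma gl_simps [simp]: "gl [] = 1" "gl (i # is) = g_gen i * gl is" "gl (xs @ ys) = gl xs * gl ys"
  by (simp_all add: gl_def)

locale presentation =
  fixes s :: variant and n :: nat
begin

interpretation I: ideal "relation_ideal (generators n) (relations s n)" "free_algebra (generators n)"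
  by (rule ideal_relation_ideal[OF relations_in_carrier])

abbreviation carr :: "free_elem set" where "carr \<equiv> carrier (free_algebra (generators n))"
abbreviation equ (infix "\<approx>" 50) where "x \<approx> y \<equiv> eqv s n x y"
abbreviation X :: "nat set" where "X \<equiv> {1..<n}"

lemma ideal_zero: "0 \<in> relation_ideal (generators n) (relations s n)"
  using additive_subgroup.zero_closed[OF ideal.axioms(1)[OF I.ideal_axioms]] by simp

lemma ideal_add: "x \<in> relation_ideal (generators n) (relations s n) \<Longrightarrow>
    y \<in> relation_ideal (generators n) (relations s n) \<Longrightarrow> x + y \<in> relation_ideal (generators n) (relations s n)"
  using additive_subgroup.a_closed[OF ideal.axioms(1)[OF I.ideal_axioms]] by simp

lemma ideal_mult: "x \<in> relation_ideal (generators n) (relations s n) \<Longrightarrow> z \<in> carr \<Longrightarrow>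
    z * x \<in> relation_ideal (generators n) (relations s n) \<and> x * z \<in> relation_ideal (generators n) (relations s n)"
  using I.I_l_closed I.I_r_closed by simp

lemma eqv_carr: "x \<approx> y \<Longrightarrow> x \<in> carr" "x \<approx> y \<Longrightarrow> y \<in> carr"
  by (simp_all add: eqv_def)

lemma eqv_refl [simp]: "x \<in> carr \<Longrightarrow> x \<approx> x"
  by (simp add: eqv_def ideal_zero)

lemma eqv_sym: "x \<approx> y \<Longrightarrow> y \<approx> x"
  unfolding eqv_def using ideal_mult[of "x - y" "const (- 1)"]
  by (simp add: Poly_Mapping.single_uminus)

lemma eqv_trans [trans]: "x \<approx> y \<Longrightarrow> y \<approx> z \<Longrightarrow> x \<approx> z"
  unfolding eqv_def using ideal_add[of "x - y" "y - z"] by simp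

lemma eqv_add: "x \<approx> y \<Longrightarrow> u \<approx> v \<Longrightarrow> x + u \<approx> y + v"
  unfolding eqv_def using ideal_add[of "x - y" "u - v"] by (simp add: algebra_simps)

lemma eqv_mult: "x \<approx> y \<Longrightarrow> u \<approx> v \<Longrightarrow> x * u \<approx> y * v"
proof -
  assume a: "x \<approx> y" "u \<approx> v"
  then have "(x - y) * u + y * (u - v) \<in> relation_ideal (generators n) (relations s n)"
    unfolding eqv_def by (intro ideal_add) (auto dest: ideal_mult)
  with a show ?thesis by (simp add: eqv_def algebra_simps)
qed

lemma eqv_left: "y \<approx> z \<Longrightarrow> x \<in> carr \<Longrightarrow> x * y \<approx> x * z"
  by (simp add: eqv_mult)

lemma eqv_right: "y \<approx> z \<Longrightarrow> x \<in> carr \<Longrightarrow> y * x \<approx> z * x"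
  by (simp add: eqv_mult)

lemma eqv_const: "y \<approx> z \<Longrightarrow> const c * y \<approx> const c * z"
  by (rule eqv_left) simp_all

lemma eqv_class: "x \<approx> y \<Longrightarrow> Calg_class s n x = Calg_class s n y"
proof -
  assume a: "x \<approx> y"
  have "x = (x - y) + y" by simp
  then have "x \<in> relation_ideal (generators n) (relations s n) +>\<^bsub>free_algebra (generators n)\<^esub> y"
    using a by (auto simp: a_r_coset_def' eqv_def intro!: bexI[of _ "x - y"])
  then show ?thesis
    unfolding Calg_class_def
    by (intro I.a_repr_independence[OF _ _ I.a_subgroup, symmetric]) (use a in \<open>simp_all add: eqv_def\<close>)
qed

lemma class_eqv:
  assumes "x \<in> carr" "y \<in> carr" "Calg_class s n x = Calg_class s n y"
  shows "x \<approx> y"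
proof -
  have "x \<in> Calg_class s n y"
    using assms I.a_rcos_self[of x] by (simp add: Calg_class_def)
  then obtain i where "i \<in> relation_ideal (generators n) (relations s n)" "x = i + y"
    by (auto simp: Calg_class_def a_r_coset_def')
  then show ?thesis using assms by (simp add: eqv_def)
qed

lemma eqv_relation: "(l, r) \<in> relations s n \<Longrightarrow> l \<approx> r"
proof -
  assume lr: "(l, r) \<in> relations s n"
  have "{l - r | l r. (l, r) \<in> relations s n} \<subseteq> carr"
    using relations_in_carrier[of _ _ s n] by auto
  from ring.genideal_self[OF ring_free_algebra this] have "l - r \<in> relation_ideal (generators n) (relations s n)"
    using lr unfolding relation_ideal_def by auto
  then show ?thesis
    using relations_in_carrier[OF lr] by (simp add: eqv_def)
qed

lemma sp_carr: "x \<in> sp s n S \<Longrightarrow> x \<in> carr"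
  by (induction rule: sp.induct) (auto dest: eqv_carr)

lemma sp_trans: "x \<in> sp s n S \<Longrightarrow> (\<And>y. y \<in> S \<Longrightarrow> y \<in> carr \<Longrightarrow> y \<in> sp s n T) \<Longrightarrow> x \<in> sp s n T"
  by (induction rule: sp.induct) (auto intro: sp.intros)

lemma sp_mono: "x \<in> sp s n S \<Longrightarrow> S \<subseteq> T \<Longrightarrow> x \<in> sp s n T"
  by (rule sp_trans[of x S T]) (auto intro: sp.base)

lemma sp_map:
  assumes add: "\<And>x y. h (x + y) = h x + h y" and sc: "\<And>c x. h (const c * x) = const c * h x"
    and cong: "\<And>x y. x \<approx> y \<Longrightarrow> h x \<approx> h y"
    and S: "\<And>y. y \<in> S \<Longrightarrow> y \<in> carr \<Longrightarrow> h y \<in> sp s n T"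
  shows "x \<in> sp s n S \<Longrightarrow> h x \<in> sp s n T"
proof (induction rule: sp.induct)
  case zero
  have "h (const 0 * 0) = const 0 * h 0" by (rule sc)
  then show ?case by (simp add: sp.zero)
qed (auto simp: add sc intro: sp.intros S cong)

lemma sp_left: "x \<in> sp s n S \<Longrightarrow> z \<in> carr \<Longrightarrow> (\<And>y. y \<in> S \<Longrightarrow> y \<in> carr \<Longrightarrow> z * y \<in> sp s n T) \<Longrightarrow> z * x \<in> sp s n T"
  by (rule sp_map[where h = "(*) z" and S = S])
    (auto simp: distrib_left eqv_left const_central[of _ z] simp flip: mult.assoc)

lemma sp_right: "x \<in> sp s n S \<Longrightarrow> z \<in> carr \<Longrightarrow> (\<And>y. y \<in> S \<Longrightarrow> y \<in> carr \<Longrightarrow> y * z \<in> sp s n T) \<Longrightarrow> x * z \<in> sp s n T"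
  by (rule sp_map[where h = "\<lambda>x. x * z" and S = S])
    (auto simp: distrib_right eqv_right mult.assoc)

lemma sp_diff: "x \<in> sp s n S \<Longrightarrow> y \<in> sp s n S \<Longrightarrow> x - y \<in> sp s n S"
  using sp.add[OF _ sp.scale[of y s n S "- 1"], of x] by (simp add: Poly_Mapping.single_uminus)

lemma sp_cong': "y \<approx> x \<Longrightarrow> x \<in> sp s n S \<Longrightarrow> y \<in> sp s n S"
  by (rule sp.cong[OF _ eqv_sym])

lemma gl_carr [simp]: "set is \<subseteq> X \<Longrightarrow> gl is \<in> carr"
  by (induction "is") auto

lemma g_comm: "i \<in> X \<Longrightarrow> j \<in> X \<Longrightarrow> Suc i < j \<or> Suc j < i \<Longrightarrow> g_gen i * g_gen j \<approx> g_gen j * g_gen i"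
proof (rule eqv_relation)
  assume "i \<in> X" "j \<in> X" "Suc i < j \<or> Suc j < i"
  moreover from this(3) have "\<bar>int i - int j\<bar> \<noteq> 1" by auto
  ultimately show "(g_gen i * g_gen j, g_gen j * g_gen i) \<in> relations s n"
    unfolding relations_def hecke_relations_def by blast
qed

lemma g_braid: "i \<in> X \<Longrightarrow> Suc i \<in> X \<Longrightarrow>
    g_gen i * g_gen (Suc i) * g_gen i \<approx> g_gen (Suc i) * g_gen i * g_gen (Suc i)"
  by (rule eqv_relation) (auto simp: relations_def hecke_relations_def)

lemma g_quad: "i \<in> X \<Longrightarrow> g_gen i * g_gen i \<approx> const (qvar - 1 / qvar) * g_gen i + 1"
  by (rule eqv_relation) (auto simp: relations_def hecke_relations_def)

lemma e_1_comm: "2 \<le> i \<Longrightarrow> i < n \<Longrightarrow> e_gen 1 * g_gen i \<approx> g_gen i * e_gen 1"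
proof -
  assume i: "2 \<le> i" "i < n"
  have "e_gen 1 * u_gen i \<approx> u_gen i * e_gen 1"
    by (rule eqv_relation) (use i in \<open>auto simp: relations_def commutation_relations_def\<close>)
  moreover have "e_gen (Suc 0) * const qvar = const qvar * e_gen (Suc 0)"
    by (simp only: const_central)
  ultimately show ?thesis
    using i eqv_sym unfolding eqv_def g_gen_def
    by (simp add: algebra_simps)
qed

lemma e_idem: "r \<le> n \<Longrightarrow> e_gen r * e_gen r \<approx> e_gen r"
proof (cases "r = 0")
  case False
  moreover assume "r \<le> n"
  ultimately show ?thesis
    by (intro eqv_relation) (auto simp: relations_def idempotent_relations_def)
qed (simp add: e_gen_def)

text \<open>The recursion rewritten with g_r = q - u_r in one form for both variants; the
  coefficient of \<open>e_gen r\<close> is \<open>tpar s\<close>.\<close>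

lemma e_rec: "1 \<le> r \<Longrightarrow> r < n \<Longrightarrow> e_gen (Suc r) \<approx>
    const (eta s * (qvar - coefficient s)) * e_gen r - const (eta s) * (e_gen r * g_gen r * e_gen r)"
proof -
  assume r: "1 \<le> r" "r < n"
  let ?c = "const (eta s * coefficient s) :: free_elem"
  have 1: "e_gen (Suc r) \<approx> const (eta s) * (e_gen r * u_gen r * e_gen r) - ?c * e_gen r"
    by (rule eqv_relation, cases s)
      (use r in \<open>auto simp: relations_def Poly_Mapping.single_uminus simp del: coefficient.simps\<close>)
  have u: "u_gen r = const qvar - g_gen r" by (simp add: g_gen_def)
  have "e_gen r * u_gen r * e_gen r = const qvar * (e_gen r * e_gen r) - e_gen r * g_gen r * e_gen r"
    by (simp add: u left_diff_distrib right_diff_distrib mult.assoc flip: const_central[of qvar "e_gen r"])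
  also have "\<dots> \<approx> const qvar * e_gen r - e_gen r * g_gen r * e_gen r"
  proof -
    have "const qvar * (e_gen r * e_gen r) + (- (e_gen r * g_gen r * e_gen r)) \<approx>
        const qvar * e_gen r + (- (e_gen r * g_gen r * e_gen r))"
      using r by (intro eqv_add eqv_const e_idem eqv_refl) auto
    then show ?thesis by simp
  qed
  finally have "const (eta s) * (e_gen r * u_gen r * e_gen r) + (- (?c * e_gen r)) \<approx>
      const (eta s) * (const qvar * e_gen r - e_gen r * g_gen r * e_gen r) + (- (?c * e_gen r))"
    using r by (intro eqv_add eqv_const eqv_refl) auto
  with 1 have "e_gen (Suc r) \<approx> const (eta s) * (const qvar * e_gen r - e_gen r * g_gen r * e_gen r) + (- (?c * e_gen r))"
    using eqv_trans by simp
  moreover have "const (eta s * (qvar - coefficient s)) = const (eta s) * const qvar - ?c"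
    by (simp add: right_diff_distrib Poly_Mapping.single_diff mult_single)
  then have "const (eta s * (qvar - coefficient s)) * e_gen r - const (eta s) * (e_gen r * g_gen r * e_gen r)
    = const (eta s) * (const qvar * e_gen r - e_gen r * g_gen r * e_gen r) + (- (?c * e_gen r))"
    by (simp only: left_diff_distrib right_diff_distrib mult.assoc) simp
  ultimately show ?thesis
    by simp
qed

text \<open>Under u = q - g the terms common to both sides of (c) cancel, leaving
  \<open>eta s\<close> as the only sign. The bracketing is the one demanded by
  \<open>acts_absorb\<close> for the left and right action.\<close>

lemma absorb:
  assumes "1 \<le> i" "Suc i < r" "r \<le> n"
  shows "g_gen i * (g_gen (Suc i) * e_gen r) + const (eta s) * (g_gen i * e_gen r)
    \<approx> g_gen (Suc i) * (g_gen i * e_gen r) + const (eta s) * (g_gen (Suc i) * e_gen r)" (is ?A)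
    and "(e_gen r * g_gen (Suc i)) * g_gen i + const (eta s) * (e_gen r * g_gen i)
    \<approx> (e_gen r * g_gen i) * g_gen (Suc i) + const (eta s) * (e_gen r * g_gen (Suc i))" (is ?B)
proof -
  let ?u = "u_gen i" and ?v = "u_gen (Suc i)" and ?e = "e_gen r" and ?h = "const (eta s) :: free_elem"
  have c: "i \<in> X" "Suc i \<in> X" "r \<le> n" using assms by auto
  have 1: "(?u * ?v - ?h * ?u) * ?e \<approx> (?v * ?u - ?h * ?v) * ?e"
    by (rule eqv_relation, cases s)
      (use assms in \<open>force simp: relations_def Poly_Mapping.single_uminus\<close>)+
  have 2: "?e * (?v * ?u - ?h * ?u) \<approx> ?e * (?u * ?v - ?h * ?v)"
    by (rule eqv_relation, cases s)
      (use assms in \<open>force simp: relations_def Poly_Mapping.single_uminus\<close>)+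
  have q: "x * (const qvar * z) = const qvar * (x * z)" "x * const qvar = const qvar * x"
    "x * (?h * z) = ?h * (x * z)" for x z :: free_elem
    by (simp_all only: const_central[of _ x] mult.assoc[symmetric])
  note alg = algebra_simps q[of "?u"] q[of ?v] q[of ?e]
  show ?A using 1 c unfolding eqv_def g_gen_def by (simp add: alg)
  show ?B using 2 c unfolding eqv_def g_gen_def by (simp add: alg)
qed

end

section \<open>Hecke actions\<close>

text \<open>Left multiplication, right multiplication, and right multiplication with reversed
  indices are all instances, so the reductions of words are proved once. The action is only required
  up to congruence.\<close>

locale hecke_action = presentation s n for s :: variant and n :: nat +
  fixes act :: "nat \<Rightarrow> free_elem \<Rightarrow> free_elem"
  assumes act_cong: "i \<in> X \<Longrightarrow> x \<approx> y \<Longrightarrow> act i x \<approx> act i y"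
    and act_add: "act i (x + y) = act i x + act i y"
    and act_const: "act i (const c * x) = const c * act i x"
    and act_comm: "i \<in> X \<Longrightarrow> j \<in> X \<Longrightarrow> Suc i < j \<or> Suc j < i \<Longrightarrow> x \<in> carr \<Longrightarrow> act i (act j x) \<approx> act j (act i x)"
    and act_braid: "i \<in> X \<Longrightarrow> Suc i \<in> X \<Longrightarrow> x \<in> carr \<Longrightarrow>
      act i (act (Suc i) (act i x)) \<approx> act (Suc i) (act i (act (Suc i) x))"
    and act_quad: "i \<in> X \<Longrightarrow> x \<in> carr \<Longrightarrow> act i (act i x) \<approx> const (qvar - 1 / qvar) * act i x + x"
begin

abbreviation acts :: "nat list \<Rightarrow> free_elem \<Rightarrow> free_elem" where "acts \<equiv> foldr act"

lemma act_carr: "i \<in> X \<Longrightarrow> x \<in> carr \<Longrightarrow> act i x \<in> carr"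
  using act_cong[of i x x] eqv_carr(1) by simp

lemma acts_carr: "set is \<subseteq> X \<Longrightarrow> x \<in> carr \<Longrightarrow> acts is x \<in> carr"
  by (induction "is") (auto intro: act_carr)

lemma acts_cong: "set is \<subseteq> X \<Longrightarrow> x \<approx> y \<Longrightarrow> acts is x \<approx> acts is y"
  by (induction "is") (auto intro: act_cong)

lemma acts_add: "acts is (x + y) = acts is x + acts is y"
  by (induction "is") (auto simp: act_add)

lemma acts_const: "acts is (const c * x) = const c * acts is x"
  by (induction "is") (auto simp: act_const)

lemma sp_acts:
  assumes "x \<in> sp s n S" "set is \<subseteq> X" "\<And>y. y \<in> S \<Longrightarrow> y \<in> carr \<Longrightarrow> acts is y \<in> sp s n T"
  shows "acts is x \<in> sp s n T"
  by (rule sp_map[where h = "acts is" and S = S])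
    (use assms in \<open>auto simp: acts_add acts_const acts_cong\<close>)

lemma act_acts_commute:
  "set is \<subseteq> X \<Longrightarrow> i \<in> X \<Longrightarrow> (\<And>k. k \<in> set is \<Longrightarrow> Suc i < k \<or> Suc k < i) \<Longrightarrow> x \<in> carr \<Longrightarrow>
    act i (acts is x) \<approx> acts is (act i x)"
proof (induction "is")
  case (Cons k ks)
  have "act i (act k (acts ks x)) \<approx> act k (act i (acts ks x))"
    using Cons.prems by (intro act_comm acts_carr) auto
  also have "\<dots> \<approx> act k (acts ks (act i x))"
    using Cons by (intro act_cong) auto
  finally show ?case by simp
qed (simp add: act_carr)

lemma acts_commute:
  "set is \<subseteq> X \<Longrightarrow> set js \<subseteq> X \<Longrightarrow> (\<And>i k. i \<in> set is \<Longrightarrow> k \<in> set js \<Longrightarrow> Suc i < k \<or> Suc k < i) \<Longrightarrow> x \<in> carr \<Longrightarrow>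
    acts is (acts js x) \<approx> acts js (acts is x)"
proof (induction "is")
  case (Cons i "is")
  have "act i (acts is (acts js x)) \<approx> act i (acts js (acts is x))"
    using Cons by (intro act_cong) auto
  also have "\<dots> \<approx> acts js (act i (acts is x))"
    using Cons.prems by (intro act_acts_commute acts_carr) auto
  finally show ?case by simp
qed (simp add: acts_carr)

text \<open>After commuting past the initial letters, a single braid move turns index
  \<open>i\<close> into \<open>i - 1\<close>, which then commutes with the rest of the
  interval.\<close>

lemma act_interval:
  assumes "1 \<le> j" "j < i" "i \<le> k" "k < n" "x \<in> carr"
  shows "act i (acts [j..<Suc k] x) \<approx> acts [j..<Suc k] (act (i - 1) x)"
proof -
  obtain m where m: "i = Suc m" using assms by (cases i) auto
  have jk: "[j..<Suc k] = [j..<m] @ m # Suc m # [Suc (Suc m)..<Suc k]"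
    using assms m upt_add_eq_append[of j m "Suc k - m"] by (simp add: upt_conv_Cons)
  have X: "set [j..<m] \<subseteq> X" "set [Suc (Suc m)..<Suc k] \<subseteq> X" "m \<in> X" "Suc m \<in> X"
    using assms m by auto
  define y where "y = acts [Suc (Suc m)..<Suc k] x"
  have y: "y \<in> carr" unfolding y_def by (intro acts_carr X assms)
  have "act i (acts [j..<Suc k] x) = act (Suc m) (acts [j..<m] (act m (act (Suc m) y)))"
    unfolding jk y_def m by simp
  also have "\<dots> \<approx> acts [j..<m] (act (Suc m) (act m (act (Suc m) y)))"
    using X y by (intro act_acts_commute act_carr) auto
  also have "\<dots> \<approx> acts [j..<m] (act m (act (Suc m) (act m y)))"
    using X y by (intro acts_cong eqv_sym[OF act_braid])
  also have "\<dots> \<approx> acts [j..<m] (act m (act (Suc m) (acts [Suc (Suc m)..<Suc k] (act m x))))"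
    unfolding y_def using X assms(5) by (intro acts_cong act_cong act_acts_commute) auto
  also have "\<dots> = acts [j..<Suc k] (act (i - 1) x)"
    unfolding jk m by simp
  finally show ?thesis .
qed

text \<open>The left coset decomposition of H_(k+1) over H_k, where \<open>j = Suc k\<close> gives
  the empty interval. A further generator enters the subalgebra, lengthens the interval, shortens it
  by the quadratic relation, or passes through with index lowered by one.\<close>

lemma acts_coset:
  assumes "k < n" "x \<in> carr"
  shows "set xs \<subseteq> {1..<Suc k} \<Longrightarrow>
    acts xs x \<in> sp s n {acts [j..<Suc k] (acts ys x) | j ys. 1 \<le> j \<and> j \<le> Suc k \<and> set ys \<subseteq> {1..<k}}"
    (is "_ \<Longrightarrow> _ \<in> sp s n ?S")
proof (induction xs)
  case Nil
  have "acts [Suc k..<Suc k] (acts [] x) \<in> ?S" by fastforce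
  then show ?case by (intro sp.base) (use assms in simp_all)
next
  case (Cons i xs)
  have i: "1 \<le> i" "i \<le> k" using Cons.prems by auto
  have S: "acts [j..<Suc k] (acts ys x) \<in> sp s n ?S" if "1 \<le> j" "j \<le> Suc k" "set ys \<subseteq> {1..<k}" for j ys
    by (rule sp.base) (use that assms in \<open>fastforce intro!: acts_carr simp del: upt_Suc\<close>)+
  have "acts [i] (acts xs x) \<in> sp s n ?S"
  proof (rule sp_acts)
    show "acts xs x \<in> sp s n ?S" using Cons by auto
    fix y assume "y \<in> ?S"
    then obtain j ys where y: "y = acts [j..<Suc k] (acts ys x)" "1 \<le> j" "j \<le> Suc k" "set ys \<subseteq> {1..<k}"
      by blast
    have ys: "acts ys x \<in> carr" using y(4) assms by (intro acts_carr) auto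
    consider "i + 1 < j" | "j = i + 1" | "j = i" | "j < i" by linarith
    then have "act i y \<in> sp s n ?S"
    proof cases
      case 1
      have "act i y \<approx> acts [j..<Suc k] (acts (i # ys) x)"
        unfolding y(1) foldr.simps o_apply by (rule act_acts_commute) (use 1 i ys y assms in auto)
      then show ?thesis using S[of j "i # ys"] 1 y i by (intro sp_cong'[of "act i y"]) auto
    next
      case 2
      then have "act i y = acts [i..<Suc k] (acts ys x)" using i by (simp add: y upt_conv_Cons del: upt_Suc)
      then show ?thesis using S[of i ys] i y by simp
    next
      case 3
      have "[j..<Suc k] = i # [Suc i..<Suc k]" using 3 i by (simp add: upt_conv_Cons)
      then have y': "y = act i (acts [Suc i..<Suc k] (acts ys x))" using y by simp
      have "act i y \<approx> const (qvar - 1 / qvar) * y + acts [Suc i..<Suc k] (acts ys x)"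
        unfolding y' by (rule act_quad) (use i assms ys in \<open>auto intro!: acts_carr simp del: upt_Suc\<close>)
      then show ?thesis
        by (rule sp_cong') (use S[of j ys] S[of "Suc i" ys] y i 3 in \<open>auto intro!: sp.add sp.scale simp del: upt_Suc\<close>)
    next
      case 4
      have "act i y \<approx> acts [j..<Suc k] (act (i - 1) (acts ys x))"
        unfolding y(1) by (rule act_interval) (use 4 y i ys assms in auto)
      then show ?thesis
      proof (rule sp_cong')
        have "i - 1 \<in> {1..<k}" using y i 4 by auto
        then show "acts [j..<Suc k] (act (i - 1) (acts ys x)) \<in> sp s n ?S"
          using S[of j "(i - 1) # ys"] y(2-4) by (simp del: upt_Suc)
      qed
    qed
    then show "acts [i] y \<in> sp s n ?S" by simp
  qed (use i assms in auto)
  then show ?case by simp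
qed

text \<open>By \<open>acts_coset\<close> and induction only products of two intervals ending in
  \<open>Suc m\<close> and \<open>m\<close> could leave the list \<open>bw\<close>. There the last
  letters are brought next to \<open>v\<close>, and the absorption relation replaces g_(m+1) g_m by
  g_m g_(m+1) and single letters, all of which have a suitable form.\<close>

lemma acts_absorb:
  assumes v: "v \<in> carr" and R: "R \<le> n"
    and absorb: "\<And>j. 1 \<le> j \<Longrightarrow> Suc j < R \<Longrightarrow>
      act j (act (Suc j) v) + const h * act j v \<approx> act (Suc j) (act j v) + const h * act (Suc j) v"
  shows "r \<le> R \<Longrightarrow> set xs \<subseteq> {1..<r} \<Longrightarrow> acts xs v \<in> sp s n {acts b v | b. b \<in> bw r}"
proof (induction r arbitrary: xs rule: bw.induct)
  case 1
  then show ?case using v by (auto intro!: sp.base)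
next
  case 2
  then show ?case using v by (auto intro!: sp.base)
next
  case (3 m)
  note IH1 = "3.IH"(1) and IH2 = "3.IH"(2)
  let ?k = "Suc m"
  let ?T = "{acts b v | b. b \<in> bw (Suc ?k)}"
  have mn: "?k < n" "Suc ?k \<le> R" using "3.prems" R by auto
  have bw_carr: "acts b v \<in> carr" if "set b \<subseteq> {1..<Suc ?k}" for b
    using that mn by (intro acts_carr v) auto
  have target: "acts [j..<Suc ?k] (acts b v) \<in> sp s n ?T" if "1 \<le> j" "j \<le> ?k" "b \<in> bw m" for j b
  proof (rule sp.base)
    have "[j..<Suc ?k] @ b \<in> bw (Suc ?k)" using that by auto
    then show "acts [j..<Suc ?k] (acts b v) \<in> ?T"
      by (intro CollectI exI[of _ "[j..<Suc ?k] @ b"]) simp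
    show "acts [j..<Suc ?k] (acts b v) \<in> carr"
      using bw_letters[OF that(3)] that mn by (intro acts_carr v) auto
  qed
  have low: "acts xs v \<in> sp s n ?T" if "set xs \<subseteq> {1..<?k}" for xs
  proof (rule sp_mono)
    show "acts xs v \<in> sp s n {acts b v | b. b \<in> bw ?k}" using IH1 that mn by auto
  qed auto
  have top: "acts [j..<Suc ?k] (acts ys v) \<in> sp s n ?T" if "1 \<le> j" "j \<le> ?k" "set ys \<subseteq> {1..<m}" for j ys
  proof (rule sp_acts)
    show "acts ys v \<in> sp s n {acts b v | b. b \<in> bw m}" using IH2 that mn by auto
    show "acts [j..<Suc ?k] y \<in> sp s n ?T" if "y \<in> {acts b v | b. b \<in> bw m}" for y
      using that target \<open>1 \<le> j\<close> \<open>j \<le> ?k\<close> by blast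
  qed (use that mn in auto)
  \<comment> \<open>Write \<open>ws\<close> as an interval ending in \<open>m\<close> times letters
    below \<open>m\<close>. The latter commute with \<open>?k\<close>, so \<open>?k\<close> prolongs
    the interval.\<close>
  have Q: "acts ws (act ?k v) \<in> sp s n ?T" if "set ws \<subseteq> {1..<?k}" for ws
  proof (rule sp_trans)
    show "acts ws (act ?k v) \<in> sp s n {acts [j..<Suc m] (acts ys (act ?k v)) | j ys. 1 \<le> j \<and> j \<le> Suc m \<and> set ys \<subseteq> {1..<m}}"
      using that mn v by (intro acts_coset) (auto intro: act_carr)
    fix y assume "y \<in> {acts [j..<Suc m] (acts ys (act ?k v)) | j ys. 1 \<le> j \<and> j \<le> Suc m \<and> set ys \<subseteq> {1..<m}}"
    then obtain j ys where y: "y = acts [j..<Suc m] (acts ys (act ?k v))" "1 \<le> j" "j \<le> Suc m" "set ys \<subseteq> {1..<m}"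
      by blast
    have "acts ys (act ?k v) \<approx> act ?k (acts ys v)"
      by (rule eqv_sym[OF act_acts_commute]) (use y mn v in auto)
    then have "y \<approx> acts [j..<Suc m] (act ?k (acts ys v))"
      unfolding y(1) using y mn by (intro acts_cong) auto
    then show "y \<in> sp s n ?T"
      by (rule sp_cong') (use top[of j ys] y in simp)
  qed
  show ?case
  proof (rule sp_trans)
    show "acts xs v \<in> sp s n {acts [j..<Suc ?k] (acts ys v) | j ys. 1 \<le> j \<and> j \<le> Suc ?k \<and> set ys \<subseteq> {1..<?k}}"
      using "3.prems" mn v by (intro acts_coset) auto
    fix y assume "y \<in> {acts [j..<Suc ?k] (acts ys v) | j ys. 1 \<le> j \<and> j \<le> Suc ?k \<and> set ys \<subseteq> {1..<?k}}"
    then obtain j ys where y: "y = acts [j..<Suc ?k] (acts ys v)" "1 \<le> j" "j \<le> Suc ?k" "set ys \<subseteq> {1..<?k}"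
      by blast
    show "y \<in> sp s n ?T"
    proof (cases "j = Suc ?k")
      case True
      then show ?thesis using y low by simp
    next
      case False
      then have j: "j \<le> ?k" using y by simp
      have "acts [j..<Suc ?k] (acts ys v) \<in> sp s n ?T"
      proof (rule sp_acts)
        show "acts ys v \<in> sp s n {acts b v | b. b \<in> bw ?k}" using IH1 y mn by auto
        show "set [j..<Suc ?k] \<subseteq> X" using y mn by auto
        fix z assume "z \<in> {acts b v | b. b \<in> bw ?k}"
        then obtain b where z: "z = acts b v" "b \<in> bw ?k" by blast
        show "acts [j..<Suc ?k] z \<in> sp s n ?T"
        proof (cases "b \<in> bw m")
          case True
          then show ?thesis using z target[of j b] y j by simp
        next
          case False
          then obtain l where l: "m = Suc l" using z by (cases m) auto
          with z False obtain i b' where b: "b = [i..<Suc m] @ b'" "1 \<le> i" "i \<le> m" "b' \<in> bw l"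
            by auto
          have b': "set b' \<subseteq> {1..<l}" using bw_letters[OF b(4)] .
          define ws where "ws = [j..<?k] @ [i..<m] @ b'"
          have ws: "set ws \<subseteq> {1..<?k}" using b b' y l by (auto simp: ws_def)
          have mX: "m \<in> X" "?k \<in> X" using l mn by auto
          have c: "acts b' v \<in> carr" using b' mn l v by (intro acts_carr) auto
          have vk: "act ?k v \<in> carr" "act m v \<in> carr" using v mX act_carr by auto
          have "acts [j..<Suc ?k] z = acts [j..<?k] (act ?k (acts [i..<m] (act m (acts b' v))))"
            using z b y j by simp
          also have "\<dots> \<approx> acts [j..<?k] (acts [i..<m] (act ?k (act m (acts b' v))))"
            by (intro acts_cong act_acts_commute act_carr c mX) (use y b mn in auto)
          \<comment> \<open>The letters of \<open>b'\<close> are below \<open>m - 1\<close>, hence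
            commute with \<open>m\<close> and \<open>?k\<close>.\<close>
          also have "\<dots> \<approx> acts [j..<?k] (acts [i..<m] (acts b' (act ?k (act m v))))"
          proof (intro acts_cong)
            have bx: "1 \<le> x \<and> x < n \<and> Suc x < m" if "x \<in> set b'" for x using b' that mn l by auto
            have "acts [?k, m] (acts b' v) \<approx> acts b' (acts [?k, m] v)"
            proof (rule acts_commute)
              show "Suc i < k \<or> Suc k < i" if "i \<in> set [?k, m]" "k \<in> set b'" for i k
                using bx[OF that(2)] that(1) by auto
              show "set b' \<subseteq> X" using bx by auto
            qed (use mX v in auto)
            then show "act ?k (act m (acts b' v)) \<approx> acts b' (act ?k (act m v))" by simp
          qed (use y b mn in auto)
          also have "\<dots> = acts ws (act ?k (act m v))" by (simp add: ws_def)
          finally have 1: "acts [j..<Suc ?k] z \<approx> acts ws (act ?k (act m v))" .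
          have "act m (act ?k v) + const h * act m v + const (- h) * act ?k v
              \<approx> act ?k (act m v) + const h * act ?k v + const (- h) * act ?k v"
            by (intro eqv_add[OF absorb eqv_refl]) (use l mn vk in auto)
          from eqv_sym[OF this] have 2: "act ?k (act m v) \<approx> act m (act ?k v) + const h * act m v + const (- h) * act ?k v"
            by (simp add: Poly_Mapping.single_uminus)
          have wsX: "set ws \<subseteq> X" using ws mn by auto
          have "acts [j..<Suc ?k] z \<approx> acts ws (act m (act ?k v) + const h * act m v + const (- h) * act ?k v)"
            using eqv_trans[OF 1 acts_cong[OF wsX 2]] .
          moreover have "acts ws (act m (act ?k v)) \<in> sp s n ?T" "acts ws (act m v) \<in> sp s n ?T" "acts ws (act ?k v) \<in> sp s n ?T"
            using Q[of "ws @ [m]"] low[of "ws @ [m]"] Q[of ws] ws l by auto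
          ultimately show ?thesis
            unfolding acts_add acts_const by (blast intro: sp_cong' sp.add sp.scale)
        qed
      qed
      then show ?thesis using y by simp
    qed
  qed
qed

end

section \<open>The spanning set\<close>

context presentation
begin

lemma eqv_mid: "a \<approx> b \<Longrightarrow> x \<in> carr \<Longrightarrow> y \<in> carr \<Longrightarrow> x * a * y \<approx> x * b * y"
  by (intro eqv_mult eqv_refl)

lemma eqv_diff: "x \<approx> y \<Longrightarrow> u \<approx> v \<Longrightarrow> x - u \<approx> y - v"
  using eqv_add[OF _ eqv_const[of u v "- 1"], of x y]
  by (simp add: Poly_Mapping.single_uminus)

lemma const_left: "x * (const c * y) = const c * (x * y :: free_elem)"
  by (simp only: const_central[of _ x] mult.assoc[symmetric])

lemma left_action: "hecke_action s n (\<lambda>i. (*) (g_gen i))"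
proof (unfold_locales, goal_cases)
  case (4 i j x)
  then show ?case using eqv_right[OF g_comm, of i j x] by (simp add: mult.assoc)
next
  case (5 i x)
  then show ?case using eqv_right[OF g_braid, of i x] by (simp add: mult.assoc)
next
  case (6 i x)
  then show ?case using eqv_right[OF g_quad, of i x] by (simp add: mult.assoc distrib_right)
qed (auto simp: distrib_left const_left eqv_left)

lemma right_action: "hecke_action s n (\<lambda>i x. x * g_gen i)"
proof (unfold_locales, goal_cases)
  case (4 i j x)
  then show ?case using eqv_left[OF g_comm, of j i x] by (auto simp: mult.assoc)
next
  case (5 i x)
  then show ?case using eqv_left[OF g_braid, of i x] by (simp add: mult.assoc)
next
  case (6 i x)
  then show ?case using eqv_left[OF g_quad, of i x] by (simp add: mult.assoc distrib_left const_left)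
qed (auto simp: distrib_right eqv_right mult.assoc)

text \<open>Reversing the order of the generators turns the cosets of \<open>S\<^bsub>n-1\<^esub>\<close> into those of the stabiliser of \<open>1\<close>.\<close>

lemma mirrored_right_action: "hecke_action s n (\<lambda>i x. x * g_gen (n - i))"
proof (unfold_locales, goal_cases)
  case (1 i x y)
  then show ?case by (intro eqv_right) auto
next
  case (4 i j x)
  then have "Suc (n - j) < n - i \<or> Suc (n - i) < n - j" "n - j \<in> X" "n - i \<in> X" by auto
  then show ?case using 4 eqv_left[OF g_comm, of "n - j" "n - i" x] by (simp add: mult.assoc)
next
  case (5 i x)
  then have "n - i = Suc (n - Suc i)" "n - Suc i \<in> X" "Suc (n - Suc i) \<in> X" by auto
  then show ?case using 5 eqv_sym[OF eqv_left[OF g_braid, of "n - Suc i" x]] by (simp add: mult.assoc)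
next
  case (6 i x)
  then have "n - i \<in> X" by auto
  then show ?case using 6 eqv_left[OF g_quad, of "n - i" x] by (simp add: mult.assoc distrib_left const_left)
qed (auto simp: distrib_right mult.assoc)

lemma foldr_left: "foldr (\<lambda>i. (*) (g_gen i)) is x = gl is * x"
  by (induction "is") (simp_all add: mult.assoc)

lemma foldr_right: "foldr (\<lambda>i x. x * g_gen (f i)) is x = x * gl (map f (rev is))"
  by (induction "is") (simp_all add: mult.assoc)

text \<open>The generators with index at least 2 are collected on the left because those are the
  ones that commute with e_(1).\<close>

lemma gl_tail_coset:
  assumes "set xs \<subseteq> X" "1 \<le> n"
  shows "gl xs \<in> sp s n {gl as * gl [1..<k] | as k. set as \<subseteq> {2..<n} \<and> 1 \<le> k \<and> k \<le> n}"
    (is "_ \<in> sp s n ?S")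
proof -
  have False: "n \<noteq> 0" using assms by simp
  define f where "f i = n - i" for i
  let ?ys = "map f (rev xs)"
  let ?acts = "foldr (\<lambda>i x. x * g_gen (f i))"
  have "map f (rev ?ys) = xs"
    using assms by (auto simp: f_def rev_map intro!: map_idI)
  then have xs: "gl xs = ?acts ?ys 1"
    unfolding foldr_right by simp
  have "?acts ?ys 1 \<in> sp s n {?acts [j..<Suc (n - 1)] (?acts ys 1) | j ys. 1 \<le> j \<and> j \<le> Suc (n - 1) \<and> set ys \<subseteq> {1..<n - 1}}"
    unfolding f_def
  proof (rule hecke_action.acts_coset[OF mirrored_right_action])
    have "n - x \<in> {1..<n}" if "x \<in> set xs" for x using subsetD[OF assms(1) that] by auto
    then show "set (map ((-) n) (rev xs)) \<subseteq> {1..<Suc (n - 1)}" using False by auto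
  qed (use False in auto)
  then show ?thesis
    unfolding xs
  proof (rule sp_mono, safe)
    fix j ys assume j: "1 \<le> j" "j \<le> Suc (n - 1)" "set ys \<subseteq> {1..<n - 1}"
    have l: "map f (rev [j..<n]) = [1..<Suc (n - j)]"
      by (rule nth_equalityI) (auto simp: f_def rev_nth simp del: upt_Suc)
    have "?acts [j..<Suc (n - 1)] (?acts ys 1) = gl (map f (rev ys)) * gl [1..<Suc (n - j)]"
      using False unfolding foldr_right by (simp add: l del: upt_Suc)
    moreover have "n - x \<in> {2..<n}" if "x \<in> set ys" for x using subsetD[OF j(3) that] by auto
    then have "set (map f (rev ys)) \<subseteq> {2..<n}" by (auto simp: f_def)
    ultimately show "\<exists>as k. ?acts [j..<Suc (n - 1)] (?acts ys 1) = gl as * gl [1..<k] \<and>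
        set as \<subseteq> {2..<n} \<and> 1 \<le> k \<and> k \<le> n"
      using j False by (intro exI[of _ "map f (rev ys)"] exI[of _ "Suc (n - j)"]) auto
  qed
qed

section \<open>Products of idempotents and Hecke words\<close>

lemma e_g_comm: "r < i \<Longrightarrow> i < n \<Longrightarrow> e_gen r * g_gen i \<approx> g_gen i * e_gen r"
proof (induction r)
  case 0
  then show ?case by (simp add: e_gen_def)
next
  case (Suc r)
  show ?case
  proof (cases "r = 0")
    case True
    then show ?thesis using e_1_comm[of i] Suc by simp
  next
    case False
    let ?e = "e_gen r" and ?g = "g_gen r" and ?k = "g_gen i"
    let ?C = "const (eta s * (qvar - coefficient s)) :: free_elem" and ?H = "const (eta s) :: free_elem"
    have rec: "e_gen (Suc r) \<approx> ?C * ?e - ?H * (?e * ?g * ?e)"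
      by (rule e_rec) (use False Suc.prems in auto)
    have c: "?e \<in> carr" "?g \<in> carr" "?k \<in> carr" using False Suc.prems by auto
    have comm: "?e * ?k \<approx> ?k * ?e" using Suc by simp
    have "?e * ?g * ?e * ?k \<approx> ?e * ?g * (?k * ?e)"
      unfolding mult.assoc by (intro eqv_left comm c)
    also have "\<dots> \<approx> ?e * (?k * ?g) * ?e"
      using eqv_mid[OF g_comm[of r i], of ?e ?e] False Suc.prems c by (simp add: mult.assoc)
    also have "\<dots> \<approx> ?k * ?e * (?g * ?e)"
      using eqv_right[OF comm, of "?g * ?e"] c by (simp add: mult.assoc)
    finally have ege: "?e * ?g * ?e * ?k \<approx> ?k * (?e * ?g * ?e)" by (simp add: mult.assoc)
    have "e_gen (Suc r) * ?k \<approx> (?C * ?e - ?H * (?e * ?g * ?e)) * ?k"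
      by (intro eqv_right rec c)
    also have "\<dots> = ?C * (?e * ?k) - ?H * (?e * ?g * ?e * ?k)"
      by (simp only: left_diff_distrib mult.assoc)
    also have "\<dots> \<approx> ?C * (?k * ?e) - ?H * (?k * (?e * ?g * ?e))"
      by (intro eqv_diff eqv_const comm ege)
    also have "\<dots> = ?k * (?C * ?e - ?H * (?e * ?g * ?e))"
      by (simp only: right_diff_distrib const_left)
    also have "\<dots> \<approx> ?k * e_gen (Suc r)"
      by (intro eqv_left eqv_sym[OF rec] c)
    finally show ?thesis .
  qed
qed

lemma gl_e_comm: "r \<le> n \<Longrightarrow> set is \<subseteq> {Suc r..<n} \<Longrightarrow> gl is * e_gen r \<approx> e_gen r * gl is"
proof (induction "is")
  case Nil
  then show ?case by simp
next
  case (Cons i "is")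
  then have c: "i \<in> X" "r < i" "i < n" "r \<le> n" "gl is \<in> carr" by (auto intro!: gl_carr)
  have "g_gen i * (gl is * e_gen r) \<approx> g_gen i * (e_gen r * gl is)"
    using Cons c by (intro eqv_left) auto
  also have "\<dots> \<approx> e_gen r * g_gen i * gl is"
    using eqv_right[OF eqv_sym[OF e_g_comm[of r i]], of "gl is"] c by (simp add: mult.assoc)
  finally show ?case by (simp add: mult.assoc)
qed

lemma e_absorb: "r \<le> t \<Longrightarrow> t \<le> n \<Longrightarrow> e_gen r * e_gen t \<approx> e_gen t"
proof (induction t)
  case 0
  then show ?case by (simp add: e_gen_def)
next
  case (Suc t)
  consider "r = Suc t" | "r = 0" | "r \<le> t" "t \<noteq> 0" using Suc by linarith
  then show ?case
  proof cases
    case 3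
    let ?e = "e_gen t" and ?g = "g_gen t"
    let ?C = "const (eta s * (qvar - coefficient s)) :: free_elem" and ?H = "const (eta s) :: free_elem"
    have rec: "e_gen (Suc t) \<approx> ?C * ?e - ?H * (?e * ?g * ?e)"
      by (rule e_rec) (use 3 Suc.prems in auto)
    have c: "?e \<in> carr" "?g \<in> carr" "e_gen r \<in> carr" using 3 Suc.prems by auto
    have IH: "e_gen r * ?e \<approx> ?e" using Suc 3 by simp
    have "e_gen r * e_gen (Suc t) \<approx> e_gen r * (?C * ?e - ?H * (?e * ?g * ?e))"
      by (intro eqv_left rec c)
    also have "\<dots> = ?C * (e_gen r * ?e) - ?H * ((e_gen r * ?e) * (?g * ?e))"
      by (simp only: right_diff_distrib const_left mult.assoc)
    also have "\<dots> \<approx> ?C * ?e - ?H * (?e * (?g * ?e))"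
      by (intro eqv_diff eqv_const eqv_right IH) (use c in auto)
    also have "\<dots> \<approx> e_gen (Suc t)"
      using eqv_sym[OF rec] by (simp only: mult.assoc)
    finally show ?thesis .
  qed (use Suc.prems e_idem[of "Suc t"] eqv_refl[of "e_gen (Suc t)"] in \<open>auto simp: e_gen_def[of 0]\<close>)
qed

lemma e_g_e:
  assumes "1 \<le> r" "r < n"
  shows "e_gen r * g_gen r * e_gen r \<approx> const (qvar - coefficient s) * e_gen r - const (eta s) * e_gen (Suc r)"
proof -
  let ?x = "e_gen r * g_gen r * e_gen r" and ?H = "const (eta s) :: free_elem"
  let ?C = "const (eta s * (qvar - coefficient s)) :: free_elem"
  have x: "?x \<in> carr" "e_gen r \<in> carr" using assms by auto
  have e: "?H * ?H = 1" "?H * ?C = const (qvar - coefficient s)"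
    by (cases s; simp add: mult_single)+
  have "?H * e_gen (Suc r) \<approx> ?H * (?C * e_gen r - ?H * ?x)"
    using e_rec[OF assms] by (rule eqv_const)
  also have "\<dots> = (?H * ?C) * e_gen r - (?H * ?H) * ?x"
    by (simp only: right_diff_distrib mult.assoc)
  also have "\<dots> = const (qvar - coefficient s) * e_gen r - ?x"
    unfolding e by simp
  finally have "?H * e_gen (Suc r) \<approx> const (qvar - coefficient s) * e_gen r - ?x" .
  from eqv_diff[OF eqv_refl eqv_sym[OF this], of "const (qvar - coefficient s) * e_gen r"] show ?thesis
    using x by simp
qed

abbreviation hecke_span where "hecke_span \<equiv> sp s n {gl is | is. set is \<subseteq> X}"

lemma hecke_span_gl: "set is \<subseteq> X \<Longrightarrow> gl is \<in> hecke_span"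
  by (rule sp.base) auto

text \<open>Since e_(k) e_(k+1) = e_(k+1) and e_(k) commutes with g_(k+1), a factor e_(k) can be
  inserted in front of g_(k+1) e_(k+1). The induction hypothesis then applies to its left, and the
  recursion to the resulting e_(k+1) g_(k+1) e_(k+1).\<close>

lemma e_descending:
  "1 \<le> k \<Longrightarrow> k < n \<Longrightarrow>
    \<exists>c x. x \<in> hecke_span \<and> e_gen 1 * gl [1..<Suc k] * e_gen k \<approx> const c * e_gen (Suc k) + x * e_gen k"
proof (induction k rule: dec_induct)
  case base
  have "e_gen 1 * gl [1..<Suc 1] * e_gen 1 \<approx>
      const (- eta s) * e_gen (Suc 1) + (const (qvar - coefficient s) * gl []) * e_gen 1"
    using e_g_e[of 1] base by (simp add: Poly_Mapping.single_uminus)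
  moreover have "const (qvar - coefficient s) * gl [] \<in> hecke_span"
    by (intro sp.scale hecke_span_gl) simp
  ultimately show ?case by blast
next
  case (step k)
  let ?e = "e_gen (Suc k)" and ?g = "g_gen (Suc k)"
  obtain c x where x: "x \<in> hecke_span" "e_gen 1 * gl [1..<Suc k] * e_gen k \<approx> const c * ?e + x * e_gen k"
    using step by auto
  have cc: "?e \<in> carr" "?g \<in> carr" "e_gen k \<in> carr" "e_gen 1 \<in> carr" "gl [1..<Suc k] \<in> carr" "x \<in> carr"
    using step x sp_carr[OF x(1)] by (auto intro!: gl_carr simp del: upt_Suc)
  have ab: "e_gen k * ?e \<approx> ?e" using step by (intro e_absorb) auto
  have cm: "e_gen k * ?g \<approx> ?g * e_gen k" using step by (intro e_g_comm) auto
  have kge: "e_gen k * ?g * ?e \<approx> ?g * ?e"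
    using eqv_trans[OF eqv_right[OF cm cc(1)]] eqv_left[OF ab cc(2)] by (simp add: mult.assoc)
  let ?P = "e_gen 1 * gl [1..<Suc k]"
  have "?P * (?g * ?e) \<approx> ?P * (e_gen k * ?g * ?e)"
    by (intro eqv_left eqv_sym[OF kge]) (use cc in simp)
  also have "\<dots> = (?P * e_gen k) * (?g * ?e)"
    by (simp only: mult.assoc)
  also have "\<dots> \<approx> (const c * ?e + x * e_gen k) * (?g * ?e)"
    by (intro eqv_right x) (use cc in simp)
  also have "\<dots> = const c * (?e * ?g * ?e) + x * (e_gen k * ?g * ?e)"
    by (simp only: distrib_right mult.assoc)
  also have "\<dots> \<approx> const c * (const (qvar - coefficient s) * ?e - const (eta s) * e_gen (Suc (Suc k))) + x * (?g * ?e)"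
    by (intro eqv_add eqv_const eqv_left e_g_e kge) (use cc step in auto)
  also have "\<dots> = const (- (c * eta s)) * e_gen (Suc (Suc k)) + (const (c * (qvar - coefficient s)) * gl [] + x * ?g) * ?e"
    by (simp add: right_diff_distrib[of "const c"] distrib_right mult.assoc const_mult_assoc Poly_Mapping.single_uminus)
  finally have "e_gen 1 * gl [1..<Suc (Suc k)] * ?e \<approx>
      const (- (c * eta s)) * e_gen (Suc (Suc k)) + (const (c * (qvar - coefficient s)) * gl [] + x * ?g) * ?e"
    by (simp add: mult.assoc)
  moreover have xg: "x * ?g \<in> hecke_span"
    using x(1) cc(2)
  proof (rule sp_right)
    fix y assume "y \<in> {gl is | is. set is \<subseteq> X}"
    then obtain "is" where "y = gl is" "set is \<subseteq> X" by blast
    then show "y * ?g \<in> hecke_span" using hecke_span_gl[of "is @ [Suc k]"] step by simp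
  qed
  moreover have "const (c * (qvar - coefficient s)) * gl [] + x * ?g \<in> hecke_span"
    by (intro sp.add sp.scale hecke_span_gl xg) simp
  ultimately show ?case by blast
qed

abbreviation e_span where "e_span \<equiv> sp s n {gl xs * e_gen r * gl ys | xs r ys. set xs \<subseteq> X \<and> set ys \<subseteq> X \<and> r \<le> n}"

lemma e_span_base: "set xs \<subseteq> X \<Longrightarrow> set ys \<subseteq> X \<Longrightarrow> r \<le> n \<Longrightarrow> gl xs * e_gen r * gl ys \<in> e_span"
  by (rule sp.base) auto

lemma e_span_g: "z \<in> e_span \<Longrightarrow> set is \<subseteq> X \<Longrightarrow> gl is * z \<in> e_span"
proof (erule sp_left)
  fix y assume i: "set is \<subseteq> X" and "y \<in> {gl xs * e_gen r * gl ys | xs r ys. set xs \<subseteq> X \<and> set ys \<subseteq> X \<and> r \<le> n}"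
  then obtain xs r ys where "y = gl xs * e_gen r * gl ys" "set xs \<subseteq> X" "set ys \<subseteq> X" "r \<le> n" by blast
  then show "gl is * y \<in> e_span" using e_span_base[of "is @ xs" ys r] i by (simp add: mult.assoc)
qed simp

lemma e_span_right: "z \<in> e_span \<Longrightarrow> set is \<subseteq> X \<Longrightarrow> z * gl is \<in> e_span"
proof (erule sp_right)
  fix y assume i: "set is \<subseteq> X" and "y \<in> {gl xs * e_gen r * gl ys | xs r ys. set xs \<subseteq> X \<and> set ys \<subseteq> X \<and> r \<le> n}"
  then obtain xs r ys where "y = gl xs * e_gen r * gl ys" "set xs \<subseteq> X" "set ys \<subseteq> X" "r \<le> n" by blast
  then show "y * gl is \<in> e_span" using e_span_base[of xs "ys @ is" r] i by (simp add: mult.assoc)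
qed simp

lemma e_span_hecke: "x \<in> hecke_span \<Longrightarrow> z \<in> e_span \<Longrightarrow> x * z \<in> e_span"
  by (erule sp_right) (blast intro: sp_carr e_span_g)+

lemma e_span_e: "r \<le> n \<Longrightarrow> e_gen r \<in> e_span"
  using e_span_base[of "[]" "[]" r] by simp

text \<open>Both main cases rest on \<open>e_descending\<close>. If \<open>k \<le> r\<close>, the
  missing idempotent is split off from e_(r), which absorbs smaller ones. If \<open>r < k\<close>,
  the letters above \<open>r\<close> are moved to the right of e_(r).\<close>

lemma e_1_gl_e:
  assumes k: "1 \<le> k" "k \<le> n" and r: "r \<le> n"
  shows "e_gen 1 * (gl [1..<k] * e_gen r) \<in> e_span"
proof (cases "r = 0")
  case True
  have "e_gen 1 * (gl [1..<k] * e_gen r) = gl [] * e_gen 1 * gl [1..<k]"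
    using True by (simp add: e_gen_def)
  then show ?thesis using e_span_base[of "[]" "[1..<k]" 1] k by simp
next
  case False
  have cc: "e_gen 1 \<in> carr" "e_gen r \<in> carr" using k r by auto
  consider "k = 1" | m where "k = Suc m" "1 \<le> m" "k \<le> r" | "r < k"
    using k by (cases k) (auto simp: not_less, metis not_less_eq_eq le0 le_neq_implies_less less_Suc0 linorder_not_less)
  then show ?thesis
  proof cases
    case 1
    have "e_gen 1 * (gl [1..<k] * e_gen r) \<approx> e_gen r"
      using 1 e_absorb[of 1 r] False r by simp
    then show ?thesis by (rule sp_cong') (use e_span_e r in simp)
  next
    case (2 m)
    then obtain c x where x: "x \<in> hecke_span" "e_gen 1 * gl [1..<Suc m] * e_gen m \<approx> const c * e_gen (Suc m) + x * e_gen m"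
      using e_descending[of m] k by auto
    have m: "e_gen m * e_gen r \<approx> e_gen r" "e_gen k * e_gen r \<approx> e_gen r"
      using 2 r by (auto intro!: e_absorb)
    have g: "gl [1..<k] \<in> carr" using k by (intro gl_carr) auto
    have "e_gen 1 * (gl [1..<k] * e_gen r) \<approx> e_gen 1 * (gl [1..<k] * (e_gen m * e_gen r))"
      by (intro eqv_left eqv_sym[OF m(1)] cc g)
    also have "\<dots> = (e_gen 1 * gl [1..<Suc m] * e_gen m) * e_gen r"
      using 2 by (simp only: mult.assoc)
    also have "\<dots> \<approx> (const c * e_gen (Suc m) + x * e_gen m) * e_gen r"
      by (intro eqv_right x cc)
    also have "\<dots> = const c * (e_gen k * e_gen r) + x * (e_gen m * e_gen r)"
      using 2 by (simp only: distrib_right mult.assoc)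
    also have "\<dots> \<approx> const c * e_gen r + x * e_gen r"
      by (intro eqv_add eqv_const eqv_left m sp_carr[OF x(1)])
    finally show ?thesis
      by (rule sp_cong') (intro sp.add sp.scale e_span_hecke e_span_e x r)
  next
    case 3
    then obtain c x where x: "x \<in> hecke_span" "e_gen 1 * gl [1..<Suc r] * e_gen r \<approx> const c * e_gen (Suc r) + x * e_gen r"
      using e_descending[of r] k False by auto
    have split: "[1..<k] = [1..<Suc r] @ [Suc r..<k]"
      using 3 upt_add_eq_append[of 1 "Suc r" "k - Suc r"] by simp
    have g: "gl [1..<Suc r] \<in> carr" "gl [Suc r..<k] \<in> carr" using 3 k by (auto intro!: gl_carr simp del: upt_Suc)
    have "e_gen 1 * (gl [1..<k] * e_gen r) = (e_gen 1 * gl [1..<Suc r]) * (gl [Suc r..<k] * e_gen r)"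
      unfolding split gl_simps by (simp only: mult.assoc)
    also have "\<dots> \<approx> (e_gen 1 * gl [1..<Suc r]) * (e_gen r * gl [Suc r..<k])"
      by (intro eqv_left gl_e_comm) (use cc g k r in auto)
    also have "\<dots> = (e_gen 1 * gl [1..<Suc r] * e_gen r) * gl [Suc r..<k]"
      by (simp only: mult.assoc)
    also have "\<dots> \<approx> (const c * e_gen (Suc r) + x * e_gen r) * gl [Suc r..<k]"
      by (intro eqv_right x g)
    finally show ?thesis
      by (rule sp_cong') (intro e_span_right sp.add sp.scale e_span_hecke e_span_e x r; use 3 k in auto)
  qed
qed

text \<open>Lets e_(1) pass the first factor in \<open>gl_tail_coset\<close>, which leaves only
  products of the kind treated in \<open>e_1_gl_e\<close>.\<close>

lemma e_1_gl: "1 \<le> n \<Longrightarrow> set is \<subseteq> {2..<n} \<Longrightarrow> e_gen 1 * gl is \<approx> gl is * e_gen 1"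
  using eqv_sym[OF gl_e_comm[of 1 "is"]] by (simp add: numeral_2_eq_2)

lemma e_span_e_1: "1 \<le> n \<Longrightarrow> z \<in> e_span \<Longrightarrow> e_gen 1 * z \<in> e_span"
proof (erule sp_left)
  assume n: "1 \<le> n"
  then show e: "e_gen 1 \<in> carr" by simp
  fix y assume "y \<in> {gl xs * e_gen r * gl ys | xs r ys. set xs \<subseteq> X \<and> set ys \<subseteq> X \<and> r \<le> n}"
  then obtain xs r ys where y: "y = gl xs * e_gen r * gl ys" "set xs \<subseteq> X" "set ys \<subseteq> X" "r \<le> n" by blast
  define h where "h z = e_gen 1 * (z * e_gen r)" for z
  have "h (gl xs) \<in> e_span"
    using gl_tail_coset[OF y(2) n]
  proof (rule sp_map[rotated -1])
    fix w assume "w \<in> {gl as * gl [1..<k] | as k. set as \<subseteq> {2..<n} \<and> 1 \<le> k \<and> k \<le> n}"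
    then obtain as k where w: "w = gl as * gl [1..<k]" "set as \<subseteq> {2..<n}" "1 \<le> k" "k \<le> n" by blast
    have c: "gl [1..<k] * e_gen r \<in> carr" using w y by (auto intro!: mult_in_carrier gl_carr)
    have "h w = e_gen 1 * gl as * (gl [1..<k] * e_gen r)" by (simp add: h_def w mult.assoc)
    also have "\<dots> \<approx> gl as * e_gen 1 * (gl [1..<k] * e_gen r)"
      by (intro eqv_right e_1_gl w c n)
    also have "\<dots> = gl as * (e_gen 1 * (gl [1..<k] * e_gen r))" by (simp only: mult.assoc)
    finally show "h w \<in> e_span"
      by (rule sp_cong') (intro e_span_g e_1_gl_e w y; use w in force)
  qed (use e y in \<open>auto simp: h_def distrib_left distrib_right const_left mult.assoc intro!: eqv_left eqv_right\<close>)
  from e_span_right[OF this y(3)] show "e_gen 1 * y \<in> e_span"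
    by (simp add: h_def y(1) mult.assoc)
qed

text \<open>Multiplication by e_(1) and by Hecke words suffices: the recursion expresses e_(r+1)
  through e_(r) and g_r.\<close>

lemma e_span_e_left: "r \<le> n \<Longrightarrow> z \<in> e_span \<Longrightarrow> e_gen r * z \<in> e_span"
proof (induction r arbitrary: z)
  case 0
  then show ?case by (simp add: e_gen_def)
next
  case (Suc r)
  show ?case
  proof (cases "r = 0")
    case True
    then show ?thesis using e_span_e_1 Suc.prems by simp
  next
    case False
    let ?C = "const (eta s * (qvar - coefficient s)) :: free_elem" and ?H = "const (eta s) :: free_elem"
    have z: "z \<in> carr" using Suc.prems sp_carr by blast
    have "e_gen (Suc r) * z \<approx> (?C * e_gen r - ?H * (e_gen r * g_gen r * e_gen r)) * z"
      by (intro eqv_right e_rec z) (use False Suc.prems in auto)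
    also have "\<dots> = ?C * (e_gen r * z) - ?H * (e_gen r * (gl [r] * (e_gen r * z)))"
      by (simp add: left_diff_distrib mult.assoc)
    finally show ?thesis
      by (rule sp_cong') (intro sp_diff sp.scale Suc.IH e_span_g; use Suc.prems False in auto)
  qed
qed

lemma sp_sum: "finite A \<Longrightarrow> (\<And>a. a \<in> A \<Longrightarrow> f a \<in> sp s n S) \<Longrightarrow> (\<Sum>a\<in>A. f a) \<in> sp s n S"
  by (induction A rule: finite_induct) (auto intro: sp.zero sp.add)

lemma e_span_monomial: "set v \<subseteq> generators n \<Longrightarrow> Poly_Mapping.single (Word v) 1 \<in> e_span"
proof (induction v)
  case Nil
  have "Word [] = (0 :: generator free_monoid)" by (simp add: zero_free_monoid_def)
  then show ?case using e_span_e[of 0] by (simp add: e_gen_def)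
next
  case (Cons a v)
  let ?v = "Poly_Mapping.single (Word v) 1 :: free_elem"
  have v: "?v \<in> e_span" using Cons by simp
  have split: "Poly_Mapping.single (Word (a # v)) 1 = gen a * ?v"
    by (simp add: mult_single plus_free_monoid_def)
  show ?case
  proof (cases a)
    case (U i)
    then have i: "i \<in> X" using Cons.prems by (auto simp: generators_def)
    have "gen a = const qvar - g_gen i" by (simp add: U g_gen_def u_gen_def)
    then have "gen a * ?v = const qvar * ?v - gl [i] * ?v" by (simp add: left_diff_distrib)
    then show ?thesis unfolding split using sp_diff[OF sp.scale[OF v, of qvar] e_span_g[OF v, of "[i]"]] i by simp
  next
    case (E r)
    then have "r \<le> n" "gen a = e_gen r" using Cons.prems by (auto simp: generators_def e_gen_def)
    then show ?thesis unfolding split using e_span_e_left v by simp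
  qed
qed

lemma e_span_all:
  assumes "x \<in> carr"
  shows "x \<in> e_span"
proof -
  have "(\<Sum>v\<in>Poly_Mapping.keys x. const (Poly_Mapping.lookup x v) * Poly_Mapping.single (Word (letters v)) 1) \<in> e_span"
    by (intro sp_sum sp.scale e_span_monomial) (use assms in \<open>auto simp: carrier_free_algebra\<close>)
  moreover have "(\<Sum>v\<in>Poly_Mapping.keys x. const (Poly_Mapping.lookup x v) * Poly_Mapping.single (Word (letters v)) 1) = x"
    by (rule poly_mapping_eqI) (auto simp: lookup_sum lookup_single when_def in_keys_iff mult_single)
  ultimately show ?thesis by simp
qed


section \<open>Reduction to normal words\<close>

lemma gl_reduced:
  assumes "asc is" "asc js" "set is \<subseteq> X" "set js \<subseteq> X" "perm_of is = perm_of js"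
  shows "gl is \<approx> gl js"
proof (rule class_eqv)
  have "Calg_class s n (gl (is @ [])) = Calg_class s n (gl (js @ []))"
  proof (rule matsumoto[where F = "\<lambda>is. Calg_class s n (gl is)" and n = n])
    fix xs ys :: "nat list" and i j
    assume a: "set xs \<subseteq> X" "set ys \<subseteq> X" "i \<in> X" "j \<in> X" "Suc i < j"
    have "gl xs * (g_gen i * g_gen j) * gl ys \<approx> gl xs * (g_gen j * g_gen i) * gl ys"
      by (intro eqv_mid g_comm gl_carr) (use a in auto)
    then show "Calg_class s n (gl (xs @ i # j # ys)) = Calg_class s n (gl (xs @ j # i # ys))"
      by (intro eqv_class) (simp add: mult.assoc)
  next
    fix xs ys :: "nat list" and i
    assume a: "set xs \<subseteq> X" "set ys \<subseteq> X" "i \<in> X" "Suc i \<in> X"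
    have "gl xs * (g_gen i * g_gen (Suc i) * g_gen i) * gl ys \<approx> gl xs * (g_gen (Suc i) * g_gen i * g_gen (Suc i)) * gl ys"
      by (intro eqv_mid g_braid gl_carr) (use a in auto)
    then show "Calg_class s n (gl (xs @ i # Suc i # i # ys)) = Calg_class s n (gl (xs @ Suc i # i # Suc i # ys))"
      by (intro eqv_class) (simp add: mult.assoc)
  qed (use assms in auto)
  then show "Calg_class s n (gl is) = Calg_class s n (gl js)" by simp
qed (use assms in \<open>auto intro!: gl_carr\<close>)

lemma gl_span_reduced: "set xs \<subseteq> X \<Longrightarrow> gl xs \<in> sp s n {gl is | is. asc is \<and> set is \<subseteq> X}"
proof (induction xs rule: rev_induct)
  case Nil
  have "gl [] \<in> {gl is | is. asc is \<and> set is \<subseteq> X}"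
    by (intro CollectI exI[of _ "[]"]) (simp add: asc.Nil)
  then show ?case by (rule sp.base) simp
next
  case (snoc i xs)
  let ?S = "{gl is | is. asc is \<and> set is \<subseteq> X}"
  have i: "i \<in> X" using snoc.prems by auto
  have S: "gl is \<in> sp s n ?S" if "asc is" "set is \<subseteq> X" for "is"
    by (rule sp.base) (use that in \<open>auto intro!: gl_carr\<close>)
  have "gl xs * g_gen i \<in> sp s n ?S"
  proof (rule sp_right)
    show "gl xs \<in> sp s n ?S" using snoc by simp
    show "g_gen i \<in> carr" using i by simp
    fix y assume "y \<in> ?S"
    then obtain "is" where y: "y = gl is" "asc is" "set is \<subseteq> X" by blast
    show "y * g_gen i \<in> sp s n ?S"
    proof (cases "perm_of is i < perm_of is (Suc i)")
      case True
      then show ?thesis using S[of "is @ [i]"] y i by (simp add: asc_snoc_iff)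
    next
      case False
      have "perm_of is i \<noteq> perm_of is (Suc i)" by simp
      with False have lt: "perm_of is (Suc i) < perm_of is i" by linarith
      have "perm_of (is @ [i]) permutes {1..n}"
        using y i by (intro perm_of_permutes) auto
      \<comment> \<open>By the independence of reduced words, \<open>is\<close> may be replaced by a
        word ending in \<open>i\<close>; the quadratic relation then removes the square.\<close>
      then obtain js where js: "asc js" "set js \<subseteq> {1..<n}" "perm_of js = perm_of (is @ [i])"
        using asc_word_exists by blast
      have "asc (js @ [i])"
        using js lt by (simp add: asc_snoc_iff perm_of_append)
      moreover have "perm_of is = perm_of (js @ [i])"
        by (simp add: perm_of_append js(3) comp_assoc)
      ultimately have "gl is \<approx> gl (js @ [i])"
        using y js i by (intro gl_reduced) auto
      then have "y * g_gen i \<approx> gl js * g_gen i * g_gen i"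
        unfolding y(1) using eqv_right[of "gl is" "gl js * g_gen i" "g_gen i"] i by simp
      also have "\<dots> \<approx> gl js * (const (qvar - 1 / qvar) * g_gen i + 1)"
        unfolding mult.assoc by (intro eqv_left g_quad gl_carr i js)
      also have "\<dots> = const (qvar - 1 / qvar) * gl (js @ [i]) + gl js"
        by (simp add: distrib_left const_left)
      finally show ?thesis
        by (rule sp_cong') (use S[of "js @ [i]"] S[of js] \<open>asc (js @ [i])\<close> js i in \<open>auto intro!: sp.add sp.scale\<close>)
    qed
  qed
  then show ?case by simp
qed

lemma gl_rev_span_reduced: 
  assumes "set xs \<subseteq> X"
  shows "gl xs \<in> sp s n {gl (rev is) | is. asc is \<and> set is \<subseteq> X}"
  using gl_span_reduced[OF assms]
proof (rule sp_mono, safe)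
  fix "is" assume "asc is" "set is \<subseteq> X"
  then show "\<exists>js. gl is = gl (rev js) \<and> asc js \<and> set js \<subseteq> X"
    by (intro exI[of _ "rev is"]) (simp add: asc_rev)
qed

lemma absorb_left:
  assumes "r \<le> n" "set xs \<subseteq> {1..<r}"
  shows "gl xs * e_gen r \<in> sp s n {gl b * e_gen r | b. b \<in> bw r}"
proof -
  have "foldr (\<lambda>i. (*) (g_gen i)) xs (e_gen r) \<in> sp s n {foldr (\<lambda>i. (*) (g_gen i)) b (e_gen r) | b. b \<in> bw r}"
    by (rule hecke_action.acts_absorb[OF left_action, where R = r and h = "eta s"])
      (use assms absorb(1) in auto)
  then show ?thesis by (simp only: foldr_left)
qed

lemma absorb_right:
  assumes "r \<le> n" "set xs \<subseteq> {1..<r}"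
  shows "e_gen r * gl (rev xs) \<in> sp s n {e_gen r * gl (rev b) | b. b \<in> bw r}"
proof -
  have "foldr (\<lambda>i x. x * g_gen (id i)) xs (e_gen r) \<in> sp s n {foldr (\<lambda>i x. x * g_gen (id i)) b (e_gen r) | b. b \<in> bw r}"
    unfolding id_apply
    by (rule hecke_action.acts_absorb[OF right_action, where R = r and h = "eta s"])
      (use assms absorb(2) in auto)
  then show ?thesis by (simp only: foldr_right list.map_id)
qed

definition normal_words :: "(nat \<times> nat list \<times> nat list \<times> nat list \<times> nat list) set"
  where "normal_words = {(r, c, b, b', d). r \<le> n \<and> b \<in> bw r \<and> b' \<in> bw r
    \<and> asc c \<and> set c \<subseteq> X \<and> perm_of c \<in> shortest_left_coset_elements n {v. v permutes {1..r}}
    \<and> asc d \<and> set d \<subseteq> X \<and> perm_of d \<in> shortest_left_coset_elements n (young n r)}"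

fun monomial :: "nat \<times> nat list \<times> nat list \<times> nat list \<times> nat list \<Rightarrow> free_elem"
  where "monomial (r, c, b, b', d) = gl c * gl b * e_gen r * gl (rev b') * gl (rev d)"

abbreviation monomial_span where "monomial_span \<equiv> sp s n (monomial ` normal_words)"

text \<open>A reduced word of w v, with w shortest in its coset and v in S_r, is congruent to the
  concatenation of reduced words of both; the part in S_r stands next to e_(r) and is
  absorbed.\<close>

lemma left_normal:
  assumes r: "r \<le> n" and xs: "set xs \<subseteq> X"
  shows "gl xs * e_gen r \<in> sp s n {gl c * gl b * e_gen r | c b. b \<in> bw r \<and>
    asc c \<and> set c \<subseteq> X \<and> perm_of c \<in> shortest_left_coset_elements n {v. v permutes {1..r}}}"
    (is "_ \<in> sp s n ?S")
  using gl_span_reduced[OF xs]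
proof (rule sp_right)
  show "e_gen r \<in> carr" using r by simp
  fix y assume "y \<in> {gl is | is. asc is \<and> set is \<subseteq> X}"
  then obtain "is" where y: "y = gl is" "asc is" "set is \<subseteq> X" by blast
  have p: "perm_of is permutes {1..n}" by (rule perm_of_permutes[OF y(3)])
  obtain w v where wv: "w \<in> shortest_left_coset_elements n {v. v permutes {1..r}}" "v permutes {1..r}" "perm_of is = w \<circ> v"
    using coset_decomposition[OF p sym_group(1-3) sym_group(4)[OF r]] by blast
  have "w permutes {1..n}" using wv(1) by (simp add: shortest_left_coset_elements_def)
  then obtain c where c: "asc c" "set c \<subseteq> X" "perm_of c = w" using asc_word_exists by blast
  obtain b where b: "asc b" "set b \<subseteq> {1..<r}" "perm_of b = v" using asc_word_exists[OF wv(2)] by blast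
  have "asc (c @ b)"
    by (rule asc_append[OF c(1) _ b(1,2)]) (use shortest_sym_increasing[OF wv(1) r] c in auto)
  moreover have bX: "set b \<subseteq> X" using b r by auto
  ultimately have "gl is \<approx> gl (c @ b)"
    using y c b wv by (intro gl_reduced) (auto simp: perm_of_append)
  then have "y * e_gen r \<approx> gl c * (gl b * e_gen r)"
    using eqv_right[of "gl is" "gl (c @ b)" "e_gen r"] y r by (simp add: mult.assoc)
  moreover have "gl c * (gl b * e_gen r) \<in> sp s n ?S"
    using absorb_left[OF r b(2)]
  proof (rule sp_left)
    show "gl c \<in> carr" using c by simp
    fix z assume z: "z \<in> {gl b * e_gen r | b. b \<in> bw r}" "z \<in> carr"
    then obtain b where "z = gl b * e_gen r" "b \<in> bw r" by blast
    then have "gl c * z \<in> ?S" using c wv(1) by (simp only: mult.assoc[symmetric]) blast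
    then show "gl c * z \<in> sp s n ?S" by (rule sp.base) (use c z in simp)
  qed
  ultimately show "y * e_gen r \<in> sp s n ?S" by (rule sp_cong')
qed

text \<open>Here words are reversed, so that left cosets serve on the right side. The factor from
  S_(n-r) commutes with e_(r) and crosses to the left. This is why the right representatives are
  taken modulo S_r x S_(n-r), but the left ones only modulo S_r.\<close>

lemma right_normal:
  assumes r: "r \<le> n" and ys: "set ys \<subseteq> X"
  shows "e_gen r * gl ys \<in> sp s n {gl xs * e_gen r * gl (rev b) * gl (rev d) | xs b d. set xs \<subseteq> X \<and> b \<in> bw r \<and>
    asc d \<and> set d \<subseteq> X \<and> perm_of d \<in> shortest_left_coset_elements n (young n r)}"
    (is "_ \<in> sp s n ?S")
  using gl_rev_span_reduced[OF ys]
proof (rule sp_left)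
  show "e_gen r \<in> carr" using r by simp
  fix y assume "y \<in> {gl (rev is) | is. asc is \<and> set is \<subseteq> X}"
  then obtain "is" where y: "y = gl (rev is)" "asc is" "set is \<subseteq> X" by blast
  have p: "perm_of is permutes {1..n}" by (rule perm_of_permutes[OF y(3)])
  obtain w u where wu: "w \<in> shortest_left_coset_elements n (young n r)" "u \<in> young n r" "perm_of is = w \<circ> u"
    using coset_decomposition[OF p young_group[OF r]] by blast
  obtain v v' where v: "u = v \<circ> v'" "v permutes {1..r}" "v' permutes {r + 1..n}"
    using wu(2) by (auto simp: young_def)
  have "w permutes {1..n}" using wu(1) by (simp add: shortest_left_coset_elements_def)
  then obtain d where d: "asc d" "set d \<subseteq> X" "perm_of d = w" using asc_word_exists by blast
  obtain b where b: "asc b" "set b \<subseteq> {1..<r}" "perm_of b = v" using asc_word_exists[OF v(2)] by blast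
  obtain b' where b': "asc b'" "set b' \<subseteq> {r + 1..<n}" "perm_of b' = v'" using asc_word_exists[OF v(3)] by blast
  have 1: "asc (d @ b)"
    by (rule asc_append[OF d(1) _ b(1,2)]) (use shortest_young_increasing(1)[OF wu(1) r] d in auto)
  have "v x = x" if "r + 1 \<le> x" for x using v(2) that by (simp add: permutes_not_in)
  then have "asc ((d @ b) @ b')"
    by (intro asc_append[OF 1 _ b'(1,2)])
      (use shortest_young_increasing(2)[OF wu(1) r] d b in \<open>auto simp: perm_of_append\<close>)
  then have "asc (rev ((d @ b) @ b'))" by (rule asc_rev)
  moreover have X: "set b \<subseteq> X" "set b' \<subseteq> X" using b b' r by auto
  moreover have "perm_of (rev is) = perm_of (rev ((d @ b) @ b'))"
  proof (rule ext)
    fix x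
    have "perm_of is = perm_of ((d @ b) @ b')"
      using wu(3) v(1) d b b' by (simp add: perm_of_append comp_assoc)
    then show "perm_of (rev is) x = perm_of (rev ((d @ b) @ b')) x"
      by (metis perm_of_rev_apply perm_of_eq_iff rev_rev_ident)
  qed
  ultimately have "gl (rev is) \<approx> gl (rev ((d @ b) @ b'))"
    using y d by (intro gl_reduced[OF asc_rev[OF y(2)]]) auto
  then have "e_gen r * y \<approx> e_gen r * (gl (rev b') * gl (rev b) * gl (rev d))"
    unfolding y(1) using r eqv_left by (simp add: mult.assoc)
  also have "\<dots> = e_gen r * gl (rev b') * (gl (rev b) * gl (rev d))" by (simp only: mult.assoc)
  also have "\<dots> \<approx> gl (rev b') * e_gen r * (gl (rev b) * gl (rev d))"
    by (intro eqv_right eqv_sym[OF gl_e_comm] r) (use X b' d in auto)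
  also have "\<dots> = gl (rev b') * (e_gen r * gl (rev b)) * gl (rev d)" by (simp only: mult.assoc)
  finally have "e_gen r * y \<approx> gl (rev b') * (e_gen r * gl (rev b)) * gl (rev d)" .
  moreover have "gl (rev b') * (e_gen r * gl (rev b)) * gl (rev d) \<in> sp s n ?S"
    using absorb_right[OF r b(2)]
  proof (rule sp_map[rotated -1, where h = "\<lambda>z. gl (rev b') * z * gl (rev d)"])
    fix z assume z: "z \<in> {e_gen r * gl (rev b) | b. b \<in> bw r}" "z \<in> carr"
    then obtain b where "z = e_gen r * gl (rev b)" "b \<in> bw r" by blast
    then have "gl (rev b') * z * gl (rev d) = gl (rev b') * e_gen r * gl (rev b) * gl (rev d)" "b \<in> bw r"
      by (simp_all only: mult.assoc)
    moreover have "set (rev b') \<subseteq> X" using X by simp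
    ultimately have "gl (rev b') * z * gl (rev d) \<in> ?S" using d wu(1) by blast
    then show "gl (rev b') * z * gl (rev d) \<in> sp s n ?S"
      by (rule sp.base) (use X d z in simp)
  qed (use X d in \<open>auto simp: distrib_left distrib_right const_left mult.assoc intro!: eqv_mult\<close>)
  ultimately show "e_gen r * y \<in> sp s n ?S" by (rule sp_cong')
qed

text \<open>The right side has to be normalised before the left, as it releases a Hecke word to the
  left of e_(r).\<close>

lemma carr_monomial_span:
  assumes "x \<in> carr"
  shows "x \<in> monomial_span"
proof (rule sp_trans[OF e_span_all[OF assms]])
  fix y assume "y \<in> {gl xs * e_gen r * gl ys | xs r ys. set xs \<subseteq> X \<and> set ys \<subseteq> X \<and> r \<le> n}"
  then obtain xs r ys where y: "y = gl xs * (e_gen r * gl ys)" "set xs \<subseteq> X" "set ys \<subseteq> X" "r \<le> n"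
    by (auto simp: mult.assoc)
  show "y \<in> monomial_span"
    unfolding y(1) using right_normal[OF y(4,3)]
  proof (rule sp_left)
    show "gl xs \<in> carr" using y by simp
    fix z assume "z \<in> {gl xs * e_gen r * gl (rev b) * gl (rev d) | xs b d. set xs \<subseteq> X \<and> b \<in> bw r \<and>
      asc d \<and> set d \<subseteq> X \<and> perm_of d \<in> shortest_left_coset_elements n (young n r)}"
    then obtain as b' d where z: "z = gl as * e_gen r * gl (rev b') * gl (rev d)" "set as \<subseteq> X" "b' \<in> bw r"
      and d: "asc d" "set d \<subseteq> X" "perm_of d \<in> shortest_left_coset_elements n (young n r)" by blast
    have b'X: "set (rev b') \<subseteq> X" "set (rev d) \<subseteq> X" using bw_letters[OF z(3)] y d by auto
    define h where "h = gl (rev b') * gl (rev d)"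
    have hc: "h \<in> carr" unfolding h_def using gl_carr[OF b'X(1)] gl_carr[OF b'X(2)] by simp
    have "gl (xs @ as) * e_gen r * h \<in> monomial_span"
    proof (rule sp_right[OF left_normal[OF y(4)] hc])
      show "set (xs @ as) \<subseteq> X" using y z by simp
      fix w assume w: "w \<in> carr" "w \<in> {gl c * gl b * e_gen r | c b. b \<in> bw r \<and>
        asc c \<and> set c \<subseteq> X \<and> perm_of c \<in> shortest_left_coset_elements n {v. v permutes {1..r}}}"
      then obtain c b where c: "w = gl c * gl b * e_gen r" "b \<in> bw r" "asc c" "set c \<subseteq> X"
        "perm_of c \<in> shortest_left_coset_elements n {v. v permutes {1..r}}" by blast
      have "w * h = monomial (r, c, b, b', d)"
        by (simp add: c(1) h_def mult.assoc)
      moreover have "(r, c, b, b', d) \<in> normal_words"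
        using c z d y by (simp add: normal_words_def)
      ultimately have "w * h \<in> monomial ` normal_words" by (simp only: image_eqI)
      then show "w * h \<in> monomial_span" by (rule sp.base) (use w hc in simp)
    qed
    then show "gl xs * z \<in> monomial_span" by (simp add: z(1) h_def mult.assoc)
  qed
qed

end

section \<open>Basis and dimension\<close>

lemma card_bw: "finite (bw r) \<and> card (bw r) \<le> h_num r"
proof (induction r rule: bw.induct)
  case (3 r)
  have "card (\<Union>j\<in>{1..Suc r}. (@) [j..<Suc (Suc r)] ` bw r) \<le> (\<Sum>j\<in>{1..Suc r}. card ((@) [j..<Suc (Suc r)] ` bw r))"
    by (rule card_UN_le) simp
  also have "\<dots> \<le> (\<Sum>j\<in>{1..Suc r}. h_num r)"
    using 3 by (intro sum_mono) (meson card_image_le le_trans)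
  finally show ?case
    using 3 card_Un_le[of "bw (Suc r)" "\<Union>j\<in>{1..Suc r}. (@) [j..<Suc (Suc r)] ` bw r"]
    by (simp del: upt_Suc)
qed simp_all

lemma pvar_qvar:
  "pvar \<noteq> 0" "pvar \<noteq> 1" "pvar \<noteq> - 1" "qvar \<noteq> 0" "qvar * qvar \<noteq> 1"
  by (simp_all add: pvar_def qvar_def Zero_fract_def One_fract_def eq_fract one_pCons)

text \<open>If q equals the coefficient, clearing the denominator gives p q = p / q in both
  variants, hence q^2 = 1.\<close>

lemma tpar_nonzero: "tpar s \<noteq> 0"
proof
  assume "tpar s = 0"
  then have q: "qvar = coefficient s" by (cases s) (simp_all add: tpar_def)
  have p: "pvar - 1 \<noteq> 0" "pvar + 1 \<noteq> 0"
    using pvar_qvar by (simp_all add: eq_neg_iff_add_eq_0)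
  have "pvar * qvar = pvar / qvar"
  proof (cases s)
    case Plus
    with q p(1) have "qvar * (pvar - 1) = pvar / qvar - qvar" by (simp add: eq_divide_eq)
    then show ?thesis by (simp add: algebra_simps)
  next
    case Minus
    with q p(2) have "qvar * (pvar + 1) = pvar / qvar + qvar" by (simp add: eq_divide_eq)
    then show ?thesis by (simp add: algebra_simps)
  qed
  then have "pvar * (qvar * qvar) = pvar * 1" using pvar_qvar(4) by (simp add: eq_divide_eq mult.assoc)
  then show False using pvar_qvar by simp
qed

section \<open>The quotient algebra and its spanning set\<close>

context presentation
begin

interpretation I: ideal "relation_ideal (generators n) (relations s n)" "free_algebra (generators n)"
  by (rule ideal_relation_ideal[OF relations_in_carrier])

interpretation V: vectorspace class_ring "Calg s n"
  by (rule vectorspace_Calg)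

interpretation Q: ring "Calg s n"
  by (rule ring_Calg)

abbreviation cl where "cl \<equiv> Calg_class s n"

lemma Calg_carrier: "carrier (Calg s n) = cl ` carr"
  by (auto simp: Calg_def presented_algebra_simps FactRing_def A_RCOSETS_def' Calg_class_def)

lemma class_closed [simp]: "x \<in> carr \<Longrightarrow> cl x \<in> carrier (Calg s n)"
  by (simp add: Calg_carrier)

lemma class_mult: "x \<in> carr \<Longrightarrow> y \<in> carr \<Longrightarrow> cl x \<otimes>\<^bsub>Calg s n\<^esub> cl y = cl (x * y)"
  using I.rcoset_mult_add[of x y]
  by (simp add: Calg_def presented_algebra_simps FactRing_def Calg_class_def)

lemma class_add: "x \<in> carr \<Longrightarrow> y \<in> carr \<Longrightarrow> cl x \<oplus>\<^bsub>Calg s n\<^esub> cl y = cl (x + y)"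
  using I.a_rcos_sum[of x y]
  by (simp add: Calg_def presented_algebra_simps FactRing_def Calg_class_def)

lemma class_smult: "x \<in> carr \<Longrightarrow> c \<odot>\<^bsub>Calg s n\<^esub> cl x = cl (const c * x)"
  unfolding Calg_def Calg_class_def by (rule smult_presented_algebra[OF relations_in_carrier])

lemma class_one: "\<one>\<^bsub>Calg s n\<^esub> = cl 1"
  by (simp add: Calg_def presented_algebra_simps FactRing_def Calg_class_def)

lemma class_zero: "cl 0 = \<zero>\<^bsub>Calg s n\<^esub>"
proof -
  have "cl 0 = 0 \<odot>\<^bsub>Calg s n\<^esub> cl 0" using class_smult[of 0 0] by simp
  also have "\<dots> = \<zero>\<^bsub>Calg s n\<^esub>" using V.lmult_0[of "cl 0"] by simp
  finally show ?thesis .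
qed

lemma sum_carr: "finite W \<Longrightarrow> (\<And>w. w \<in> W \<Longrightarrow> x w \<in> carr) \<Longrightarrow> (\<Sum>w\<in>W. x w) \<in> carr"
  by (induction W rule: finite_induct) auto

lemma class_lincomb:
  assumes "finite W" "inj_on (\<lambda>w. cl (x w)) W" "\<And>w. w \<in> W \<Longrightarrow> x w \<in> carr"
  shows "V.lincomb a ((\<lambda>w. cl (x w)) ` W) = cl (\<Sum>w\<in>W. const (a (cl (x w))) * x w)"
  using assms
proof (induction W rule: finite_induct)
  case empty
  then show ?case by (simp add: V.lincomb_def class_zero)
next
  case (insert w W)
  have c: "x v \<in> carr" if "v \<in> insert w W" for v using insert.prems(2) that .
  have "V.lincomb a ((\<lambda>w. cl (x w)) ` insert w W)
      = a (cl (x w)) \<odot>\<^bsub>Calg s n\<^esub> cl (x w) \<oplus>\<^bsub>Calg s n\<^esub> V.lincomb a ((\<lambda>w. cl (x w)) ` W)"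
    unfolding V.lincomb_def image_insert
  proof (rule V.finsum_insert)
    show "cl (x w) \<notin> (\<lambda>w. cl (x w)) ` W"
      using insert.prems(1) insert.hyps by (auto simp: inj_on_def)
  qed (use insert.hyps c in \<open>auto simp: class_smult\<close>)
  also have "\<dots> = cl (\<Sum>w\<in>insert w W. const (a (cl (x w))) * x w)"
    using insert c by (simp add: class_smult class_add sum_carr)
  finally show ?case .
qed

lemma g_prod_eq: "set is \<subseteq> X \<Longrightarrow> g_prod s n is = cl (gl is)"
proof (induction "is")
  case Nil
  show ?case by (simp add: g_prod_def class_one)
next
  case (Cons i "is")
  then have "g_prod s n (i # is) = cl (g_gen i) \<otimes>\<^bsub>Calg s n\<^esub> cl (gl is)"
    by (simp add: g_prod_def)
  also have "\<dots> = cl (gl (i # is))" using Cons.prems by (simp add: class_mult)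
  finally show ?case .
qed

lemma h_elem_eq:
  assumes "asc is" "set is \<subseteq> X"
  shows "h_elem s n (perm_of is) = cl (gl is)"
proof -
  define js where "js = (SOME js. is_reduced_expression n js (perm_of is))"
  have "is_reduced_expression n is (perm_of is)"
    using assms by (simp add: is_reduced_expression_iff)
  then have "is_reduced_expression n js (perm_of is)"
    unfolding js_def by (rule someI)
  then have js: "set js \<subseteq> X" "perm_of js = perm_of is" "asc js"
    by (simp_all add: is_reduced_expression_iff)
  then have "cl (gl js) = cl (gl is)"
    using assms by (intro eqv_class gl_reduced) auto
  then show ?thesis
    using js by (simp add: h_elem_def g_prod_eq flip: js_def)
qed

lemma B_set_eq: "r \<le> n \<Longrightarrow> B_set s n r = (\<lambda>b. cl (gl b)) ` bw r"
proof (induction r rule: bw.induct)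
  case (3 r)
  have IH: "B_set s n r = (\<lambda>b. cl (gl b)) ` bw r" "B_set s n (Suc r) = (\<lambda>b. cl (gl b)) ` bw (Suc r)"
    using "3.IH"(1) "3.IH"(2)[of 1] "3.prems" by auto
  have "{g_prod s n [j..<Suc (Suc r)]} <#>\<^bsub>Calg s n\<^esub> B_set s n r
      = (\<lambda>b. cl (gl b)) ` (@) [j..<Suc (Suc r)] ` bw r" if j: "j \<in> {1..Suc r}" for j
  proof -
    let ?w = "[j..<Suc (Suc r)]"
    have w: "set ?w \<subseteq> X" using j 3 by auto
    have "{g_prod s n ?w} <#>\<^bsub>Calg s n\<^esub> B_set s n r = (\<lambda>b. cl (gl ?w) \<otimes>\<^bsub>Calg s n\<^esub> cl (gl b)) ` bw r"
      unfolding set_mult_def IH g_prod_eq[OF w] by blast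
    also have "\<dots> = (\<lambda>b. cl (gl (?w @ b))) ` bw r"
    proof (rule image_cong[OF refl])
      fix b assume "b \<in> bw r"
      then have "set b \<subseteq> X" using bw_letters[of b r] "3.prems" by auto
      then show "cl (gl ?w) \<otimes>\<^bsub>Calg s n\<^esub> cl (gl b) = cl (gl (?w @ b))"
        using gl_carr[OF w] gl_carr[of b] by (simp only: class_mult gl_simps)
    qed
    finally show ?thesis by (simp only: image_image)
  qed
  then show ?case by (simp add: IH image_Un image_UN del: upt_Suc)
qed (simp_all add: class_one)

lemma perm_of_rev_inv: "inv_into UNIV (perm_of b) = perm_of (rev b)"
  by (rule inv_equality) (use perm_of_rev_apply[of "rev b"] in \<open>simp_all add: perm_of_rev_apply\<close>)

lemma transpose_mem:
  assumes "asc b" "set b \<subseteq> X" "cl (gl b) \<in> S"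
  shows "cl (gl (rev b)) \<in> transpose_set s n S"
  unfolding transpose_set_def
proof (intro CollectI exI[of _ "perm_of b"] conjI)
  show "cl (gl (rev b)) = h_elem s n (inv_into UNIV (perm_of b))"
    using h_elem_eq[of "rev b"] assms by (simp add: perm_of_rev_inv asc_rev)
  show "perm_of b permutes {1..n}" by (rule perm_of_permutes) (use assms in simp)
  show "h_elem s n (perm_of b) \<in> S" using assms by (simp add: h_elem_eq)
qed

lemma h_elem_carrier: "w permutes {1..n} \<Longrightarrow> h_elem s n w \<in> carrier (Calg s n)"
proof -
  assume "w permutes {1..n}"
  then obtain "is" where "asc is" "set is \<subseteq> {1..<n}" "perm_of is = w"
    using asc_word_exists by blast
  then show ?thesis using h_elem_eq[of "is"] by simp
qed

lemma shortest_permutes: "w \<in> shortest_left_coset_elements n G \<Longrightarrow> w permutes {1..n}"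
  by (simp add: shortest_left_coset_elements_def)

lemma D_set_eq: "D_set s n r = h_elem s n ` shortest_left_coset_elements n (young n r)"
  by (simp add: D_set_def young_def)

lemma transpose_carrier: "transpose_set s n S \<subseteq> carrier (Calg s n)"
  unfolding transpose_set_def by (auto intro!: h_elem_carrier permutes_inv)

lemma basis_set_carrier: "basis_set s n \<subseteq> carrier (Calg s n)"
proof
  fix y assume "y \<in> basis_set s n"
  then obtain r c b b' d where y: "r \<le> n" "c \<in> C_set s n r" "b \<in> B_set s n r"
      "b' \<in> transpose_set s n (B_set s n r)" "d \<in> transpose_set s n (D_set s n r)"
      "y = tuple_product s n (r, c, b, b', d)"
    unfolding basis_set_eq_image factor_tuples_def by auto
  have "c \<in> carrier (Calg s n)"
    using y(2) by (auto simp: C_set_def intro!: h_elem_carrier shortest_permutes)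
  moreover have "b \<in> carrier (Calg s n)"
  proof -
    obtain z where "z \<in> bw r" "b = cl (gl z)" using y B_set_eq by auto
    moreover from this have "set z \<subseteq> X" using bw_letters[of z r] y(1) by auto
    ultimately show ?thesis by simp
  qed
  moreover have "b' \<in> carrier (Calg s n)" "d \<in> carrier (Calg s n)"
    using y transpose_carrier by blast+
  ultimately show "y \<in> carrier (Calg s n)"
    using y(1,6) by simp
qed

lemma monomial_basis_set:
  assumes "t \<in> normal_words"
  shows "cl (monomial t) \<in> basis_set s n"
proof -
  obtain r c b b' d where t: "t = (r, c, b, b', d)" by (cases t) auto
  note N = assms[unfolded t normal_words_def, simplified]
  have X: "set b \<subseteq> X" "set b' \<subseteq> X" "set c \<subseteq> X" "set d \<subseteq> X"
    using N bw_letters[of b r] bw_letters[of b' r] by auto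
  have asc: "asc b" "asc b'" "asc c" "asc d" using N bw_asc by auto
  have "cl (gl c) \<in> C_set s n r"
    using N h_elem_eq[OF asc(3) X(3)] by (auto simp: C_set_def image_iff)
  moreover have B: "cl (gl b) \<in> B_set s n r" "cl (gl b') \<in> B_set s n r"
    using N by (auto simp: B_set_eq)
  moreover have "cl (gl (rev b')) \<in> transpose_set s n (B_set s n r)"
    by (rule transpose_mem[OF asc(2) X(2) B(2)])
  moreover have "cl (gl (rev d)) \<in> transpose_set s n (D_set s n r)"
    by (rule transpose_mem[OF asc(4) X(4)])
      (use N h_elem_eq[OF asc(4) X(4)] in \<open>auto simp: D_set_eq image_iff\<close>)
  ultimately have "(r, cl (gl c), cl (gl b), cl (gl (rev b')), cl (gl (rev d))) \<in> factor_tuples s n"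
    using N by (simp add: factor_tuples_def)
  moreover have "tuple_product s n (r, cl (gl c), cl (gl b), cl (gl (rev b')), cl (gl (rev d))) = cl (monomial t)"
    using X N gl_carr[of "rev b'"] gl_carr[of "rev d"] by (simp add: t class_mult)
  ultimately show ?thesis
    unfolding basis_set_eq_image by (metis image_eqI)
qed

lemma class_span: "x \<in> monomial_span \<Longrightarrow> cl x \<in> V.span (basis_set s n)"
proof (induction rule: sp.induct)
  interpret S: submodule class_ring "V.span (basis_set s n)" "Calg s n"
    by (rule V.span_is_submodule[OF basis_set_carrier])
  case (base x)
  then show ?case
    using V.in_own_span[OF basis_set_carrier] monomial_basis_set by blast
next
  interpret S: submodule class_ring "V.span (basis_set s n)" "Calg s n"
    by (rule V.span_is_submodule[OF basis_set_carrier])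
  case zero
  have "\<zero>\<^bsub>Calg s n\<^esub> \<in> V.span (basis_set s n)"
    using V.span_is_submodule[OF basis_set_carrier] by (simp add: submodule_def)
  then show ?case by (simp add: class_zero)
next
  case (add x y)
  then show ?case
    using V.span_is_submodule[OF basis_set_carrier] sp_carr[OF add(1)] sp_carr[OF add(2)]
    by (simp add: submodule_def flip: class_add)
next
  case (scale x c)
  then show ?case
    using V.span_is_submodule[OF basis_set_carrier] sp_carr[OF scale(1)]
    by (simp add: submodule_def flip: class_smult)
next
  case (cong x y)
  then show ?case using eqv_class by simp
qed

lemma span_basis_set: "V.gen_set (basis_set s n)"
proof -
  have "carrier (Calg s n) \<subseteq> V.span (basis_set s n)"
    unfolding Calg_carrier using carr_monomial_span class_span by blast
  moreover have "V.span (basis_set s n) \<subseteq> carrier (Calg s n)"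
    using V.span_is_submodule[OF basis_set_carrier] by (simp add: submodule_def)
  ultimately show ?thesis by simp
qed


section \<open>Comparison of the two bounds for the dimension\<close>

lemma evr_eqv:
  assumes "x \<approx> y"
  shows "evr s x = evr s y"
proof -
  have "ev (rep s) (x - y) = 0"
    by (rule ev_relation_ideal[of "relations s n" "generators n"])
      (use assms relations_in_carrier evr_relations in \<open>auto simp: eqv_def\<close>)
  then show ?thesis by (simp add: ev_diff)
qed

text \<open>The word permutes the first row of \<open>parallel n 0\<close>, and the partners of the
  second row record its permutation. This serves to recover \<open>w\<close> from h_w.\<close>

definition word_inv :: "nat list \<Rightarrow> involution"
  where "word_inv is = foldr (\<lambda>i. cj (i - 1)) is (parallel n 0)"

lemma word_inv_simps [simp]: "word_inv [] = parallel n 0" "word_inv (i # is) = cj (i - 1) (word_inv is)"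
  by (simp_all add: word_inv_def)

lemma sw_transp: "Suc (sw j x) = transp (Suc j) (Suc x)"
  by (auto simp: sw_def Transposition.transpose_def)

lemma ap_word_inv: "set is \<subseteq> X \<Longrightarrow> x < n \<Longrightarrow> Suc (ap (word_inv is) (n + x)) = perm_of is (Suc x)"
proof (induction "is")
  case Nil
  then show ?case by (simp add: parallel.rep_eq)
next
  case (Cons i "is")
  then obtain j where j: "i = Suc j" by (cases i) auto
  with Cons.prems have "sw j (n + x) = n + x" by (auto simp: sw_def)
  then show ?case using Cons by (simp add: sw_transp j)
qed

lemma ap_word_inv':
  assumes "set is \<subseteq> X" "1 \<le> y" "y \<le> n"
  shows "1 \<le> perm_of (rev is) y" "perm_of (rev is) y \<le> n"
    "Suc (ap (word_inv is) (y - 1)) = n + perm_of (rev is) y"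
proof -
  have "perm_of (rev is) permutes {1..n}" by (rule perm_of_permutes) (use assms in simp)
  then have "perm_of (rev is) y \<in> {1..n}" using assms permutes_in_image by fastforce
  then show u: "1 \<le> perm_of (rev is) y" "perm_of (rev is) y \<le> n" by simp_all
  let ?u = "perm_of (rev is) y - 1"
  have "Suc (ap (word_inv is) (n + ?u)) = perm_of is (Suc ?u)"
    using u by (intro ap_word_inv[OF assms(1)]) simp
  also have "Suc ?u = perm_of (rev is) y" using u by simp
  also have "perm_of is (perm_of (rev is) y) = y"
    using perm_of_rev_apply[of "rev is" y] by simp
  finally have "ap (word_inv is) (n + ?u) = y - 1" by simp
  then have "ap (word_inv is) (y - 1) = n + ?u" by (metis ap_ap)
  then show "Suc (ap (word_inv is) (y - 1)) = n + perm_of (rev is) y" using u by simp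
qed

text \<open>For a reduced word every conjugation happens at an ascent between two crossing arcs, so
  only one term survives, up to sign. The hypothesis is on \<open>rev is\<close> because the
  induction adds letters at the front.\<close>

lemma evr_gl:
  "asc (rev is) \<Longrightarrow> set is \<subseteq> X \<Longrightarrow> app (evr s (gl is)) f (parallel n 0) = eta s ^ length is * f (word_inv is)"
proof (induction "is" arbitrary: f)
  case Nil
  then show ?case by (simp add: ev_simps)
next
  case (Cons i "is")
  have i: "1 \<le> i" "i < n" "set is \<subseteq> X" using Cons.prems by auto
  have a: "asc (rev is)" "perm_of (rev is) i < perm_of (rev is) (Suc i)"
    using Cons.prems by (simp_all add: asc_snoc_iff)
  obtain j where j: "i = Suc j" using i by (cases i) auto
  let ?w = "word_inv is"
  have "ap ?w j < ap ?w (Suc j)"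
    using ap_word_inv'(3)[OF i(3), of i] ap_word_inv'(3)[OF i(3), of "Suc i"] a(2) i j by simp
  moreover have "n \<le> ap ?w j"
    using ap_word_inv'(3)[OF i(3), of i] ap_word_inv'(1)[OF i(3), of i] i j by simp
  then have "\<not> both_fixed j ?w" "ap ?w j \<noteq> Suc j"
    using i j by (auto simp: both_fixed_def)
  ultimately have h: "hecke (hpar s) j f ?w = f (cj j ?w)"
    by (simp add: hecke_def)
  have "app (evr s (gl (i # is))) f (parallel n 0) = eta s ^ length is * app (sc (eta s) * op_g (hpar s) j) f ?w"
    using Cons.IH[OF a(1) i(3)] by (simp add: ev_mult evr_g j)
  also have "app (sc (eta s) * op_g (hpar s) j) f ?w = eta s * f (cj j ?w)"
    unfolding sc_central[of "eta s"] by (simp add: h)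
  finally show ?case by (simp add: j)
qed

lemma gl_perm_unique:
  assumes "asc is" "asc js" "set is \<subseteq> X" "set js \<subseteq> X" "gl is \<approx> gl js"
  shows "perm_of is = perm_of js"
proof -
  let ?f = "\<lambda>w. if w = word_inv is then 1 else 0 :: cpq"
  have "eta s \<noteq> 0" using eta_square[of s] by auto
  moreover have "eta s ^ length is * ?f (word_inv is) = eta s ^ length js * ?f (word_inv js)"
    using evr_gl[OF asc_rev[OF assms(1)] assms(3), of ?f] evr_gl[OF asc_rev[OF assms(2)] assms(4), of ?f]
      evr_eqv[OF assms(5)] by simp
  ultimately have w: "word_inv js = word_inv is" by (auto split: if_splits)
  show ?thesis
  proof (rule ext)
    fix x
    show "perm_of is x = perm_of js x"
    proof (cases "x \<in> {1..n}")
      case True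
      then obtain y where "x = Suc y" "y < n" by (cases x) auto
      then show ?thesis
        using ap_word_inv[OF assms(3), of y] ap_word_inv[OF assms(4), of y] w by simp
    next
      case False
      then show ?thesis
        using perm_of_permutes[OF assms(3)] perm_of_permutes[OF assms(4)] by (simp add: permutes_not_in)
    qed
  qed
qed

text \<open>\<open>transpose_set\<close> collects the transposes of all \<open>w\<close> with
  \<open>h_elem s n w\<close> in the set; only injectivity bounds its size by that of the
  set.\<close>

lemma h_elem_inj: "inj_on (h_elem s n) {w. w permutes {1..n}}"
proof (rule inj_onI)
  fix w w' assume a: "w \<in> {w. w permutes {1..n}}" "w' \<in> {w. w permutes {1..n}}" "h_elem s n w = h_elem s n w'"
  obtain "is" where i: "asc is" "set is \<subseteq> {1..<n}" "perm_of is = w" using asc_word_exists a(1) by blast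
  obtain js where j: "asc js" "set js \<subseteq> {1..<n}" "perm_of js = w'" using asc_word_exists a(2) by blast
  have "gl is \<approx> gl js"
    using a(3) h_elem_eq[OF i(1,2)] h_elem_eq[OF j(1,2)] i j by (intro class_eqv gl_carr) auto
  then show "w = w'" using gl_perm_unique[OF i(1) j(1) i(2) j(2)] i j by simp
qed

lemma card_transpose:
  assumes "finite S"
  shows "finite (transpose_set s n S) \<and> card (transpose_set s n S) \<le> card S"
proof -
  let ?A = "{w. w permutes {1..n} \<and> h_elem s n w \<in> S}"
  have fin: "finite ?A" by (rule finite_subset[OF _ finite_permutations[of "{1..n}"]]) auto
  have t: "transpose_set s n S = (\<lambda>w. h_elem s n (inv_into UNIV w)) ` ?A"
    by (auto simp: transpose_set_def)
  have "inj_on (h_elem s n) ?A"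
    by (rule inj_on_subset[OF h_elem_inj]) blast
  then have "card ?A \<le> card S"
    by (rule card_inj_on_le) (use assms in auto)
  then show ?thesis unfolding t using fin card_image_le[OF fin] le_trans by blast
qed

lemma card_factor_tuples: "finite (factor_tuples s n) \<and> card (factor_tuples s n) \<le> h_num (n + n)"
proof -
  let ?C = "\<lambda>r. C_set s n r" and ?B = "\<lambda>r. B_set s n r"
  let ?B' = "\<lambda>r. transpose_set s n (B_set s n r)" and ?D = "\<lambda>r. transpose_set s n (D_set s n r)"
  have fin: "finite (shortest_left_coset_elements n G)" for G
    by (rule finite_subset[OF _ finite_permutations[of "{1..n}"]]) (blast dest: shortest_permutes, simp)
  have C: "finite (?C r) \<and> card (?C r) \<le> fact n div fact r" if "r \<le> n" for r
    unfolding C_set_def using card_image_le[OF fin, of "h_elem s n"] card_shortest_sym[OF that] fin le_trans by blast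
  have B: "finite (?B r) \<and> card (?B r) \<le> h_num r" if "r \<le> n" for r
    unfolding B_set_eq[OF that] using card_bw[of r] card_image_le[of "bw r"] le_trans by blast
  have B': "finite (?B' r) \<and> card (?B' r) \<le> h_num r" if "r \<le> n" for r
    using card_transpose[of "?B r"] B[OF that] le_trans by blast
  have "finite (D_set s n r) \<and> card (D_set s n r) \<le> n choose r" if "r \<le> n" for r
    unfolding D_set_eq using card_image_le[OF fin, of "h_elem s n"] card_shortest_young[OF that] fin le_trans by blast
  then have D: "finite (?D r) \<and> card (?D r) \<le> n choose r" if "r \<le> n" for r
    using card_transpose[of "D_set s n r"] that le_trans by blast
  have "card (factor_tuples s n) = (\<Sum>r\<in>{0..n}. card (?C r \<times> ?B r \<times> ?B' r \<times> ?D r))"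
    unfolding factor_tuples_def by (rule card_SigmaI) (use C B B' D in auto)
  also have "\<dots> \<le> (\<Sum>r = 0..n. (h_num r)\<^sup>2 * (fact n div fact r) * (n choose r))"
  proof (rule sum_mono)
    fix r assume "r \<in> {0..n}"
    then have r: "r \<le> n" by simp
    have "card (?C r \<times> ?B r \<times> ?B' r \<times> ?D r) = card (?C r) * (card (?B r) * (card (?B' r) * card (?D r)))"
      by (simp add: card_cartesian_product)
    also have "\<dots> \<le> (fact n div fact r) * (h_num r * (h_num r * (n choose r)))"
      by (intro mult_le_mono) (use C[OF r] B[OF r] B'[OF r] D[OF r] in blast)+
    finally show "card (?C r \<times> ?B r \<times> ?B' r \<times> ?D r) \<le> (h_num r)\<^sup>2 * (fact n div fact r) * (n choose r)"
      by (simp add: power2_eq_square ac_simps)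
  qed
  finally have "card (factor_tuples s n) \<le> h_num (n + n)" by (simp only: h_num_double)
  moreover have "finite (factor_tuples s n)"
    unfolding factor_tuples_def by (rule finite_SigmaI) (use C B B' D in auto)
  ultimately show ?thesis by blast
qed

lemma calg_evr: "T \<in> calg (hpar s) (tpar s) n \<Longrightarrow> \<exists>x\<in>carr. evr s x = T"
proof (induction rule: calg.induct)
  case (sc c)
  show ?case by (rule bexI[of _ "const c"]) (simp_all add: ev_simps)
next
  case (g i)
  have "evr s (const (eta s) * g_gen (Suc i)) = sc (eta s * eta s) * op_g (hpar s) i"
    by (simp only: ev_mult ev_simps evr_g sc_arith mult.assoc) simp
  with g show ?case
    by (intro bexI[of _ "const (eta s) * g_gen (Suc i)"]) (auto simp: eta_square sc_arith)
next
  case (e r)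
  then show ?case by (intro bexI[of _ "e_gen r"]) (auto simp: evr_e)
next
  case (add S T)
  then show ?case by (metis add_in_carrier ev_add)
next
  case (mult S T)
  then show ?case by (metis mult_in_carrier ev_mult)
qed

lemma app_evr_sum:
  "finite W \<Longrightarrow> app (evr s (\<Sum>w\<in>W. const (c w) * x w)) f z = (\<Sum>w\<in>W. c w * app (evr s (x w)) f z)"
proof (induction W rule: finite_induct)
  case (insert w W)
  have "app (sc (c w) * evr s (x w)) f z = c w * app (evr s (x w)) f z"
    unfolding sc_central[of "c w"] by simp
  then show ?case using insert by (simp add: ev_add ev_mult ev_simps del: app_simps(6))
qed (simp add: ev_simps)

text \<open>For each involution \<open>w\<close> some \<open>x w\<close> in the algebra realises the
  evaluation at \<open>w\<close>. Applying a vanishing combination to the function supported at one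
  involution isolates the coefficient there.\<close>

lemma independent_family:
  "\<exists>S. finite S \<and> S \<subseteq> carrier (Calg s n) \<and> V.lin_indpt S \<and> card S = h_num (n + n)"
proof -
  let ?W = "involutions (n + n)"
  have "\<exists>x. x \<in> carr \<and> (\<forall>f. app (evr s x) f (parallel n 0) = f w)" if "w \<in> ?W" for w
  proof -
    have "reachable (hpar s) (tpar s) n (\<lambda>f. f w)"
      by (rule reachable_supported[OF tpar_nonzero supported_involutions[OF that]])
    then show ?thesis unfolding reachable_def using calg_evr by metis
  qed
  then obtain x where x: "\<And>w. w \<in> ?W \<Longrightarrow> x w \<in> carr"
    "\<And>w f. w \<in> ?W \<Longrightarrow> app (evr s (x w)) f (parallel n 0) = f w" by metis
  let ?S = "(\<lambda>w. cl (x w)) ` ?W"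
  have inj: "inj_on (\<lambda>w. cl (x w)) ?W"
  proof (rule inj_onI)
    fix v w assume vw: "v \<in> ?W" "w \<in> ?W" "cl (x v) = cl (x w)"
    then have "x v \<approx> x w" using x(1) by (intro class_eqv) auto
    then have "(if v = w then 1 else 0 :: cpq) = 1"
      using x(2)[OF vw(1), of "\<lambda>u. if u = w then 1 else 0"] x(2)[OF vw(2), of "\<lambda>u. if u = w then 1 else 0"]
        evr_eqv by simp
    then show "v = w" by (simp split: if_splits)
  qed
  have fin: "finite ?W" by (rule finite_involutions)
  have S: "finite ?S" "?S \<subseteq> carrier (Calg s n)" using fin x(1) by auto
  moreover have "V.lin_indpt ?S"
  proof
    assume "V.lin_dep ?S"
    then obtain a v where a: "V.lincomb a ?S = \<zero>\<^bsub>Calg s n\<^esub>" "v \<in> ?S" "a v \<noteq> 0"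
      using V.finite_lin_dep[OF S(1) _ S(2)] by auto
    then obtain w where w: "w \<in> ?W" "v = cl (x w)" by blast
    let ?y = "\<Sum>w\<in>?W. const (a (cl (x w))) * x w"
    have "cl ?y = cl 0"
      using a(1) class_lincomb[OF fin inj x(1), of a] class_zero by simp
    moreover have "?y \<in> carr" using x(1) fin by (intro sum_carr) auto
    ultimately have "?y \<approx> 0" by (intro class_eqv) auto
    then have "app (evr s ?y) f (parallel n 0) = 0" for f
      using evr_eqv by (simp add: ev_simps)
    then have "(\<Sum>u\<in>?W. a (cl (x u)) * f u) = 0" for f :: "involution \<Rightarrow> cpq"
      using x(2) by (simp add: app_evr_sum[OF fin])
    from this[of "\<lambda>u. if u = w then 1 else 0"] have "a (cl (x w)) = 0"
      using w fin by (simp add: if_distrib cong: if_cong)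
    then show False using a w by simp
  qed
  moreover have "card ?S = h_num (n + n)"
    using card_image[OF inj] by (simp add: card_involutions)
  ultimately show ?thesis by blast
qed

text \<open>Equality holds throughout the chain from the lower bound over the dimension and the size
  of the spanning set to the number of tuples. The last equality makes the indexing by tuples
  injective.\<close>

lemma basis_and_dimension:
  "V.basis (basis_set s n) \<and> inj_on (tuple_product s n) (factor_tuples s n)
    \<and> V.fin_dim \<and> V.dim = h_num (n + n)"
proof -
  let ?B = "basis_set s n"
  note tuples = card_factor_tuples[THEN conjunct1] card_factor_tuples[THEN conjunct2]
  have B: "finite ?B" "card ?B \<le> card (factor_tuples s n)"
    unfolding basis_set_eq_image using tuples card_image_le by auto
  obtain S where S: "finite S" "S \<subseteq> carrier (Calg s n)" "V.lin_indpt S" "card S = h_num (n + n)"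
    using independent_family by blast
  have fd: "V.fin_dim"
    unfolding V.fin_dim_def using B basis_set_carrier span_basis_set by blast
  have le: "h_num (n + n) \<le> V.dim" "V.dim \<le> card ?B"
    using V.li_le_dim(2)[OF fd S(2,3)] S(4) V.gen_ge_dim[OF B(1) basis_set_carrier span_basis_set] by auto
  have "V.basis ?B"
    by (rule V.dim_gen_is_basis[OF B(1) basis_set_carrier span_basis_set])
      (use le B(2) tuples(2) in linarith)
  moreover have "inj_on (tuple_product s n) (factor_tuples s n)"
    by (rule eq_card_imp_inj_on[OF tuples(1)])
      (use le B(2) tuples(2) basis_set_eq_image[of s n] in simp)
  moreover have "V.dim = h_num (n + n)" using le B(2) tuples(2) by linarith
  ultimately show ?thesis using fd by blast
qed

end

theorem theorem3p7:
  fixes n :: nat and s :: variant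
  assumes "n \<ge> 1"
  shows "vectorspace.basis class_ring (Calg s n) (basis_set s n)
    \<and> inj_on (tuple_product s n) (factor_tuples s n)
    \<and> vectorspace.fin_dim class_ring (Calg s n)
    \<and> vectorspace.dim class_ring (Calg s n)
        = (\<Sum>r = 0..n. (h_num r)\<^sup>2 * (fact n div fact r) * (n choose r))"
  using presentation.basis_and_dimension[of s n] by (simp only: h_num_double)

end
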